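(* Let $K$ be a field, let $A$ be a basic finite dimensional $K$-algebra of finite global dimension, and let $\Delta(A)$ be the trivial extension of $A$. Then $$\det C_{\Delta(A)}(x)=\phi_A(x)\det C_A,$$ where $C_{\Delta(A)}(x)$ is the graded Cartan matrix of $\Delta(A)$, $C_A$ is the Cartan matrix of $A$ and $\phi_A(x)$ is the Coxeter polynomial of $A$.
   Context: The trivial extension is $\Delta(A)=A\oplus DA$ with $DA=\mathrm{Hom}_K(A,K)$ and multiplication $(a,f)(b,g)=(ab,ag+fb)$, graded with $A$ in degree $0$ and $DA$ in degree $1$. For a graded algebra $\Lambda$ with $\Lambda_0$ basic and $e_1,\dots,e_n\in\Lambda_0$ a complete list of primitive orthogonal idempotents, the graded Cartan matrix is $C_\Lambda(x)=\sum_kC^{(k)}x^k$ with $C^{(k)}_{i,j}=\dim_K(e_i\Lambda_ke_j)$. The Cartan matrix $C_A$ is the case of $A$ concentrated in degree $0$: $(C_A)_{i,j}=\dim_K(e_iAe_j)$ (the same ordered idempotents are used for $\Delta(A)$). The Coxeter matrix of $A$ is $\Phi_A=-C_A^TC_A^{-1}$, and the Coxeter polynomial $\phi_A(x)=\det(xI-\Phi_A)$ is its characteristic polynomial. *)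

theory Defs
  imports
    "Jordan_Normal_Form.Missing_VectorSpace"
    "Jordan_Normal_Form.Char_Poly"
    "Jordan_Normal_Form.Gauss_Jordan_Elimination"
    "HOL-Library.Extended_Nat"
begin

section \<open>Finite dimensional algebras\<close>

text \<open>The locale \<^locale>\<open>algebra\<close> of the library is about commutative algebras, so we introduce
  associative unital algebras that need not be commutative.\<close>

locale k_algebra = vectorspace K A + alg?: ring A
  for K and A (structure) +
  assumes smult_mult_left:
      "\<lbrakk>c \<in> carrier K; x \<in> carrier A; y \<in> carrier A\<rbrakk>
        \<Longrightarrow> (c \<odot> x) \<otimes> y = c \<odot> (x \<otimes> y)"
    and smult_mult_right:
      "\<lbrakk>c \<in> carrier K; x \<in> carrier A; y \<in> carrier A\<rbrakk>
        \<Longrightarrow> x \<otimes> (c \<odot> y) = c \<odot> (x \<otimes> y)"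

locale fin_dim_algebra = k_algebra +
  assumes fin_dim: "fin_dim"


section \<open>Left modules\<close>

text \<open>The same axioms as in \<^locale>\<open>Module.module\<close>, which requires a commutative ring. The inherited
  record fields \<^const>\<open>monoid.mult\<close> and \<^const>\<open>one\<close> of a module are irrelevant here.
  Homomorphisms are given by \<^const>\<open>LinearCombinations.module_hom\<close>, whose definition does not use
  commutativity.\<close>

locale left_module = R?: ring R + M?: abelian_group M for R :: "('a, 'c) ring_scheme" and M :: "('a, 'm, 'd) module_scheme" (structure) +
  assumes smult_closed:
      "\<lbrakk>a \<in> carrier R; x \<in> carrier M\<rbrakk> \<Longrightarrow> a \<odot> x \<in> carrier M"
    and smult_l_distr:
      "\<lbrakk>a \<in> carrier R; b \<in> carrier R; x \<in> carrier M\<rbrakk>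
        \<Longrightarrow> (a \<oplus>\<^bsub>R\<^esub> b) \<odot> x = a \<odot> x \<oplus> b \<odot> x"
    and smult_r_distr:
      "\<lbrakk>a \<in> carrier R; x \<in> carrier M; y \<in> carrier M\<rbrakk>
        \<Longrightarrow> a \<odot> (x \<oplus> y) = a \<odot> x \<oplus> a \<odot> y"
    and smult_assoc:
      "\<lbrakk>a \<in> carrier R; b \<in> carrier R; x \<in> carrier M\<rbrakk>
        \<Longrightarrow> (a \<otimes>\<^bsub>R\<^esub> b) \<odot> x = a \<odot> (b \<odot> x)"
    and smult_one: "x \<in> carrier M \<Longrightarrow> \<one>\<^bsub>R\<^esub> \<odot> x = x"

definition regular_module :: "('a, 'c) ring_scheme \<Rightarrow> ('a, 'a) module" where
  "regular_module R =
    \<lparr>carrier = carrier R, monoid.mult = monoid.mult R, one = one R, zero = zero R, add = add R,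
     module.smult = monoid.mult R\<rparr>"

definition principal_left_module :: "('a, 'c) ring_scheme \<Rightarrow> 'a \<Rightarrow> ('a, 'a) module" where
  "principal_left_module R e =
    (regular_module R)\<lparr>carrier := (\<lambda>a. a \<otimes>\<^bsub>R\<^esub> e) ` carrier R\<rparr>"

definition module_isomorphic ::
  "('a, 'c) ring_scheme \<Rightarrow> ('a, 'm) module \<Rightarrow> ('a, 'n) module \<Rightarrow> bool" where
  "module_isomorphic R M N \<longleftrightarrow>
    (\<exists>f \<in> LinearCombinations.module_hom R M N. bij_betw f (carrier M) (carrier N))"

definition fin_gen_module :: "('a, 'c) ring_scheme \<Rightarrow> ('a, 'm) module \<Rightarrow> bool" where
  "fin_gen_module R M \<longleftrightarrow> left_module R M \<and>
    (\<exists>S. finite S \<and> S \<subseteq> carrier M \<and>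
      (\<forall>m \<in> carrier M. \<exists>c \<in> S \<rightarrow> carrier R. m = (\<Oplus>\<^bsub>M\<^esub> s \<in> S. c s \<odot>\<^bsub>M\<^esub> s)))"


section \<open>Global dimension\<close>

text \<open>The test modules \<open>M\<close> and \<open>N\<close> live on the same type \<open>'m\<close> as \<open>P\<close>. For
  the type used in \<open>gl_dim\<close> below this is no restriction: it contains a copy of a free module
  mapping onto \<open>P\<close>, so the lifting property makes \<open>P\<close> a direct summand of it.\<close>

definition projective_module :: "('a, 'c) ring_scheme \<Rightarrow> ('a, 'm) module \<Rightarrow> bool" where
  "projective_module R P \<longleftrightarrow> left_module R P \<and>
    (\<forall>(M :: ('a, 'm) module) (N :: ('a, 'm) module) g h.
      left_module R M \<and> left_module R N \<and>
      g \<in> LinearCombinations.module_hom R M N \<and> g ` carrier M = carrier N \<and>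
      h \<in> LinearCombinations.module_hom R P N
      \<longrightarrow> (\<exists>h' \<in> LinearCombinations.module_hom R P M. \<forall>x \<in> carrier P. g (h' x) = h x))"

text \<open>An exact sequence \<open>0 \<rightarrow> P\<^sub>d \<rightarrow> \<dots> \<rightarrow> P\<^sub>1 \<rightarrow> P\<^sub>0 \<rightarrow> M \<rightarrow> 0\<close>
  of finitely generated left modules with all \<open>P\<^sub>i\<close> projective, written as an infinite
  sequence that vanishes beyond \<open>d\<close>; \<open>\<delta> i\<close> maps \<open>P (Suc i)\<close> to \<open>P i\<close>.
  As usual for finite dimensional algebras, everything takes place in the category of finitely
  generated modules; since these algebras are Noetherian, this does not change projective
  dimensions of finitely generated modules.\<close>

definition has_projective_resolution ::
  "('a, 'c) ring_scheme \<Rightarrow> ('a, 'm) module \<Rightarrow> nat \<Rightarrow> bool" where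
  "has_projective_resolution R M d \<longleftrightarrow>
    (\<exists>(P :: nat \<Rightarrow> ('a, 'm) module) \<delta> \<epsilon>.
      (\<forall>i. fin_gen_module R (P i) \<and> projective_module R (P i)) \<and>
      (\<forall>i > d. carrier (P i) = {\<zero>\<^bsub>P i\<^esub>}) \<and>
      \<epsilon> \<in> LinearCombinations.module_hom R (P 0) M \<and>
      (\<forall>i. \<delta> i \<in> LinearCombinations.module_hom R (P (Suc i)) (P i)) \<and>
      \<epsilon> ` carrier (P 0) = carrier M \<and>
      \<delta> 0 ` carrier (P (Suc 0)) = {x \<in> carrier (P 0). \<epsilon> x = \<zero>\<^bsub>M\<^esub>} \<and>
      (\<forall>i. \<delta> (Suc i) ` carrier (P (Suc (Suc i))) =
        {x \<in> carrier (P (Suc i)). \<delta> i x = \<zero>\<^bsub>P i\<^esub>}))"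

definition proj_dim :: "('a, 'c) ring_scheme \<Rightarrow> ('a, 'm) module \<Rightarrow> enat" where
  "proj_dim R M = (INF d \<in> {d. has_projective_resolution R M d}. enat d)"

text \<open>Left global dimension. Every finitely generated left module is isomorphic to a
  quotient \<open>R\<^sup>m/U\<close>, whose elements are cosets, i.e. sets of vectors in
  \<open>R\<^sup>m\<close>. Hence modules on the type \<open>(nat \<Rightarrow> 'a) set\<close> represent all finitely
  generated modules (and all finitely generated free ones) up to isomorphism.
  For finite dimensional algebras the left and right global dimension agree and are computed by
  finitely generated modules.\<close>

definition gl_dim :: "('a, 'c) ring_scheme \<Rightarrow> enat" where
  "gl_dim R = (SUP M \<in> {M :: ('a, (nat \<Rightarrow> 'a) set) module. fin_gen_module R M}. proj_dim R M)"


section \<open>Primitive orthogonal idempotents and basic algebras\<close>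

definition idempotent_elem :: "('a, 'c) ring_scheme \<Rightarrow> 'a \<Rightarrow> bool" where
  "idempotent_elem R x \<longleftrightarrow> x \<in> carrier R \<and> x \<otimes>\<^bsub>R\<^esub> x = x"

definition primitive_idempotent :: "('a, 'c) ring_scheme \<Rightarrow> 'a \<Rightarrow> bool" where
  "primitive_idempotent R x \<longleftrightarrow> idempotent_elem R x \<and> x \<noteq> \<zero>\<^bsub>R\<^esub> \<and>
    (\<forall>y z. idempotent_elem R y \<and> idempotent_elem R z \<and>
      y \<otimes>\<^bsub>R\<^esub> z = \<zero>\<^bsub>R\<^esub> \<and> z \<otimes>\<^bsub>R\<^esub> y = \<zero>\<^bsub>R\<^esub> \<and> x = y \<oplus>\<^bsub>R\<^esub> z
      \<longrightarrow> y = \<zero>\<^bsub>R\<^esub> \<or> z = \<zero>\<^bsub>R\<^esub>)"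

text \<open>The idempotents \<open>e\<^sub>1, \<dots>, e\<^sub>n\<close> are indexed as \<open>e 0, \<dots>, e (n - 1)\<close>.\<close>

definition complete_primitive_idempotents ::
  "('a, 'c) ring_scheme \<Rightarrow> nat \<Rightarrow> (nat \<Rightarrow> 'a) \<Rightarrow> bool" where
  "complete_primitive_idempotents R n e \<longleftrightarrow>
    (\<forall>i < n. primitive_idempotent R (e i)) \<and>
    (\<forall>i < n. \<forall>j < n. i \<noteq> j \<longrightarrow> e i \<otimes>\<^bsub>R\<^esub> e j = \<zero>\<^bsub>R\<^esub>) \<and>
    (\<Oplus>\<^bsub>R\<^esub> i \<in> {..<n}. e i) = \<one>\<^bsub>R\<^esub>"

text \<open>An algebra with a complete list of primitive orthogonal idempotents is basic if the
  modules \<open>A e\<^sub>i\<close> are pairwise non-isomorphic. By the Krull-Schmidt theorem this does not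
  depend on the list, and left and right modules give the same notion.\<close>

definition basic_algebra :: "('a, 'c) ring_scheme \<Rightarrow> nat \<Rightarrow> (nat \<Rightarrow> 'a) \<Rightarrow> bool" where
  "basic_algebra R n e \<longleftrightarrow> complete_primitive_idempotents R n e \<and>
    (\<forall>i < n. \<forall>j < n. i \<noteq> j \<longrightarrow>
      \<not> module_isomorphic R (principal_left_module R (e i)) (principal_left_module R (e j)))"


section \<open>The trivial extension\<close>

definition dual_space ::
  "('k, 'd) ring_scheme \<Rightarrow> ('k, 'a, 'c) module_scheme \<Rightarrow> ('k, 'a \<Rightarrow> 'k) module" where
  "dual_space K A = (ring.func_space K (carrier A))
    \<lparr>carrier := LinearCombinations.module_hom K A (regular_module K) \<inter> extensional (carrier A)\<rparr>"

text \<open>The bimodule structure of \<open>DA\<close> is \<open>(a g) x = g (x a)\<close> and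
  \<open>(f b) x = f (b x)\<close>.\<close>

definition trivial_extension ::
  "('k, 'd) ring_scheme \<Rightarrow> ('k, 'a, 'c) module_scheme \<Rightarrow> ('k, 'a \<times> ('a \<Rightarrow> 'k)) module" where
  "trivial_extension K A = (direct_sum A (dual_space K A))
    \<lparr>monoid.mult := (\<lambda>(a, f) (b, g).
        (a \<otimes>\<^bsub>A\<^esub> b,
         (\<lambda>x \<in> carrier A. g (x \<otimes>\<^bsub>A\<^esub> a)) \<oplus>\<^bsub>dual_space K A\<^esub>
         (\<lambda>x \<in> carrier A. f (b \<otimes>\<^bsub>A\<^esub> x)))),
     one := (\<one>\<^bsub>A\<^esub>, \<zero>\<^bsub>dual_space K A\<^esub>)\<rparr>"

definition trivial_extension_grading ::
  "('k, 'd) ring_scheme \<Rightarrow> ('k, 'a, 'c) module_scheme \<Rightarrow> nat \<Rightarrow> ('a \<times> ('a \<Rightarrow> 'k)) set" where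
  "trivial_extension_grading K A k =
    (if k = 0 then carrier A \<times> {\<zero>\<^bsub>dual_space K A\<^esub>}
     else if k = 1 then {\<zero>\<^bsub>A\<^esub>} \<times> carrier (dual_space K A)
     else {(\<zero>\<^bsub>A\<^esub>, \<zero>\<^bsub>dual_space K A\<^esub>)})"


section \<open>Cartan and Coxeter matrices\<close>

definition peirce_dim ::
  "('k, 'd) ring_scheme \<Rightarrow> ('k, 'a, 'c) module_scheme \<Rightarrow> 'a \<Rightarrow> 'a set \<Rightarrow> 'a \<Rightarrow> nat" where
  "peirce_dim K L e S f =
    vectorspace.dim K (L\<lparr>carrier := (\<lambda>x. e \<otimes>\<^bsub>L\<^esub> x \<otimes>\<^bsub>L\<^esub> f) ` S\<rparr>)"

text \<open>The argument \<open>\<Lambda>\<close> lists the homogeneous components of \<open>L\<close>. The sum is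
  finite whenever only finitely many of them are nonzero, as is the case for every grading of a
  finite dimensional algebra.\<close>

definition graded_cartan_mat ::
  "('k, 'd) ring_scheme \<Rightarrow> ('k, 'a, 'c) module_scheme \<Rightarrow> (nat \<Rightarrow> 'a set) \<Rightarrow>
    nat \<Rightarrow> (nat \<Rightarrow> 'a) \<Rightarrow> rat poly mat" where
  "graded_cartan_mat K L \<Lambda> n e = mat n n (\<lambda>(i, j).
    \<Sum>k | \<Lambda> k \<noteq> {\<zero>\<^bsub>L\<^esub>}. monom (of_nat (peirce_dim K L (e i) (\<Lambda> k) (e j))) k)"

definition cartan_mat ::
  "('k, 'd) ring_scheme \<Rightarrow> ('k, 'a, 'c) module_scheme \<Rightarrow> nat \<Rightarrow> (nat \<Rightarrow> 'a) \<Rightarrow> rat mat" where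
  "cartan_mat K A n e = mat n n (\<lambda>(i, j). of_nat (peirce_dim K A (e i) (carrier A) (e j)))"

text \<open>Meaningful only if the Cartan matrix is invertible over the rationals, which holds for
  algebras of finite global dimension; over an arbitrary field its determinant need not
  be \<open>\<plusminus> 1\<close>.\<close>

definition coxeter_mat ::
  "('k, 'd) ring_scheme \<Rightarrow> ('k, 'a, 'c) module_scheme \<Rightarrow> nat \<Rightarrow> (nat \<Rightarrow> 'a) \<Rightarrow> rat mat" where
  "coxeter_mat K A n e =
    - (transpose_mat (cartan_mat K A n e) * the (mat_inverse (cartan_mat K A n e)))"

definition coxeter_poly ::
  "('k, 'd) ring_scheme \<Rightarrow> ('k, 'a, 'c) module_scheme \<Rightarrow> nat \<Rightarrow> (nat \<Rightarrow> 'a) \<Rightarrow> rat poly" where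
  "coxeter_poly K A n e = char_poly (coxeter_mat K A n e)"

end

theory Submission
  imports Defs
begin

text \<open>Write \<open>C\<close> for the Cartan matrix of \<open>A\<close>. The space \<open>e\<^sub>i (DA) e\<^sub>j\<close> is the dual of \<open>e\<^sub>j A e\<^sub>i\<close>, so the graded
  Cartan matrix of the trivial extension is \<open>C + x C\<^sup>T\<close> (\<open>graded_cartan_trivial_extension\<close>). Its
  transpose is \<open>x C + C\<^sup>T = (x I + C\<^sup>T C\<^sup>-\<^sup>1) C = (x I - \<Phi>) C\<close>, and taking determinants gives the claim
  (\<open>det_pencil_coxeter\<close>), provided that \<open>C\<close> is invertible over the rationals.

  Invertibility of \<open>C\<close> is where finite global dimension is needed (\<open>cartan_rows_independent\<close>). Over a
  field that is not algebraically closed the simple modules need not be one-dimensional, so that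
  \<open>det C\<close> need not be \<open>\<plusminus>1\<close>, but the usual argument still shows that it is nonzero: the columns of \<open>C\<close>
  are the dimension vectors of the projectives \<open>A e\<^sub>k\<close>, projective resolutions express all dimension
  vectors by these, and the dimension vectors of the simple modules are positive multiples of the
  unit vectors. In dual form, let the row vector \<open>x\<close> annihilate \<open>C\<close> and give a module \<open>M\<close> the weight
  \<open>\<Sum>\<^sub>j x\<^sub>j dim e\<^sub>j M\<close>. Weights are additive on exact sequences and vanish on the \<open>A e\<^sub>k\<close>. Hence they vanish
  on finite dimensional projectives (\<open>corner_weight_projective\<close>), then on all modules with finite
  projective resolutions, in particular on the radical of \<open>A e\<^sub>k\<close>. The dimension vectors of
  \<open>A e\<^sub>k\<close> and of its radical differ only in the \<open>k\<close>-th entry (\<open>corner_dim_radical\<close>), so \<open>x\<^sub>k = 0\<close>.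

  The structure theory this requires is obtained directly. The radical of \<open>A e\<close>, for a primitive
  idempotent \<open>e\<close>, consists of the elements that do not generate \<open>A e\<close>; it is a submodule because
  \<open>e A e\<close> is local, by the argument of Fitting's lemma (\<open>primitive_corner_local\<close>). A nonzero finite
  dimensional projective \<open>P\<close> maps onto some \<open>A e\<^sub>k\<close> (\<open>projective_maps_onto_principal\<close>), with
  projective kernel of smaller dimension; this induction takes the place of the Krull-Schmidt
  theorem.\<close>

section \<open>Left modules\<close>

context left_module
begin

lemma zero_smult: "x \<in> carrier M \<Longrightarrow> \<zero>\<^bsub>R\<^esub> \<odot> x = \<zero>"
proof -
  assume x: "x \<in> carrier M"
  have "\<zero>\<^bsub>R\<^esub> \<odot> x \<oplus> \<zero>\<^bsub>R\<^esub> \<odot> x = \<zero>\<^bsub>R\<^esub> \<odot> x"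
    using smult_l_distr[of "\<zero>\<^bsub>R\<^esub>" "\<zero>\<^bsub>R\<^esub>" x] x by simp
  then show ?thesis
    using x smult_closed[of "\<zero>\<^bsub>R\<^esub>" x] by (simp add: M.add.r_cancel_one')
qed

lemma smult_zero: "a \<in> carrier R \<Longrightarrow> a \<odot> \<zero> = \<zero>"
proof -
  assume a: "a \<in> carrier R"
  have "a \<odot> \<zero> \<oplus> a \<odot> \<zero> = a \<odot> \<zero>"
    using smult_r_distr[of a \<zero> \<zero>] a by simp
  then show ?thesis
    using a smult_closed[of a \<zero>] by (simp add: M.add.r_cancel_one')
qed

lemma smult_l_minus: "a \<in> carrier R \<Longrightarrow> x \<in> carrier M \<Longrightarrow> (\<ominus>\<^bsub>R\<^esub> a) \<odot> x = \<ominus> (a \<odot> x)"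
proof -
  assume a: "a \<in> carrier R" and x: "x \<in> carrier M"
  have "(\<ominus>\<^bsub>R\<^esub> a) \<odot> x \<oplus> a \<odot> x = \<zero>"
    using smult_l_distr[of "\<ominus>\<^bsub>R\<^esub> a" a x] a x by (simp add: R.l_neg zero_smult)
  then show ?thesis
    using a x smult_closed by (metis M.minus_equality R.a_inv_closed)
qed

lemma smult_r_minus: "a \<in> carrier R \<Longrightarrow> x \<in> carrier M \<Longrightarrow> a \<odot> (\<ominus> x) = \<ominus> (a \<odot> x)"
proof -
  assume a: "a \<in> carrier R" and x: "x \<in> carrier M"
  have "a \<odot> (\<ominus> x) \<oplus> a \<odot> x = \<zero>"
    using smult_r_distr[of a "\<ominus> x" x] a x by (simp add: M.l_neg smult_zero)
  then show ?thesis
    using a x smult_closed by (metis M.minus_equality M.a_inv_closed)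
qed

lemma minus_as_smult: "x \<in> carrier M \<Longrightarrow> \<ominus> x = (\<ominus>\<^bsub>R\<^esub> \<one>\<^bsub>R\<^esub>) \<odot> x"
  by (simp add: smult_l_minus smult_one)

end

lemma left_moduleI:
  fixes R :: "('a, 'c) ring_scheme" and M :: "('a, 'm, 'd) module_scheme"
  assumes "ring R"
    and "\<zero>\<^bsub>M\<^esub> \<in> carrier M"
    and "\<And>x y. x \<in> carrier M \<Longrightarrow> y \<in> carrier M \<Longrightarrow> x \<oplus>\<^bsub>M\<^esub> y \<in> carrier M"
    and "\<And>a x. a \<in> carrier R \<Longrightarrow> x \<in> carrier M \<Longrightarrow> a \<odot>\<^bsub>M\<^esub> x \<in> carrier M"
    and "\<And>x y z. x \<in> carrier M \<Longrightarrow> y \<in> carrier M \<Longrightarrow> z \<in> carrier M \<Longrightarrow>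
      (x \<oplus>\<^bsub>M\<^esub> y) \<oplus>\<^bsub>M\<^esub> z = x \<oplus>\<^bsub>M\<^esub> (y \<oplus>\<^bsub>M\<^esub> z)"
    and "\<And>x y. x \<in> carrier M \<Longrightarrow> y \<in> carrier M \<Longrightarrow> x \<oplus>\<^bsub>M\<^esub> y = y \<oplus>\<^bsub>M\<^esub> x"
    and "\<And>x. x \<in> carrier M \<Longrightarrow> \<zero>\<^bsub>M\<^esub> \<oplus>\<^bsub>M\<^esub> x = x"
    and "\<And>x. x \<in> carrier M \<Longrightarrow> \<exists>y\<in>carrier M. y \<oplus>\<^bsub>M\<^esub> x = \<zero>\<^bsub>M\<^esub>"
    and "\<And>a b x. a \<in> carrier R \<Longrightarrow> b \<in> carrier R \<Longrightarrow> x \<in> carrier M \<Longrightarrow>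
      (a \<oplus>\<^bsub>R\<^esub> b) \<odot>\<^bsub>M\<^esub> x = a \<odot>\<^bsub>M\<^esub> x \<oplus>\<^bsub>M\<^esub> b \<odot>\<^bsub>M\<^esub> x"
    and "\<And>a x y. a \<in> carrier R \<Longrightarrow> x \<in> carrier M \<Longrightarrow> y \<in> carrier M \<Longrightarrow>
      a \<odot>\<^bsub>M\<^esub> (x \<oplus>\<^bsub>M\<^esub> y) = a \<odot>\<^bsub>M\<^esub> x \<oplus>\<^bsub>M\<^esub> a \<odot>\<^bsub>M\<^esub> y"
    and "\<And>a b x. a \<in> carrier R \<Longrightarrow> b \<in> carrier R \<Longrightarrow> x \<in> carrier M \<Longrightarrow>
      (a \<otimes>\<^bsub>R\<^esub> b) \<odot>\<^bsub>M\<^esub> x = a \<odot>\<^bsub>M\<^esub> (b \<odot>\<^bsub>M\<^esub> x)"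
    and "\<And>x. x \<in> carrier M \<Longrightarrow> \<one>\<^bsub>R\<^esub> \<odot>\<^bsub>M\<^esub> x = x"
  shows "left_module R M"
proof -
  have "abelian_group M"
    by (rule abelian_groupI) (use assms in auto)
  then show ?thesis
    unfolding left_module_def left_module_axioms_def using assms by auto
qed

definition left_submodule ::
  "('a, 'c) ring_scheme \<Rightarrow> 'm set \<Rightarrow> ('a, 'm) module \<Rightarrow> bool" where
  "left_submodule R U M \<longleftrightarrow> U \<subseteq> carrier M \<and> \<zero>\<^bsub>M\<^esub> \<in> U \<and>
    (\<forall>x\<in>U. \<forall>y\<in>U. x \<oplus>\<^bsub>M\<^esub> y \<in> U) \<and> (\<forall>a\<in>carrier R. \<forall>x\<in>U. a \<odot>\<^bsub>M\<^esub> x \<in> U)"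

lemma left_submoduleD:
  assumes "left_submodule R U M"
  shows "U \<subseteq> carrier M" "\<zero>\<^bsub>M\<^esub> \<in> U" "x \<in> U \<Longrightarrow> x \<in> carrier M"
    "x \<in> U \<Longrightarrow> y \<in> U \<Longrightarrow> x \<oplus>\<^bsub>M\<^esub> y \<in> U" "a \<in> carrier R \<Longrightarrow> x \<in> U \<Longrightarrow> a \<odot>\<^bsub>M\<^esub> x \<in> U"
  using assms unfolding left_submodule_def by auto

lemma left_submodule_minus:
  assumes "left_module R M" "left_submodule R U M"
  shows "x \<in> U \<Longrightarrow> \<ominus>\<^bsub>M\<^esub> x \<in> U" "x \<in> U \<Longrightarrow> y \<in> U \<Longrightarrow> x \<ominus>\<^bsub>M\<^esub> y \<in> U"
proof -
  interpret left_module R M by fact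
  show *: "x \<in> U \<Longrightarrow> \<ominus>\<^bsub>M\<^esub> x \<in> U" for x
    using left_submoduleD[OF assms(2)] by (simp add: minus_as_smult)
  show "x \<in> U \<Longrightarrow> y \<in> U \<Longrightarrow> x \<ominus>\<^bsub>M\<^esub> y \<in> U"
    using left_submoduleD[OF assms(2)] * by (simp add: a_minus_def)
qed

lemma left_module_restrict:
  assumes "left_module R M" "left_submodule R U M"
  shows "left_module R (M\<lparr>carrier := U\<rparr>)"
proof -
  interpret left_module R M by fact
  note D = left_submoduleD[OF assms(2)]
  show ?thesis
  proof (rule left_moduleI)
    show "ring R" by (rule R.ring_axioms)
    show "\<exists>y\<in>carrier (M\<lparr>carrier := U\<rparr>). y \<oplus>\<^bsub>M\<lparr>carrier := U\<rparr>\<^esub> x = \<zero>\<^bsub>M\<lparr>carrier := U\<rparr>\<^esub>"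
      if "x \<in> carrier (M\<lparr>carrier := U\<rparr>)" for x
      using that left_submodule_minus(1)[OF assms] D(3) M.l_neg
      by (auto intro!: bexI[of _ "\<ominus>\<^bsub>M\<^esub> x"])
  qed (simp_all add: D(2-5) M.a_ac smult_l_distr smult_r_distr smult_assoc smult_one)
qed

lemma left_module_hom_zero:
  assumes "left_module R M" "left_module R N" "f \<in> LinearCombinations.module_hom R M N"
  shows "f \<zero>\<^bsub>M\<^esub> = \<zero>\<^bsub>N\<^esub>"
    and "x \<in> carrier M \<Longrightarrow> f (\<ominus>\<^bsub>M\<^esub> x) = \<ominus>\<^bsub>N\<^esub> f x"
    and "x \<in> carrier M \<Longrightarrow> y \<in> carrier M \<Longrightarrow> f (x \<ominus>\<^bsub>M\<^esub> y) = f x \<ominus>\<^bsub>N\<^esub> f y"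
proof -
  interpret M: left_module R M by fact
  interpret N: left_module R N by fact
  have cl: "f x \<in> carrier N" if "x \<in> carrier M" for x
    using LinearCombinations.module_hom_closed[OF assms(3)] that by auto
  have "f \<zero>\<^bsub>M\<^esub> = f (\<zero>\<^bsub>R\<^esub> \<odot>\<^bsub>M\<^esub> \<zero>\<^bsub>M\<^esub>)" by (simp add: M.smult_zero)
  also have "\<dots> = \<zero>\<^bsub>R\<^esub> \<odot>\<^bsub>N\<^esub> f \<zero>\<^bsub>M\<^esub>" by (rule LinearCombinations.module_hom_smult[OF assms(3)]) auto
  finally show "f \<zero>\<^bsub>M\<^esub> = \<zero>\<^bsub>N\<^esub>" using cl by (simp add: N.zero_smult)
  show *: "f (\<ominus>\<^bsub>M\<^esub> x) = \<ominus>\<^bsub>N\<^esub> f x" if "x \<in> carrier M" for x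
    using that cl LinearCombinations.module_hom_smult[OF assms(3)] by (simp add: M.minus_as_smult N.minus_as_smult)
  show "x \<in> carrier M \<Longrightarrow> y \<in> carrier M \<Longrightarrow> f (x \<ominus>\<^bsub>M\<^esub> y) = f x \<ominus>\<^bsub>N\<^esub> f y"
    using cl * LinearCombinations.module_hom_add[OF assms(3)] by (simp add: a_minus_def)
qed

definition hom_kernel :: "('m \<Rightarrow> 'n) \<Rightarrow> ('a, 'm) module \<Rightarrow> ('a, 'n) module \<Rightarrow> 'm set" where
  "hom_kernel f M N = {x \<in> carrier M. f x = \<zero>\<^bsub>N\<^esub>}"

lemma left_submodule_hom_kernel:
  assumes "left_module R M" "left_module R N" "f \<in> LinearCombinations.module_hom R M N"
  shows "left_submodule R (hom_kernel f M N) M"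
proof -
  interpret M: left_module R M by fact
  interpret N: left_module R N by fact
  show ?thesis
    unfolding left_submodule_def hom_kernel_def
    using left_module_hom_zero(1)[OF assms] LinearCombinations.module_hom_add[OF assms(3)] LinearCombinations.module_hom_smult[OF assms(3)]
    by (auto simp: M.smult_closed N.smult_zero)
qed

lemma left_submodule_hom_image:
  assumes "left_module R M" "left_module R N" "f \<in> LinearCombinations.module_hom R M N"
    and "left_submodule R U M"
  shows "left_submodule R (f ` U) N"
proof -
  interpret M: left_module R M by fact
  interpret N: left_module R N by fact
  note D = left_submoduleD[OF assms(4)]
  have "f x \<oplus>\<^bsub>N\<^esub> f y \<in> f ` U" if "x \<in> U" "y \<in> U" for x y
    using LinearCombinations.module_hom_add[OF assms(3), of x y] that D by (metis imageI)
  moreover have "a \<odot>\<^bsub>N\<^esub> f x \<in> f ` U" if "x \<in> U" "a \<in> carrier R" for x a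
    using LinearCombinations.module_hom_smult[OF assms(3), of a x] that D by (metis imageI)
  moreover have "\<zero>\<^bsub>N\<^esub> \<in> f ` U"
    using left_module_hom_zero(1)[OF assms(1-3)] D(2) by (metis imageI)
  ultimately show ?thesis
    unfolding left_submodule_def using LinearCombinations.module_hom_closed[OF assms(3)] D(1) by auto
qed

lemma left_submodule_carrier: "left_module R M \<Longrightarrow> left_submodule R (carrier M) M"
proof -
  assume "left_module R M"
  then interpret left_module R M .
  show ?thesis unfolding left_submodule_def by (auto simp: smult_closed)
qed

lemma module_hom_corestrict:
  "f \<in> LinearCombinations.module_hom R M N \<Longrightarrow> U \<subseteq> carrier M \<Longrightarrow> f ` U \<subseteq> V \<Longrightarrow>
    f \<in> LinearCombinations.module_hom R (M\<lparr>carrier := U\<rparr>) (N\<lparr>carrier := V\<rparr>)"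
  by (auto simp: LinearCombinations.module_hom_def subset_iff)

lemma module_hom_comp:
  "f \<in> LinearCombinations.module_hom R M N \<Longrightarrow> g \<in> LinearCombinations.module_hom R N L \<Longrightarrow>
    (\<lambda>x. g (f x)) \<in> LinearCombinations.module_hom R M L"
  by (auto simp: LinearCombinations.module_hom_def Pi_iff)

text \<open>Projectivity and global dimension quantify over modules on one fixed type. This construction
  brings modules to that type: with an injective \<open>q\<close> it copies a module, and with a choice of
  coset representatives for \<open>q\<close> it yields a quotient module on the type of the original one.\<close>

lemma coset_map_image_module:
  fixes M :: "('a, 'm) module" and q :: "'m \<Rightarrow> 'n"
  assumes M: "left_module R M" and U: "left_submodule R U M"
    and q: "\<And>x y. x \<in> carrier M \<Longrightarrow> y \<in> carrier M \<Longrightarrow> q x = q y \<longleftrightarrow> x \<ominus>\<^bsub>M\<^esub> y \<in> U"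
  obtains N :: "('a, 'n) module" where "left_module R N" "q \<in> LinearCombinations.module_hom R M N"
    "q ` carrier M = carrier N"
proof -
  interpret left_module R M by fact
  note D = left_submoduleD[OF U]
  define s where "s = inv_into (carrier M) q"
  have s: "s u \<in> carrier M" "q (s u) = u" if "u \<in> q ` carrier M" for u
    using that unfolding s_def by (auto intro: inv_into_into f_inv_into_f)
  \<comment> \<open>Addition and scalar multiplication do not depend on the preimages chosen by \<open>s\<close>; the two fields
    of the record that belong to rings are arbitrary.\<close>
  define N where "N = \<lparr>carrier = q ` carrier M, monoid.mult = (\<lambda>u v. u), one = q \<zero>\<^bsub>M\<^esub>,
     zero = q \<zero>\<^bsub>M\<^esub>, add = (\<lambda>u v. q (s u \<oplus>\<^bsub>M\<^esub> s v)), module.smult = (\<lambda>a u. q (a \<odot>\<^bsub>M\<^esub> s u))\<rparr>"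
  have add: "q x \<oplus>\<^bsub>N\<^esub> q y = q (x \<oplus>\<^bsub>M\<^esub> y)" if xy: "x \<in> carrier M" "y \<in> carrier M" for x y
  proof -
    have "s (q x) \<ominus>\<^bsub>M\<^esub> x \<in> U" "s (q y) \<ominus>\<^bsub>M\<^esub> y \<in> U"
      using q s xy by blast+
    then have "(s (q x) \<ominus>\<^bsub>M\<^esub> x) \<oplus>\<^bsub>M\<^esub> (s (q y) \<ominus>\<^bsub>M\<^esub> y) \<in> U" by (rule D)
    also have "(s (q x) \<ominus>\<^bsub>M\<^esub> x) \<oplus>\<^bsub>M\<^esub> (s (q y) \<ominus>\<^bsub>M\<^esub> y) = (s (q x) \<oplus>\<^bsub>M\<^esub> s (q y)) \<ominus>\<^bsub>M\<^esub> (x \<oplus>\<^bsub>M\<^esub> y)"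
      using s(1)[of "q x"] s(1)[of "q y"] xy by (simp add: a_minus_def M.minus_add M.a_ac)
    finally show ?thesis
      unfolding N_def using q s xy by auto
  qed
  have smult: "a \<odot>\<^bsub>N\<^esub> q x = q (a \<odot>\<^bsub>M\<^esub> x)" if xy: "x \<in> carrier M" "a \<in> carrier R" for x a
  proof -
    have "s (q x) \<ominus>\<^bsub>M\<^esub> x \<in> U"
      using q s xy by blast+
    then have "a \<odot>\<^bsub>M\<^esub> (s (q x) \<ominus>\<^bsub>M\<^esub> x) \<in> U" using xy D by auto
    also have "a \<odot>\<^bsub>M\<^esub> (s (q x) \<ominus>\<^bsub>M\<^esub> x) = (a \<odot>\<^bsub>M\<^esub> s (q x)) \<ominus>\<^bsub>M\<^esub> (a \<odot>\<^bsub>M\<^esub> x)"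
      using s(1)[of "q x"] xy by (simp add: a_minus_def smult_r_distr smult_r_minus)
    finally show ?thesis
      unfolding N_def using q s xy by (auto simp: smult_closed)
  qed
  have c: "carrier N = q ` carrier M" and z: "\<zero>\<^bsub>N\<^esub> = q \<zero>\<^bsub>M\<^esub>" by (simp_all add: N_def)
  have "left_module R N"
  proof (rule left_moduleI)
    show "ring R" by (rule R.ring_axioms)
    show "\<exists>y\<in>carrier N. y \<oplus>\<^bsub>N\<^esub> x = \<zero>\<^bsub>N\<^esub>" if "x \<in> carrier N" for x
    proof -
      from that obtain x' where x': "x' \<in> carrier M" "x = q x'" unfolding c by auto
      show ?thesis
        using x' M.l_neg by (auto simp: c z add intro!: bexI[of _ "\<ominus>\<^bsub>M\<^esub> x'"])
    qed
  qed (auto simp: c z add smult M.a_ac smult_l_distr smult_r_distr smult_assoc smult_one smult_closed)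
  moreover have "q \<in> LinearCombinations.module_hom R M N"
    unfolding LinearCombinations.module_hom_def by (auto simp: c add smult)
  ultimately show ?thesis using c that by metis
qed

lemma quotient_module_exists:
  fixes M :: "('a, 'm) module"
  assumes M: "left_module R M" and U: "left_submodule R U M"
  obtains N :: "('a, 'm) module" and q where "left_module R N"
    "q \<in> LinearCombinations.module_hom R M N" "q ` carrier M = carrier N"
    "\<And>x y. x \<in> carrier M \<Longrightarrow> y \<in> carrier M \<Longrightarrow> q x = q y \<longleftrightarrow> x \<ominus>\<^bsub>M\<^esub> y \<in> U"
proof -
  interpret left_module R M by fact
  define q where "q x = (SOME y. y \<in> carrier M \<and> x \<ominus>\<^bsub>M\<^esub> y \<in> U)" for x
  have refl: "x \<ominus>\<^bsub>M\<^esub> x \<in> U" if "x \<in> carrier M" for x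
    using that left_submoduleD[OF U] by (simp add: a_minus_def M.r_neg)
  have sym: "y \<ominus>\<^bsub>M\<^esub> x \<in> U" if "x \<in> carrier M" "y \<in> carrier M" "x \<ominus>\<^bsub>M\<^esub> y \<in> U" for x y
    using left_submodule_minus(1)[OF M U that(3)] that(1,2)
    by (simp add: a_minus_def M.minus_add M.a_comm)
  have trans: "x \<ominus>\<^bsub>M\<^esub> z \<in> U"
    if "x \<in> carrier M" "y \<in> carrier M" "z \<in> carrier M" "x \<ominus>\<^bsub>M\<^esub> y \<in> U" "y \<ominus>\<^bsub>M\<^esub> z \<in> U" for x y z
  proof -
    have "(x \<ominus>\<^bsub>M\<^esub> y) \<oplus>\<^bsub>M\<^esub> (y \<ominus>\<^bsub>M\<^esub> z) \<in> U"
      using that(4,5) by (rule left_submoduleD(4)[OF U])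
    also have "(x \<ominus>\<^bsub>M\<^esub> y) \<oplus>\<^bsub>M\<^esub> (y \<ominus>\<^bsub>M\<^esub> z) = x \<ominus>\<^bsub>M\<^esub> z"
    proof -
      have "(x \<ominus>\<^bsub>M\<^esub> y) \<oplus>\<^bsub>M\<^esub> (y \<ominus>\<^bsub>M\<^esub> z) = x \<oplus>\<^bsub>M\<^esub> ((\<ominus>\<^bsub>M\<^esub> y \<oplus>\<^bsub>M\<^esub> y) \<oplus>\<^bsub>M\<^esub> \<ominus>\<^bsub>M\<^esub> z)"
        using that(1-3) unfolding a_minus_def by (simp add: M.a_assoc)
      then show ?thesis using that(1-3) by (simp add: a_minus_def M.l_neg)
    qed
    finally show ?thesis .
  qed
  have qs: "q x \<in> carrier M \<and> x \<ominus>\<^bsub>M\<^esub> q x \<in> U" if "x \<in> carrier M" for x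
    unfolding q_def by (rule someI[of _ x]) (use that refl in auto)
  have qq: "q x = q y \<longleftrightarrow> x \<ominus>\<^bsub>M\<^esub> y \<in> U" if xy: "x \<in> carrier M" "y \<in> carrier M" for x y
  proof
    assume "q x = q y"
    then show "x \<ominus>\<^bsub>M\<^esub> y \<in> U"
      using trans[of x "q x" y] sym[of y "q y"] qs[of x] qs[of y] xy by simp
  next
    assume *: "x \<ominus>\<^bsub>M\<^esub> y \<in> U"
    have "(z \<in> carrier M \<and> x \<ominus>\<^bsub>M\<^esub> z \<in> U) = (z \<in> carrier M \<and> y \<ominus>\<^bsub>M\<^esub> z \<in> U)" for z
      using trans[of x y z] trans[of y x z] sym[of x y] xy * by (cases "z \<in> carrier M") auto
    then show "q x = q y" unfolding q_def by (intro arg_cong[where f = Eps] ext)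
  qed
  obtain N :: "('a, 'm) module" where N: "left_module R N"
    "q \<in> LinearCombinations.module_hom R M N" "q ` carrier M = carrier N"
    by (rule coset_map_image_module[OF M U qq])
  show ?thesis by (rule that[OF N qq])
qed

lemma module_copy_exists:
  fixes M :: "('a, 'm) module" and i :: "'m \<Rightarrow> 'n"
  assumes M: "left_module R M" and i: "inj_on i (carrier M)"
  obtains N :: "('a, 'n) module" where "left_module R N"
    "i \<in> LinearCombinations.module_hom R M N" "bij_betw i (carrier M) (carrier N)"
proof -
  interpret left_module R M by fact
  have U: "left_submodule R {\<zero>\<^bsub>M\<^esub>} M"
    unfolding left_submodule_def by (auto simp: smult_zero)
  have ii: "i x = i y \<longleftrightarrow> x \<ominus>\<^bsub>M\<^esub> y \<in> {\<zero>\<^bsub>M\<^esub>}" if "x \<in> carrier M" "y \<in> carrier M" for x y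
    using inj_on_eq_iff[OF i that] that by simp
  obtain N :: "('a, 'n) module" where "left_module R N"
    "i \<in> LinearCombinations.module_hom R M N" "i ` carrier M = carrier N"
    by (rule coset_map_image_module[OF M U ii])
  then show ?thesis using that i by (simp add: bij_betw_def)
qed

lemma module_hom_inverse:
  assumes M: "left_module R M" and f: "f \<in> LinearCombinations.module_hom R M N"
    and b: "bij_betw f (carrier M) (carrier N)"
  shows "inv_into (carrier M) f \<in> LinearCombinations.module_hom R N M"
    "bij_betw (inv_into (carrier M) f) (carrier N) (carrier M)"
proof -
  interpret left_module R M by fact
  let ?g = "inv_into (carrier M) f"
  show b': "bij_betw ?g (carrier N) (carrier M)" by (rule bij_betw_inv_into[OF b])
  have g: "?g y \<in> carrier M" "f (?g y) = y" if "y \<in> carrier N" for y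
    using that b b' by (auto simp: bij_betw_def f_inv_into_f)
  have gf: "?g (f x) = x" if "x \<in> carrier M" for x
    using that b by (auto simp: bij_betw_def)
  have "?g (x \<oplus>\<^bsub>N\<^esub> y) = ?g x \<oplus>\<^bsub>M\<^esub> ?g y" if "x \<in> carrier N" "y \<in> carrier N" for x y
    using LinearCombinations.module_hom_add[OF f g(1)[OF that(1)] g(1)[OF that(2)]] g that
    by (metis gf M.add.m_closed)
  moreover have "?g (a \<odot>\<^bsub>N\<^esub> x) = a \<odot>\<^bsub>M\<^esub> ?g x" if "x \<in> carrier N" "a \<in> carrier R" for x a
    using LinearCombinations.module_hom_smult[OF f that(2) g(1)[OF that(1)]] g that
    by (metis gf smult_closed)
  ultimately show "?g \<in> LinearCombinations.module_hom R N M"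
    unfolding LinearCombinations.module_hom_def using g by auto
qed

section \<open>Dimensions of subspaces\<close>

context vectorspace
begin

lemma subspace_basis_exists:
  assumes fd: "fin_dim" and W: "VectorSpace.subspace K W V"
  obtains B where "finite B" "B \<subseteq> W" "lin_indpt B" "vectorspace.basis K (vs W) B"
proof -
  interpret W: vectorspace K "vs W" by (rule subspace_is_vs[OF W])
  have sm: "submodule K W V" and WV: "W \<subseteq> carrier V"
    using W by (auto simp: VectorSpace.subspace_def submodule_def)
  have li: "W.lin_dep S = lin_dep S" if "S \<subseteq> W" for S
    by (rule span_li_not_depend(2)[OF that sm])
  have "finite S \<and> card S \<le> dim" if "S \<subseteq> carrier (vs W) \<and> W.lin_indpt S" for S
    using li_le_dim[OF fd, of S] that li WV by auto
  moreover have "{} \<subseteq> carrier (vs W) \<and> W.lin_indpt {}"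
    by (simp add: W.lin_dep_def)
  ultimately obtain B where B: "finite B" "maximal B (\<lambda>S. S \<subseteq> carrier (vs W) \<and> W.lin_indpt S)"
    using maximal_exists[of "\<lambda>S. S \<subseteq> carrier (vs W) \<and> W.lin_indpt S" dim "{}"] by blast
  have "W.basis B" by (rule W.max_li_is_basis[OF B(2)])
  then show ?thesis
    using that[of B] B(1) li[of B] by (simp add: W.basis_def)
qed

lemma subspace_fin_dim:
  assumes "fin_dim" "VectorSpace.subspace K W V"
  shows "vectorspace.fin_dim K (vs W)" "vectorspace.dim K (vs W) \<le> dim"
    "vectorspace.dim K (vs W) = dim \<Longrightarrow> W = carrier V"
proof -
  interpret W: vectorspace K "vs W" by (rule subspace_is_vs) fact
  have WV: "W \<subseteq> carrier V" and sm: "submodule K W V"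
    using assms(2) by (auto simp: VectorSpace.subspace_def submodule_def)
  obtain B where B: "finite B" "B \<subseteq> W" "lin_indpt B" "W.basis B"
    by (rule subspace_basis_exists[OF assms])
  show "W.fin_dim" using B unfolding W.fin_dim_def W.basis_def by auto
  have d: "W.dim = card B" by (rule W.dim_basis) fact+
  show "W.dim \<le> dim" unfolding d using li_le_dim(2)[OF assms(1) _ B(3)] B(2) WV by blast
  assume "W.dim = dim"
  then have "basis B"
    using dim_li_is_basis[OF assms(1) B(1) _ B(3)] d B(2) WV by auto
  then have "carrier V = span B" by (simp add: basis_def)
  also have "\<dots> \<subseteq> W" by (rule span_is_subset[OF B(2) sm])
  finally show "W = carrier V" using WV by auto
qed

lemma subspaceI:
  assumes "W \<subseteq> carrier V" "\<zero>\<^bsub>V\<^esub> \<in> W" "\<And>x y. x \<in> W \<Longrightarrow> y \<in> W \<Longrightarrow> x \<oplus>\<^bsub>V\<^esub> y \<in> W"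
    "\<And>c x. c \<in> carrier K \<Longrightarrow> x \<in> W \<Longrightarrow> c \<odot>\<^bsub>V\<^esub> x \<in> W"
  shows "VectorSpace.subspace K W V"
  using assms module_axioms vectorspace_axioms
  by (auto simp: VectorSpace.subspace_def submodule_def)

lemma subspace_dim_mono:
  assumes fd: "fin_dim" and X: "VectorSpace.subspace K X V" and Y: "VectorSpace.subspace K Y V"
    and XY: "X \<subseteq> Y"
  shows "vectorspace.dim K (vs X) \<le> vectorspace.dim K (vs Y)"
    "vectorspace.dim K (vs X) = vectorspace.dim K (vs Y) \<Longrightarrow> X = Y"
proof -
  interpret Y: vectorspace K "vs Y" by (rule subspace_is_vs[OF Y])
  have "VectorSpace.subspace K X (vs Y)"
    using X XY Y.vectorspace_axioms Y.module_axioms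
    unfolding VectorSpace.subspace_def submodule_def by auto
  from Y.subspace_fin_dim(2,3)[OF subspace_fin_dim(1)[OF fd Y] this]
  show "vectorspace.dim K (vs X) \<le> vectorspace.dim K (vs Y)"
    "vectorspace.dim K (vs X) = vectorspace.dim K (vs Y) \<Longrightarrow> X = Y" by simp_all
qed

lemma decreasing_subspaces_stabilize:
  assumes fd: "fin_dim" and W: "\<And>m. VectorSpace.subspace K (W m) V"
    and dec: "\<And>m. W (Suc m) \<subseteq> W m"
  shows "\<exists>m. \<forall>k\<ge>m. W k = W m"
proof -
  let ?d = "\<lambda>m. vectorspace.dim K (vs (W m))"
  define m where "m = arg_min ?d (\<lambda>_. True)"
  have min: "?d m \<le> ?d k" for k
    unfolding m_def by (rule arg_min_nat_le) simp
  have "W k = W m" if "k \<ge> m" for k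
  proof -
    have "W k \<subseteq> W m" using that dec by (metis lift_Suc_antimono_le)
    from subspace_dim_mono[OF fd W W this] show ?thesis using min[of k] by linarith
  qed
  then show ?thesis by blast
qed

end

lemma linear_mapI:
  assumes "vectorspace K V" "vectorspace K W"
    "\<And>x. x \<in> carrier V \<Longrightarrow> T x \<in> carrier W"
    "\<And>x y. x \<in> carrier V \<Longrightarrow> y \<in> carrier V \<Longrightarrow> T (x \<oplus>\<^bsub>V\<^esub> y) = T x \<oplus>\<^bsub>W\<^esub> T y"
    "\<And>c x. c \<in> carrier K \<Longrightarrow> x \<in> carrier V \<Longrightarrow> T (c \<odot>\<^bsub>V\<^esub> x) = c \<odot>\<^bsub>W\<^esub> T x"
  shows "linear_map K V W T"
proof -
  interpret V: vectorspace K V by fact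
  interpret W: vectorspace K W by fact
  show ?thesis
    by unfold_locales (use assms(3-5) in \<open>auto simp: LinearCombinations.module_hom_def\<close>)
qed

lemma dim_eq_of_bijection:
  assumes "vectorspace K V" "vectorspace K W" "vectorspace.fin_dim K V"
    "bij_betw T (carrier V) (carrier W)"
    "\<And>x y. x \<in> carrier V \<Longrightarrow> y \<in> carrier V \<Longrightarrow> T (x \<oplus>\<^bsub>V\<^esub> y) = T x \<oplus>\<^bsub>W\<^esub> T y"
    "\<And>c x. c \<in> carrier K \<Longrightarrow> x \<in> carrier V \<Longrightarrow> T (c \<odot>\<^bsub>V\<^esub> x) = c \<odot>\<^bsub>W\<^esub> T x"
  shows "vectorspace.dim K V = vectorspace.dim K W"
proof -
  interpret linear_map K V W T
    by (rule linear_mapI) (use assms in \<open>auto simp: bij_betw_def\<close>)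
  show ?thesis using dim_eq assms(3,4) by (simp add: bij_betw_def)
qed

lemma rank_nullity_subspace:
  assumes V: "vectorspace K V" and W: "vectorspace K W" and X: "VectorSpace.subspace K X V"
    and fd: "vectorspace.fin_dim K V"
    and T: "\<And>x. x \<in> X \<Longrightarrow> T x \<in> carrier W"
    "\<And>x y. x \<in> X \<Longrightarrow> y \<in> X \<Longrightarrow> T (x \<oplus>\<^bsub>V\<^esub> y) = T x \<oplus>\<^bsub>W\<^esub> T y"
    "\<And>c x. c \<in> carrier K \<Longrightarrow> x \<in> X \<Longrightarrow> T (c \<odot>\<^bsub>V\<^esub> x) = c \<odot>\<^bsub>W\<^esub> T x"
  shows "vectorspace.dim K (V\<lparr>carrier := X\<rparr>) = vectorspace.dim K (W\<lparr>carrier := T ` X\<rparr>) +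
    vectorspace.dim K (V\<lparr>carrier := {x \<in> X. T x = \<zero>\<^bsub>W\<^esub>}\<rparr>)"
proof -
  have "linear_map K (V\<lparr>carrier := X\<rparr>) W T"
    by (rule linear_mapI) (use vectorspace.subspace_is_vs[OF V X] W T in auto)
  from linear_map.rank_nullity[OF this vectorspace.subspace_fin_dim(1)[OF V fd X]]
  show ?thesis
    using mod_hom.im_def[OF linear_map.axioms(3), OF \<open>linear_map K (V\<lparr>carrier := X\<rparr>) W T\<close>]
      mod_hom.ker_def[OF linear_map.axioms(3), OF \<open>linear_map K (V\<lparr>carrier := X\<rparr>) W T\<close>]
    by simp
qed

lemma dim_zero_space:
  assumes "vectorspace K V" "carrier V = {\<zero>\<^bsub>V\<^esub>}"
  shows "vectorspace.dim K V = 0" "vectorspace.fin_dim K V"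
proof -
  interpret vectorspace K V by fact
  have g: "gen_set {}" using assms(2) span_empty by simp
  show "vectorspace.dim K V = 0" using gen_ge_dim[of "{}"] g by simp
  show "vectorspace.fin_dim K V" unfolding fin_dim_def using g by blast
qed

section \<open>The vector spaces underlying modules over an algebra\<close>

text \<open>A left module over a \<open>K\<close>-algebra is a \<open>K\<close>-space through the scalar multiples of the
  unit element.\<close>

definition underlying_space ::
  "('k, 'd) ring_scheme \<Rightarrow> ('k, 'a, 'c) module_scheme \<Rightarrow> ('a, 'm) module \<Rightarrow> ('k, 'm) module" where
  "underlying_space K A M = \<lparr>carrier = carrier M, monoid.mult = monoid.mult M, one = one M,
     zero = zero M, add = add M, module.smult = (\<lambda>c x. (c \<odot>\<^bsub>A\<^esub> \<one>\<^bsub>A\<^esub>) \<odot>\<^bsub>M\<^esub> x)\<rparr>"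

lemma underlying_space_simps [simp]:
  "carrier (underlying_space K A M) = carrier M"
  "\<zero>\<^bsub>underlying_space K A M\<^esub> = \<zero>\<^bsub>M\<^esub>"
  "x \<oplus>\<^bsub>underlying_space K A M\<^esub> y = x \<oplus>\<^bsub>M\<^esub> y"
  "c \<odot>\<^bsub>underlying_space K A M\<^esub> x = (c \<odot>\<^bsub>A\<^esub> \<one>\<^bsub>A\<^esub>) \<odot>\<^bsub>M\<^esub> x"
  "underlying_space K A (M\<lparr>carrier := U\<rparr>) = (underlying_space K A M)\<lparr>carrier := U\<rparr>"
  by (simp_all add: underlying_space_def)

definition corner :: "('a, 'm) module \<Rightarrow> 'a \<Rightarrow> 'm set" where
  "corner M u = (\<lambda>x. u \<odot>\<^bsub>M\<^esub> x) ` carrier M"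

definition corner_dim ::
  "('k, 'd) ring_scheme \<Rightarrow> ('k, 'a, 'c) module_scheme \<Rightarrow> ('a, 'm) module \<Rightarrow> 'a \<Rightarrow> nat" where
  "corner_dim K A M u = vectorspace.dim K ((underlying_space K A M)\<lparr>carrier := corner M u\<rparr>)"

definition fin_dim_module ::
  "('k, 'd) ring_scheme \<Rightarrow> ('k, 'a, 'c) module_scheme \<Rightarrow> ('a, 'm) module \<Rightarrow> bool" where
  "fin_dim_module K A M \<longleftrightarrow> left_module A M \<and> vectorspace.fin_dim K (underlying_space K A M)"

context k_algebra
begin

abbreviation scalar :: "'a \<Rightarrow> 'c" where "scalar c \<equiv> c \<odot> \<one>"

lemma scalar_closed: "c \<in> carrier K \<Longrightarrow> scalar c \<in> carrier A"
  by (simp add: smult_closed)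

lemma scalar_commutes: "c \<in> carrier K \<Longrightarrow> a \<in> carrier A \<Longrightarrow> a \<otimes> scalar c = scalar c \<otimes> a"
  by (simp add: smult_mult_left smult_mult_right)

lemma scalar_mult: "c \<in> carrier K \<Longrightarrow> a \<in> carrier A \<Longrightarrow> scalar c \<otimes> a = c \<odot> a"
  by (simp add: smult_mult_left)

lemma underlying_space_vectorspace:
  assumes "left_module A M"
  shows "vectorspace K (underlying_space K A M)"
proof -
  interpret M: left_module A M by fact
  have "Module.module K (underlying_space K A M)"
  proof (rule module_criteria)
    show "cring K" ..
    show "\<forall>v\<in>carrier (underlying_space K A M). \<exists>w\<in>carrier (underlying_space K A M).
        v \<oplus>\<^bsub>underlying_space K A M\<^esub> w = \<zero>\<^bsub>underlying_space K A M\<^esub>"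
    proof
      fix v assume "v \<in> carrier (underlying_space K A M)"
      then show "\<exists>w\<in>carrier (underlying_space K A M).
          v \<oplus>\<^bsub>underlying_space K A M\<^esub> w = \<zero>\<^bsub>underlying_space K A M\<^esub>"
        using M.M.r_neg[of v] M.M.a_inv_closed[of v] by auto
    qed
    show "\<forall>a b v. a \<in> carrier K \<and> b \<in> carrier K \<and> v \<in> carrier (underlying_space K A M) \<longrightarrow>
        (a \<otimes>\<^bsub>K\<^esub> b) \<odot>\<^bsub>underlying_space K A M\<^esub> v =
        a \<odot>\<^bsub>underlying_space K A M\<^esub> (b \<odot>\<^bsub>underlying_space K A M\<^esub> v)"
      by (simp add: scalar_closed M.smult_assoc[symmetric] scalar_mult smult_assoc1)
    show "\<forall>a b v. a \<in> carrier K \<and> b \<in> carrier K \<and> v \<in> carrier (underlying_space K A M) \<longrightarrow>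
        (a \<oplus>\<^bsub>K\<^esub> b) \<odot>\<^bsub>underlying_space K A M\<^esub> v =
        a \<odot>\<^bsub>underlying_space K A M\<^esub> v \<oplus>\<^bsub>underlying_space K A M\<^esub>
        b \<odot>\<^bsub>underlying_space K A M\<^esub> v"
      by (simp add: smult_l_distr M.smult_l_distr scalar_closed)
  qed (auto simp: scalar_closed M.smult_closed M.M.a_assoc M.smult_r_distr M.smult_one
      intro: M.M.a_comm)
  then show ?thesis by (simp add: vectorspace_def field_axioms)
qed

lemma left_submodule_subspace:
  assumes "left_module A M" "left_submodule A U M"
  shows "VectorSpace.subspace K U (underlying_space K A M)"
proof -
  interpret V: vectorspace K "underlying_space K A M"
    by (rule underlying_space_vectorspace) fact
  note D = left_submoduleD[OF assms(2)]
  show ?thesis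
    by (rule V.subspaceI) (use D(1) in \<open>auto simp: D(2-5) scalar_closed\<close>)
qed

lemma corner_subspace:
  assumes "left_module A M" "u \<in> carrier A"
  shows "VectorSpace.subspace K (corner M u) (underlying_space K A M)"
proof -
  interpret V: vectorspace K "underlying_space K A M"
    by (rule underlying_space_vectorspace) fact
  interpret M: left_module A M by fact
  show ?thesis
  proof (rule V.subspaceI)
    show "corner M u \<subseteq> carrier (underlying_space K A M)"
      using assms(2) by (auto simp: corner_def M.smult_closed)
    show "\<zero>\<^bsub>underlying_space K A M\<^esub> \<in> corner M u"
      unfolding corner_def
      by (rule image_eqI[of _ _ "\<zero>\<^bsub>M\<^esub>"]) (simp_all add: M.smult_zero assms(2))
    show "x \<oplus>\<^bsub>underlying_space K A M\<^esub> y \<in> corner M u" if xy: "x \<in> corner M u" "y \<in> corner M u" for x y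
    proof -
      obtain x' y' where "x' \<in> carrier M" "x = u \<odot>\<^bsub>M\<^esub> x'" "y' \<in> carrier M" "y = u \<odot>\<^bsub>M\<^esub> y'"
        using xy unfolding corner_def by blast
      then show ?thesis
        using M.smult_r_distr[OF assms(2), of x' y'] unfolding corner_def
        by (auto intro!: image_eqI[of _ _ "x' \<oplus>\<^bsub>M\<^esub> y'"])
    qed
    show "c \<odot>\<^bsub>underlying_space K A M\<^esub> x \<in> corner M u" if cx: "c \<in> carrier K" "x \<in> corner M u" for c x
    proof -
      obtain y where y: "y \<in> carrier M" "x = u \<odot>\<^bsub>M\<^esub> y" using cx unfolding corner_def by blast
      have "scalar c \<odot>\<^bsub>M\<^esub> x = u \<odot>\<^bsub>M\<^esub> (scalar c \<odot>\<^bsub>M\<^esub> y)"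
        using M.smult_assoc[OF scalar_closed[OF that(1)] assms(2) y(1)]
          M.smult_assoc[OF assms(2) scalar_closed[OF that(1)] y(1)]
          scalar_commutes[OF that(1) assms(2)] y(2) by metis
      then have "c \<odot>\<^bsub>underlying_space K A M\<^esub> x = u \<odot>\<^bsub>M\<^esub> (scalar c \<odot>\<^bsub>M\<^esub> y)" by simp
      moreover have "scalar c \<odot>\<^bsub>M\<^esub> y \<in> carrier M"
        by (rule M.smult_closed[OF scalar_closed[OF that(1)] y(1)])
      ultimately show ?thesis
        unfolding corner_def by (rule image_eqI)
    qed
  qed
qed

lemma corner_memD:
  assumes "left_module A M" "idempotent_elem A u" "x \<in> corner M u"
  shows "x \<in> carrier M" "u \<odot>\<^bsub>M\<^esub> x = x"
proof -
  interpret M: left_module A M by fact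
  obtain y where y: "y \<in> carrier M" "x = u \<odot>\<^bsub>M\<^esub> y" using assms unfolding corner_def by auto
  show "x \<in> carrier M" "u \<odot>\<^bsub>M\<^esub> x = x"
    using y assms(2) by (simp_all add: M.smult_closed M.smult_assoc[symmetric] idempotent_elem_def)
qed

lemma corner_memI: "u \<odot>\<^bsub>M\<^esub> x = x \<Longrightarrow> x \<in> carrier M \<Longrightarrow> x \<in> corner M u"
  unfolding corner_def by (metis imageI)

lemma fin_dim_module_restrict:
  assumes "fin_dim_module K A M" "left_submodule A U M"
  shows "fin_dim_module K A (M\<lparr>carrier := U\<rparr>)"
proof -
  have M: "left_module A M" using assms by (simp add: fin_dim_module_def)
  show ?thesis
    unfolding fin_dim_module_def
    using left_module_restrict[OF M assms(2)] left_submodule_subspace[OF M assms(2)] assms(1)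
      vectorspace.subspace_fin_dim(1)[OF underlying_space_vectorspace[OF M]]
    by (simp add: fin_dim_module_def)
qed

text \<open>Multiplication by an idempotent is an exact functor: the map \<open>u M \<rightarrow> u N\<close> induced by \<open>f\<close> has
  image \<open>u f(M)\<close> and kernel \<open>u ker f\<close>. The claim is rank-nullity for this map.\<close>

lemma corner_dim_exact:
  assumes M: "fin_dim_module K A M" and N: "left_module A N"
    and f: "f \<in> LinearCombinations.module_hom A M N"
    and u: "idempotent_elem A u"
  shows "corner_dim K A M u =
    corner_dim K A (N\<lparr>carrier := f ` carrier M\<rparr>) u +
    corner_dim K A (M\<lparr>carrier := hom_kernel f M N\<rparr>) u"
proof -
  let ?V = "underlying_space K A M" and ?W = "underlying_space K A N"
  have M': "left_module A M" using M by (simp add: fin_dim_module_def)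
  have uA: "u \<in> carrier A" using u by (simp add: idempotent_elem_def)
  have cM: "x \<in> carrier M" if "x \<in> corner M u" for x using corner_memD[OF M' u that] by simp
  have "vectorspace.dim K (?V\<lparr>carrier := corner M u\<rparr>) =
      vectorspace.dim K (?W\<lparr>carrier := f ` corner M u\<rparr>) +
      vectorspace.dim K (?V\<lparr>carrier := {x \<in> corner M u. f x = \<zero>\<^bsub>?W\<^esub>}\<rparr>)"
  proof (rule rank_nullity_subspace)
    show "vectorspace K ?V" "vectorspace K ?W"
      by (rule underlying_space_vectorspace, fact)+
    show "VectorSpace.subspace K (corner M u) ?V" by (rule corner_subspace[OF M' uA])
    show "vectorspace.fin_dim K ?V" using M by (simp add: fin_dim_module_def)
    show "f x \<in> carrier ?W" if "x \<in> corner M u" for x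
      using LinearCombinations.module_hom_closed[OF f] cM[OF that] by auto
  qed (simp_all add: cM scalar_closed LinearCombinations.module_hom_smult[OF f]
      LinearCombinations.module_hom_add[OF f])
  moreover have "f ` corner M u = corner (N\<lparr>carrier := f ` carrier M\<rparr>) u"
    by (auto simp: corner_def image_image LinearCombinations.module_hom_smult[OF f uA])
  moreover have "{x \<in> corner M u. f x = \<zero>\<^bsub>N\<^esub>} = corner (M\<lparr>carrier := hom_kernel f M N\<rparr>) u"
  proof
    show "{x \<in> corner M u. f x = \<zero>\<^bsub>N\<^esub>} \<subseteq> corner (M\<lparr>carrier := hom_kernel f M N\<rparr>) u"
      using corner_memD[OF M' u] by (auto simp: hom_kernel_def intro!: corner_memI)
    show "corner (M\<lparr>carrier := hom_kernel f M N\<rparr>) u \<subseteq> {x \<in> corner M u. f x = \<zero>\<^bsub>N\<^esub>}"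
      by (auto simp: hom_kernel_def corner_def left_module.smult_zero[OF N uA]
          LinearCombinations.module_hom_smult[OF f uA])
  qed
  ultimately show ?thesis by (simp add: corner_dim_def)
qed

lemma corner_dim_zero_module:
  assumes "left_module A M" "carrier M = {\<zero>\<^bsub>M\<^esub>}" "u \<in> carrier A"
  shows "corner_dim K A M u = 0"
proof -
  interpret M: left_module A M by fact
  interpret V: vectorspace K "underlying_space K A M"
    by (rule underlying_space_vectorspace) fact
  have "corner M u = {\<zero>\<^bsub>M\<^esub>}" using assms by (simp add: corner_def M.smult_zero)
  then show ?thesis
    unfolding corner_dim_def
    using dim_zero_space[OF V.subspace_is_vs[OF corner_subspace[OF assms(1,3)]]] by simp
qed

lemma corner_dim_surj:
  assumes M: "fin_dim_module K A M" and N: "left_module A N"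
    and f: "f \<in> LinearCombinations.module_hom A M N" "f ` carrier M = carrier N"
    and u: "idempotent_elem A u"
  shows "corner_dim K A M u =
    corner_dim K A N u + corner_dim K A (M\<lparr>carrier := hom_kernel f M N\<rparr>) u"
  using corner_dim_exact[OF M N f(1) u] f(2) by simp

lemma fin_dim_module_image:
  assumes "fin_dim_module K A M" "left_module A N" "f \<in> LinearCombinations.module_hom A M N"
    "f ` carrier M = carrier N"
  shows "fin_dim_module K A N"
proof -
  have M: "left_module A M" using assms(1) by (simp add: fin_dim_module_def)
  interpret T: linear_map K "underlying_space K A M" "underlying_space K A N" f
  proof (rule linear_mapI)
    show "vectorspace K (underlying_space K A M)" "vectorspace K (underlying_space K A N)"
      by (rule underlying_space_vectorspace, fact)+
  qed (use LinearCombinations.module_hom_closed[OF assms(3)] in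
      \<open>simp_all add: scalar_closed Pi_iff LinearCombinations.module_hom_smult[OF assms(3)]
        LinearCombinations.module_hom_add[OF assms(3)]\<close>)
  show ?thesis
    using T.surj_fin_dim assms by (simp add: fin_dim_module_def)
qed

lemma corner_dim_iso:
  assumes M: "fin_dim_module K A M" and N: "left_module A N"
    and f: "f \<in> LinearCombinations.module_hom A M N" "bij_betw f (carrier M) (carrier N)"
    and u: "idempotent_elem A u"
  shows "corner_dim K A M u = corner_dim K A N u"
proof -
  have M': "left_module A M" using M by (simp add: fin_dim_module_def)
  have sub: "left_submodule A (hom_kernel f M N) M"
    by (rule left_submodule_hom_kernel) (rule M' N f(1))+
  have z: "\<zero>\<^bsub>M\<^esub> \<in> carrier M" "f \<zero>\<^bsub>M\<^esub> = \<zero>\<^bsub>N\<^esub>"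
    using left_submoduleD(2)[OF left_submodule_carrier[OF M']] left_module_hom_zero(1)[OF M' N f(1)]
    by auto
  have "x = \<zero>\<^bsub>M\<^esub>" if "x \<in> carrier M" "f x = \<zero>\<^bsub>N\<^esub>" for x
    by (rule inj_onD[OF bij_betw_imp_inj_on[OF f(2)]]) (simp_all add: that z)
  then have "hom_kernel f M N = {\<zero>\<^bsub>M\<^esub>}"
    using z unfolding hom_kernel_def by blast
  then have "corner_dim K A (M\<lparr>carrier := hom_kernel f M N\<rparr>) u = 0"
    using u by (intro corner_dim_zero_module left_module_restrict[OF M' sub])
      (simp_all add: idempotent_elem_def)
  moreover have "corner_dim K A M u =
      corner_dim K A N u + corner_dim K A (M\<lparr>carrier := hom_kernel f M N\<rparr>) u"
    by (rule corner_dim_surj[OF M N f(1) bij_betw_imp_surj_on[OF f(2)] u])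
  ultimately show ?thesis by linarith
qed

end

section \<open>Primitive idempotents and their local corner rings\<close>

context ring
begin

lemma add_diff_cancel:
  assumes "a \<in> carrier R" "b \<in> carrier R"
  shows "(a \<oplus> b) \<ominus> a = b"
proof -
  have "(a \<oplus> b) \<ominus> a = b \<oplus> (a \<oplus> \<ominus> a)"
    using assms by (simp add: a_minus_def a_ac del: r_neg)
  then show ?thesis using assms by (simp add: r_neg)
qed

lemma diff_add_cancel:
  assumes "a \<in> carrier R" "b \<in> carrier R"
  shows "(a \<ominus> b) \<oplus> b = a"
  using assms by (simp add: a_minus_def a_assoc l_neg)

text \<open>The decomposition \<open>e = f + (e - f)\<close> is orthogonal.\<close>

lemma primitive_subidempotent:
  assumes e: "primitive_idempotent R e" and f: "idempotent_elem R f"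
    and ef: "e \<otimes> f = f" "f \<otimes> e = f"
  shows "f = \<zero> \<or> f = e"
proof -
  have c: "e \<in> carrier R" "f \<in> carrier R" and i: "e \<otimes> e = e" "f \<otimes> f = f"
    using e f by (auto simp: primitive_idempotent_def idempotent_elem_def)
  let ?g = "e \<ominus> f"
  have g: "?g \<in> carrier R" using c by simp
  have fg: "f \<otimes> ?g = \<zero>" "?g \<otimes> f = \<zero>" "?g \<otimes> e = ?g"
    using c i ef by (simp_all add: a_minus_def r_distr l_distr r_minus l_minus r_neg)
  have "?g \<otimes> ?g = ?g \<otimes> e \<ominus> ?g \<otimes> f"
    using c g by (simp add: a_minus_def r_distr r_minus)
  also have "\<dots> = ?g" using fg g by (simp add: a_minus_def)
  finally have ig: "idempotent_elem R ?g" using g by (simp add: idempotent_elem_def)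
  have "e = f \<oplus> ?g"
    using c by (simp add: a_minus_def a_ac r_neg2 r_neg1 r_neg)
  then have "f = \<zero> \<or> ?g = \<zero>"
    using e f ig fg unfolding primitive_idempotent_def by blast
  then show ?thesis using c by auto
qed

text \<open>The left factor is the geometric sum \<open>e + b + \<dots> + b\<^sup>k\<close>.\<close>

lemma nilpotent_complement_left_inverse:
  assumes c: "e \<in> carrier R" "b \<in> carrier R" and i: "e \<otimes> e = e" "e \<otimes> b = b" "b \<otimes> e = b"
  shows "\<exists>c\<in>carrier R. c \<otimes> (e \<ominus> b) = e \<ominus> b [^] Suc k"
proof (induction k)
  case 0
  have "e \<otimes> (e \<ominus> b) = e \<ominus> b" using c i by (simp add: a_minus_def r_distr r_minus)
  then show ?case using c by (auto intro!: bexI[of _ e])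
next
  case (Suc k)
  then obtain d where d: "d \<in> carrier R" "d \<otimes> (e \<ominus> b) = e \<ominus> b [^] Suc k" by auto
  let ?p = "b [^] Suc k"
  have p: "?p \<in> carrier R" and pe: "?p \<otimes> e = ?p" and pb: "?p \<otimes> b = b [^] Suc (Suc k)"
    using c i by (simp_all add: m_assoc)
  have "(d \<oplus> ?p) \<otimes> (e \<ominus> b) = d \<otimes> (e \<ominus> b) \<oplus> ?p \<otimes> (e \<ominus> b)"
    using c d p by (intro l_distr) auto
  also have "?p \<otimes> (e \<ominus> b) = ?p \<otimes> e \<ominus> ?p \<otimes> b"
    using c p unfolding a_minus_def by (subst r_distr) (auto simp: r_minus)
  also have "d \<otimes> (e \<ominus> b) \<oplus> (?p \<otimes> e \<ominus> ?p \<otimes> b) = e \<ominus> b [^] Suc (Suc k)"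
  proof -
    have q: "b [^] Suc (Suc k) \<in> carrier R" using c by simp
    have "(e \<oplus> \<ominus> ?p) \<oplus> (?p \<oplus> \<ominus> (b [^] Suc (Suc k))) =
        e \<oplus> ((\<ominus> ?p \<oplus> ?p) \<oplus> \<ominus> (b [^] Suc (Suc k)))"
      using c(1) p q by (simp only: a_assoc a_closed a_inv_closed)
    also have "\<dots> = e \<oplus> \<ominus> (b [^] Suc (Suc k))"
      using c(1) p q by (simp only: l_neg l_zero a_inv_closed)
    finally show ?thesis unfolding d(2) unfolding pe pb a_minus_def .
  qed
  finally show ?case using d p by blast
qed

text \<open>If a power \<open>p\<close> of \<open>b\<close> satisfies \<open>p = c p\<^sup>2 = p\<^sup>2 d\<close>, then \<open>c p = p d\<close> is an idempotent
  below \<open>e\<close>. It is \<open>e\<close>, so that \<open>b\<close> is left invertible, or \<open>0\<close>, so that \<open>b\<close> is nilpotent.\<close>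

lemma primitive_fitting:
  assumes e: "primitive_idempotent R e"
    and b: "b \<in> carrier R" "e \<otimes> b = b" "b \<otimes> e = b"
    and cd: "c \<in> carrier R" "d \<in> carrier R"
    and p: "b [^] Suc k = c \<otimes> (b [^] Suc k \<otimes> b [^] Suc k)"
    "b [^] Suc k = (b [^] Suc k \<otimes> b [^] Suc k) \<otimes> d"
  shows "(\<exists>u\<in>carrier R. u \<otimes> b = e) \<or> (\<exists>u\<in>carrier R. u \<otimes> (e \<ominus> b) = e)"
proof -
  have e': "e \<in> carrier R" "e \<otimes> e = e"
    using e by (auto simp: primitive_idempotent_def idempotent_elem_def)
  define p where "p = b [^] Suc k"
  have pc: "p \<in> carrier R" using b by (simp add: p_def)
  have pe: "p \<otimes> e = p" using b e' by (simp add: p_def m_assoc)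
  have ep: "e \<otimes> p = p"
  proof -
    have "p = b \<otimes> b [^] k" using nat_pow_Suc2[OF b(1), of k] by (simp add: p_def)
    moreover have "e \<otimes> (b \<otimes> b [^] k) = (e \<otimes> b) \<otimes> b [^] k"
      using m_assoc[OF e'(1) b(1), of "b [^] k"] b(1) by simp
    ultimately show ?thesis using b by simp
  qed
  have p1: "c \<otimes> (p \<otimes> p) = p" and p2: "(p \<otimes> p) \<otimes> d = p" using assms(7,8) unfolding p_def by simp_all
  define f where "f = (e \<otimes> c \<otimes> e) \<otimes> p"
  have fc: "f \<in> carrier R" using e' cd pc by (simp add: f_def)
  have f1: "f = e \<otimes> (c \<otimes> p)" using e' cd pc ep by (simp add: f_def m_assoc)
  have cp: "c \<otimes> p = p \<otimes> d"
  proof -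
    have "c \<otimes> p = c \<otimes> ((p \<otimes> p) \<otimes> d)" using p2 by simp
    also have "\<dots> = (c \<otimes> (p \<otimes> p)) \<otimes> d" using cd pc by (simp add: m_assoc)
    finally show ?thesis using p1 by simp
  qed
  have f2: "f = p \<otimes> d" unfolding f1 cp using e' pc cd ep by (simp add: m_assoc[symmetric])
  have fp: "f \<otimes> p = p"
    using e' cd pc p1 ep by (simp add: f1 m_assoc)
  have ff: "f \<otimes> f = f"
  proof -
    have "f \<otimes> f = (f \<otimes> p) \<otimes> d" using fc pc cd by (subst (2) f2) (simp add: m_assoc)
    then show ?thesis using fp f2 by simp
  qed
  have fe: "f \<otimes> e = f" using e' cd pc pe by (simp add: f_def m_assoc)
  have ef: "e \<otimes> f = f" using e' cd pc by (simp add: f1 m_assoc[symmetric])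
  have "f = \<zero> \<or> f = e"
    by (rule primitive_subidempotent[OF e _ ef fe]) (simp add: idempotent_elem_def fc ff)
  then show ?thesis
  proof
    assume "f = \<zero>"
    then have "p = \<zero>" using fp pc by simp
    then have "b [^] Suc k = \<zero>" by (simp add: p_def)
    moreover obtain u where "u \<in> carrier R" "u \<otimes> (e \<ominus> b) = e \<ominus> b [^] Suc k"
      using nilpotent_complement_left_inverse[OF e'(1) b(1) e'(2) b(2,3), of k] by blast
    ultimately show ?thesis using e' by (auto simp: a_minus_def)
  next
    assume "f = e"
    moreover have "f = ((e \<otimes> c \<otimes> e) \<otimes> b [^] k) \<otimes> b"
      unfolding f_def p_def using e' cd b by (simp add: m_assoc)
    ultimately have "((e \<otimes> c \<otimes> e) \<otimes> b [^] k) \<otimes> b = e" by simp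
    then show ?thesis using e' cd b by blast
  qed
qed

end

context fin_dim_algebra
begin

text \<open>The subspaces \<open>A b\<^sup>m\<close> and \<open>b\<^sup>m A\<close> form descending chains. Past the points where both are
  constant, \<open>b\<^sup>m\<close> lies in \<open>A b\<^sup>2\<^sup>m\<close> and in \<open>b\<^sup>2\<^sup>m A\<close>.\<close>

lemma powers_stabilize:
  assumes b: "b \<in> carrier A"
  shows "\<exists>k. \<exists>c\<in>carrier A. \<exists>d\<in>carrier A.
    b [^] Suc k = c \<otimes> (b [^] Suc k \<otimes> b [^] Suc k) \<and>
    b [^] Suc k = (b [^] Suc k \<otimes> b [^] Suc k) \<otimes> d"
proof -
  let ?L = "\<lambda>m::nat. (\<lambda>a. a \<otimes> b [^] m) ` carrier A"
  let ?R = "\<lambda>m::nat. (\<lambda>a. b [^] m \<otimes> a) ` carrier A"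
  have pw: "b [^] (m::nat) \<in> carrier A" for m using b by simp
  have L: "VectorSpace.subspace K (?L m) A" for m
  proof (rule subspaceI)
    show "?L m \<subseteq> carrier A" using pw by auto
    show "\<zero> \<in> ?L m" by (rule image_eqI[of _ _ \<zero>]) (simp_all add: pw)
    show "x \<oplus> y \<in> ?L m" if "x \<in> ?L m" "y \<in> ?L m" for x y
      using that pw[of m] by (auto simp: alg.l_distr[symmetric])
    show "c \<odot> x \<in> ?L m" if "c \<in> carrier K" "x \<in> ?L m" for c x
      using that pw[of m] by (auto simp: smult_mult_left[symmetric])
  qed
  have R: "VectorSpace.subspace K (?R m) A" for m
  proof (rule subspaceI)
    show "?R m \<subseteq> carrier A" using pw by auto
    show "\<zero> \<in> ?R m" by (rule image_eqI[of _ _ \<zero>]) (simp_all add: pw)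
    show "x \<oplus> y \<in> ?R m" if "x \<in> ?R m" "y \<in> ?R m" for x y
      using that pw[of m] by (auto simp: alg.r_distr[symmetric])
    show "c \<odot> x \<in> ?R m" if "c \<in> carrier K" "x \<in> ?R m" for c x
      using that pw[of m] by (auto simp: smult_mult_right[symmetric])
  qed
  have Ld: "?L (Suc m) \<subseteq> ?L m" for m
  proof
    fix x assume "x \<in> ?L (Suc m)"
    then obtain a where a: "a \<in> carrier A" "x = a \<otimes> b [^] Suc m" by blast
    have "x = (a \<otimes> b) \<otimes> b [^] m"
      using a b pw[of m] alg.nat_pow_Suc2[OF b, of m] by (simp add: alg.m_assoc del: alg.nat_pow_Suc)
    then show "x \<in> ?L m" using a b by blast
  qed
  have Rd: "?R (Suc m) \<subseteq> ?R m" for m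
  proof
    fix x assume "x \<in> ?R (Suc m)"
    then obtain a where a: "a \<in> carrier A" "x = b [^] Suc m \<otimes> a" by blast
    have "x = b [^] m \<otimes> (b \<otimes> a)"
      using a b pw[of m] by (simp add: alg.m_assoc)
    then show "x \<in> ?R m" using a b by blast
  qed
  obtain m1 where m1: "\<forall>k\<ge>m1. ?L k = ?L m1"
    using decreasing_subspaces_stabilize[where W = ?L, OF fin_dim L Ld] by blast
  obtain m2 where m2: "\<forall>k\<ge>m2. ?R k = ?R m2"
    using decreasing_subspaces_stabilize[where W = ?R, OF fin_dim R Rd] by blast
  define k where "k = m1 + m2"
  have sq: "b [^] Suc k \<otimes> b [^] Suc k = b [^] (Suc k + Suc k)"
    by (rule alg.nat_pow_mult[OF b])
  have "b [^] Suc k = \<one> \<otimes> b [^] Suc k" "b [^] Suc k = b [^] Suc k \<otimes> \<one>" using pw[of "Suc k"] by simp_all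
  then have "b [^] Suc k \<in> ?L (Suc k)" "b [^] Suc k \<in> ?R (Suc k)" by blast+
  moreover have "?L (Suc k) = ?L (Suc k + Suc k)" "?R (Suc k) = ?R (Suc k + Suc k)"
    using m1[rule_format, of "Suc k"] m1[rule_format, of "Suc k + Suc k"]
      m2[rule_format, of "Suc k"] m2[rule_format, of "Suc k + Suc k"]
    by (simp_all add: k_def del: alg.nat_pow_Suc)
  ultimately have "b [^] Suc k \<in> ?L (Suc k + Suc k)" "b [^] Suc k \<in> ?R (Suc k + Suc k)" by simp_all
  then obtain c d where c: "c \<in> carrier A" "b [^] Suc k = c \<otimes> b [^] (Suc k + Suc k)"
    and d: "d \<in> carrier A" "b [^] Suc k = b [^] (Suc k + Suc k) \<otimes> d" by blast
  from c(2) d(2) have "b [^] Suc k = c \<otimes> (b [^] Suc k \<otimes> b [^] Suc k) \<and>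
    b [^] Suc k = (b [^] Suc k \<otimes> b [^] Suc k) \<otimes> d"
    unfolding sq by (rule conjI)
  then show ?thesis using c(1) d(1) by blast
qed

lemma primitive_corner_local:
  assumes e: "primitive_idempotent A e" and b: "b \<in> carrier A" "e \<otimes> b = b" "b \<otimes> e = b"
  shows "(\<exists>u\<in>carrier A. u \<otimes> b = e) \<or> (\<exists>u\<in>carrier A. u \<otimes> (e \<ominus> b) = e)"
  using powers_stabilize[OF b(1)] alg.primitive_fitting[OF e b] by blast

end

section \<open>Principal left modules\<close>

text \<open>For a primitive idempotent \<open>e\<close> of a finite dimensional algebra this is the unique maximal
  submodule of \<open>A e\<close>.\<close>

definition principal_radical :: "('a, 'c) ring_scheme \<Rightarrow> 'a \<Rightarrow> 'a set" where
  "principal_radical R e = {x \<in> carrier (principal_left_module R e).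
     \<forall>u\<in>carrier R. u \<otimes>\<^bsub>R\<^esub> x \<noteq> e}"

lemma principal_left_module_simps [simp]:
  "carrier (principal_left_module R e) = (\<lambda>a. a \<otimes>\<^bsub>R\<^esub> e) ` carrier R"
  "\<zero>\<^bsub>principal_left_module R e\<^esub> = \<zero>\<^bsub>R\<^esub>"
  "x \<oplus>\<^bsub>principal_left_module R e\<^esub> y = x \<oplus>\<^bsub>R\<^esub> y"
  "a \<odot>\<^bsub>principal_left_module R e\<^esub> x = a \<otimes>\<^bsub>R\<^esub> x"
  by (simp_all add: principal_left_module_def regular_module_def)

context ring
begin

lemma regular_left_module: "left_module R (regular_module R)"
  by (rule left_moduleI) (auto simp: regular_module_def ring_axioms a_ac l_distr r_distr
      m_assoc intro: bexI[of _ "\<ominus> x" for x] l_neg)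

lemma principal_left_module:
  assumes "e \<in> carrier R"
  shows "left_module R (principal_left_module R e)"
  unfolding principal_left_module_def
proof (rule left_module_restrict[OF regular_left_module])
  show "left_submodule R ((\<lambda>a. a \<otimes> e) ` carrier R) (regular_module R)"
    unfolding left_submodule_def
  proof (intro conjI ballI)
    show "\<zero>\<^bsub>regular_module R\<^esub> \<in> (\<lambda>a. a \<otimes> e) ` carrier R"
      by (rule image_eqI[of _ _ \<zero>]) (simp_all add: assms regular_module_def)
  qed (use assms in \<open>auto simp: regular_module_def l_distr[symmetric] m_assoc[symmetric]\<close>)
qed

lemma principal_memD:
  assumes "idempotent_elem R e" "x \<in> carrier (principal_left_module R e)"
  shows "x \<in> carrier R" "x \<otimes> e = x"
  using assms by (auto simp: idempotent_elem_def m_assoc)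

lemma principal_memI: "x \<in> carrier R \<Longrightarrow> x \<otimes> e = x \<Longrightarrow> x \<in> carrier (principal_left_module R e)"
  by (auto intro: image_eqI[of _ _ x])

lemma principal_generator:
  "idempotent_elem R e \<Longrightarrow> e \<in> carrier (principal_left_module R e)"
  by (rule principal_memI) (auto simp: idempotent_elem_def)

lemma primitive_idempotentD:
  "primitive_idempotent R e \<Longrightarrow> idempotent_elem R e \<and> e \<in> carrier R \<and> e \<otimes> e = e \<and> e \<noteq> \<zero>"
  by (auto simp: primitive_idempotent_def idempotent_elem_def)

text \<open>After replacing \<open>u\<close> by \<open>v = e u f\<close>, the product \<open>x v\<close> is a nonzero idempotent below \<open>f\<close>, hence
  equal to \<open>f\<close>. So right multiplications by \<open>x\<close> and by \<open>v\<close> are mutually inverse.\<close>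

lemma principal_modules_isomorphic:
  assumes f: "primitive_idempotent R f" and e: "primitive_idempotent R e"
    and x: "x \<in> carrier R" "f \<otimes> x = x" "x \<otimes> e = x" and u: "u \<in> carrier R" "u \<otimes> x = e"
  shows "module_isomorphic R (principal_left_module R f) (principal_left_module R e)"
proof -
  note fD = primitive_idempotentD[OF f] and eD = primitive_idempotentD[OF e]
  define v where "v = e \<otimes> u \<otimes> f"
  have v: "v \<in> carrier R" "e \<otimes> v = v" "v \<otimes> f = v" "v \<otimes> x = e"
    using fD eD u x by (simp_all add: v_def m_assoc) (simp_all add: m_assoc[symmetric])
  define g where "g = x \<otimes> v"
  have g: "g \<in> carrier R" "f \<otimes> g = g" "g \<otimes> f = g"
    using fD eD v x by (simp_all add: g_def m_assoc) (simp_all add: m_assoc[symmetric])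
  have gx: "g \<otimes> x = x" using v x by (simp add: g_def m_assoc)
  have "g \<otimes> g = (g \<otimes> x) \<otimes> v" 
    using m_assoc[OF g(1) x(1) v(1)] unfolding g_def[symmetric] by simp
  then have gg: "g \<otimes> g = g" using gx by (simp add: g_def)
  have "x \<noteq> \<zero>" using u eD by auto
  then have "g \<noteq> \<zero>" using gx x by auto
  then have xv: "x \<otimes> v = f"
    using primitive_subidempotent[OF f _ g(2,3)] g gg by (auto simp: idempotent_elem_def g_def)
  have fi: "idempotent_elem R f" and ei: "idempotent_elem R e" using fD eD by auto
  have hc: "a \<otimes> x \<in> carrier (principal_left_module R e)"
    if "a \<in> carrier (principal_left_module R f)" for a
    using principal_memD(1)[OF fi that] eD
    by (intro principal_memI) (simp_all add: x m_assoc)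
  have kc: "a \<otimes> v \<in> carrier (principal_left_module R f)"
    if "a \<in> carrier (principal_left_module R e)" for a
    using principal_memD(1)[OF ei that] fD
    by (intro principal_memI) (simp_all add: v m_assoc)
  let ?h = "\<lambda>a. a \<otimes> x"
  have "?h \<in> LinearCombinations.module_hom R (principal_left_module R f) (principal_left_module R e)"
    unfolding LinearCombinations.module_hom_def
  proof (intro CollectI conjI allI impI)
    show "?h \<in> carrier (principal_left_module R f) \<rightarrow> carrier (principal_left_module R e)"
      by (rule Pi_I) (rule hc)
  qed (use fD x in \<open>auto simp: l_distr m_assoc\<close>)
  moreover have "bij_betw ?h (carrier (principal_left_module R f)) (carrier (principal_left_module R e))"
  proof (rule bij_betw_byWitness[where f' = "\<lambda>a. a \<otimes> v"])
    show "\<forall>a\<in>carrier (principal_left_module R f). (a \<otimes> x) \<otimes> v = a"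
    proof
      fix a assume a: "a \<in> carrier (principal_left_module R f)"
      show "(a \<otimes> x) \<otimes> v = a"
        using principal_memD[OF fi a] v x xv by (simp add: m_assoc)
    qed
    show "\<forall>a\<in>carrier (principal_left_module R e). (a \<otimes> v) \<otimes> x = a"
    proof
      fix a assume a: "a \<in> carrier (principal_left_module R e)"
      show "(a \<otimes> v) \<otimes> x = a"
        using principal_memD[OF ei a] v x by (simp add: m_assoc)
    qed
    show "?h ` carrier (principal_left_module R f) \<subseteq> carrier (principal_left_module R e)"
      by (rule image_subsetI) (rule hc)
    show "(\<lambda>a. a \<otimes> v) ` carrier (principal_left_module R e) \<subseteq> carrier (principal_left_module R f)"
      by (rule image_subsetI) (rule kc)
  qed
  ultimately show ?thesis unfolding module_isomorphic_def by blast
qed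

end

context fin_dim_algebra
begin

text \<open>Closure under addition uses that \<open>e A e\<close> is local: if \<open>u (x + y) = e\<close>, then \<open>e u x\<close> and
  \<open>e u y\<close> add up to \<open>e\<close>, so one of them is left invertible and \<open>x\<close> or \<open>y\<close> generates \<open>A e\<close>.\<close>

lemma principal_radical_submodule:
  assumes e: "primitive_idempotent A e"
  shows "left_submodule A (principal_radical A e) (principal_left_module A e)"
proof -
  note eD = alg.primitive_idempotentD[OF e]
  interpret P: left_module A "principal_left_module A e"
    by (rule alg.principal_left_module) (use eD in simp)
  have memD: "x \<in> carrier A" "x \<otimes> e = x" if "x \<in> principal_radical A e" for x
    using that alg.principal_memD[of e x] eD by (auto simp: principal_radical_def)
  show ?thesis
    unfolding left_submodule_def
  proof (intro conjI ballI)
    show "principal_radical A e \<subseteq> carrier (principal_left_module A e)"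
      by (auto simp: principal_radical_def)
    have "\<zero> \<in> carrier (principal_left_module A e)"
      by (rule alg.principal_memI) (use eD in auto)
    then show "\<zero>\<^bsub>principal_left_module A e\<^esub> \<in> principal_radical A e"
      using eD by (auto simp: principal_radical_def)
  next
    fix x y assume xy: "x \<in> principal_radical A e" "y \<in> principal_radical A e"
    have False if u: "u \<in> carrier A" "u \<otimes> (x \<oplus> y) = e" for u
    proof -
      let ?b = "e \<otimes> u \<otimes> x"
      have b: "?b \<in> carrier A" "e \<otimes> ?b = ?b" "?b \<otimes> e = ?b"
        using eD u memD[OF xy(1)] by (simp_all add: alg.m_assoc) (simp_all add: alg.m_assoc[symmetric])
      have "e = e \<otimes> (u \<otimes> (x \<oplus> y))" using u eD by simp
      also have "\<dots> = ?b \<oplus> e \<otimes> u \<otimes> y"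
        using eD u(1) memD[OF xy(1)] memD[OF xy(2)] by (simp add: alg.r_distr alg.m_assoc)
      finally have "e \<ominus> ?b = (?b \<oplus> e \<otimes> u \<otimes> y) \<ominus> ?b" by simp
      also have "\<dots> = e \<otimes> u \<otimes> y"
        using eD u memD[OF xy(1)] memD[OF xy(2)]
        by (intro alg.add_diff_cancel) simp_all
      finally have eb: "e \<ominus> ?b = e \<otimes> u \<otimes> y" .
      have nx: "v \<otimes> (e \<otimes> u \<otimes> x) \<noteq> e" "v \<otimes> (e \<otimes> u \<otimes> y) \<noteq> e" if "v \<in> carrier A" for v
      proof -
        have "(v \<otimes> (e \<otimes> u)) \<otimes> x \<noteq> e" "(v \<otimes> (e \<otimes> u)) \<otimes> y \<noteq> e"
          using xy eD u that unfolding principal_radical_def by auto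
        then show "v \<otimes> (e \<otimes> u \<otimes> x) \<noteq> e" "v \<otimes> (e \<otimes> u \<otimes> y) \<noteq> e"
          using eD u that memD[OF xy(1)] memD[OF xy(2)] by (simp_all add: alg.m_assoc)
      qed
      show False
        using primitive_corner_local[OF e b] nx unfolding eb by blast
    qed
    then show "x \<oplus>\<^bsub>principal_left_module A e\<^esub> y \<in> principal_radical A e"
      using xy P.M.a_closed[of x y] unfolding principal_radical_def by auto
  next
    fix a x assume a: "a \<in> carrier A" and x: "x \<in> principal_radical A e"
    have "u \<otimes> (a \<otimes> x) \<noteq> e" if "u \<in> carrier A" for u
    proof -
      have "(u \<otimes> a) \<otimes> x \<noteq> e" using a x that unfolding principal_radical_def by auto
      then show ?thesis using a memD[OF x] that by (simp add: alg.m_assoc)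
    qed
    then show "a \<odot>\<^bsub>principal_left_module A e\<^esub> x \<in> principal_radical A e"
      using P.smult_closed[OF a] x unfolding principal_radical_def by auto
  qed
qed

lemma generator_not_in_radical: "primitive_idempotent A e \<Longrightarrow> e \<notin> principal_radical A e"
  using alg.primitive_idempotentD[of e] by (auto simp: principal_radical_def intro!: bexI[of _ e])

lemma principal_fin_dim:
  assumes "e \<in> carrier A"
  shows "fin_dim_module K A (principal_left_module A e)"
proof -
  have "vectorspace.fin_dim K (underlying_space K A (regular_module A))"
  proof (rule linear_map.surj_fin_dim)
    show "linear_map K A (underlying_space K A (regular_module A)) (\<lambda>x. x)"
      by (rule linear_mapI) (simp_all add: vectorspace_axioms scalar_mult
        underlying_space_vectorspace alg.regular_left_module, simp_all add: regular_module_def scalar_mult)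
  qed (simp_all add: fin_dim regular_module_def)
  then have "fin_dim_module K A (regular_module A)"
    by (simp add: fin_dim_module_def alg.regular_left_module)
  moreover have "left_submodule A ((\<lambda>a. a \<otimes> e) ` carrier A) (regular_module A)"
    using left_submodule_hom_image[OF alg.regular_left_module alg.regular_left_module _
        left_submodule_carrier[OF alg.regular_left_module], of "\<lambda>a. a \<otimes> e"] assms
    by (auto simp: regular_module_def LinearCombinations.module_hom_def alg.l_distr alg.m_assoc)
  ultimately show ?thesis
    unfolding principal_left_module_def by (rule fin_dim_module_restrict)
qed

lemma peirce_subspace:
  assumes c: "u \<in> carrier A" "e \<in> carrier A"
  shows "VectorSpace.subspace K ((\<lambda>x. u \<otimes> x \<otimes> e) ` carrier A) A" (is "VectorSpace.subspace K ?X A")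
proof (rule subspaceI)
  show "\<zero> \<in> ?X" by (rule image_eqI[of _ _ \<zero>]) (simp_all add: c)
  show "x \<oplus> y \<in> ?X" if "x \<in> ?X" "y \<in> ?X" for x y
    using that c by (auto simp: alg.r_distr[symmetric] alg.l_distr[symmetric])
  show "a \<odot> x \<in> ?X" if ax: "a \<in> carrier K" "x \<in> ?X" for a x
  proof -
    obtain y where y: "y \<in> carrier A" "x = u \<otimes> y \<otimes> e" using ax by blast
    have "a \<odot> x = u \<otimes> (a \<odot> y) \<otimes> e"
      using y ax(1) c by (simp add: smult_mult_left smult_mult_right)
    then show ?thesis using y(1) ax(1) by blast
  qed
qed (use c in auto)

text \<open>The columns of the Cartan matrix are therefore the dimension vectors of the modules \<open>A e\<^sub>k\<close>.\<close>

lemma corner_dim_principal: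
  assumes "idempotent_elem A u" "idempotent_elem A e"
  shows "corner_dim K A (principal_left_module A e) u = peirce_dim K A u (carrier A) e"
proof -
  have c: "u \<in> carrier A" "e \<in> carrier A" using assms by (auto simp: idempotent_elem_def)
  have eq: "corner (principal_left_module A e) u = (\<lambda>x. u \<otimes> x \<otimes> e) ` carrier A"
    using c by (auto simp: corner_def image_image alg.m_assoc)
  let ?X = "(\<lambda>x. u \<otimes> x \<otimes> e) ` carrier A"
  let ?V = "underlying_space K A (principal_left_module A e)"
  have L: "left_module A (principal_left_module A e)" by (rule alg.principal_left_module[OF c(2)])
  note V = underlying_space_vectorspace[OF L]
  have sub: "VectorSpace.subspace K ?X ?V"
    using corner_subspace[OF L c(1)] eq by simp
  have XA: "x \<in> carrier A" if "x \<in> ?X" for x using that c by auto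
  have sub': "VectorSpace.subspace K ?X A" by (rule peirce_subspace[OF c])
  have "vectorspace.dim K (?V\<lparr>carrier := ?X\<rparr>) = vectorspace.dim K (A\<lparr>carrier := ?X\<rparr>)"
  proof (rule dim_eq_of_bijection[where T = "\<lambda>x. x"])
    show "vectorspace K (?V\<lparr>carrier := ?X\<rparr>)" by (rule vectorspace.subspace_is_vs[OF V sub])
    show "vectorspace K (A\<lparr>carrier := ?X\<rparr>)" by (rule subspace_is_vs[OF sub'])
    show "vectorspace.fin_dim K (?V\<lparr>carrier := ?X\<rparr>)"
      by (rule vectorspace.subspace_fin_dim(1)[OF V _ sub])
        (use principal_fin_dim[OF c(2)] in \<open>simp add: fin_dim_module_def\<close>)
  qed (simp_all add: XA scalar_mult bij_betw_def inj_on_def)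
  then show ?thesis by (simp add: corner_dim_def peirce_dim_def eq)
qed

end

section \<open>Finitely generated and finite dimensional modules\<close>

lemma finsum_underlying_space:
  "finsum (underlying_space K A M) f S = finsum M f S"
  by (simp add: finsum_def finprod_def underlying_space_def)

context left_module
begin

lemma finsum_smult_left:
  assumes "finite S" "f \<in> S \<rightarrow> carrier R" "x \<in> carrier M"
  shows "(\<Oplus>\<^bsub>R\<^esub> i\<in>S. f i) \<odot> x = (\<Oplus> i\<in>S. f i \<odot> x)"
  using assms(1,2)
proof (induction S)
  case empty
  show ?case by (simp add: zero_smult assms(3))
next
  case (insert i S)
  then have "f i \<in> carrier R" "f \<in> S \<rightarrow> carrier R" "(\<lambda>i. f i \<odot> x) \<in> S \<rightarrow> carrier M"
    using smult_closed assms(3) by auto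
  then show ?case
    using insert by (simp add: smult_l_distr assms(3) smult_closed)
qed

lemma finsum_in_additive_subset:
  assumes "finite S" "f \<in> S \<rightarrow> U" "U \<subseteq> carrier M" "\<zero> \<in> U"
    "\<And>x y. x \<in> U \<Longrightarrow> y \<in> U \<Longrightarrow> x \<oplus> y \<in> U"
  shows "(\<Oplus> i\<in>S. f i) \<in> U"
  using assms(1,2)
proof (induction S)
  case empty
  show ?case by (simp add: assms(4))
next
  case (insert i S)
  then have "f i \<in> carrier M" "f \<in> S \<rightarrow> carrier M" "f i \<in> U" "f \<in> S \<rightarrow> U"
    using assms(3) by auto
  then show ?case using insert assms(5) by simp
qed

end

context fin_dim_algebra
begin

text \<open>The products of a basis of \<open>A\<close> with the generators of \<open>M\<close> span \<open>M\<close> over \<open>K\<close>.\<close>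

lemma fin_dim_of_fin_gen:
  assumes "fin_gen_module A M"
  shows "fin_dim_module K A M"
proof -
  have M: "left_module A M" using assms by (simp add: fin_gen_module_def)
  interpret M: left_module A M by (rule M)
  interpret V: vectorspace K "underlying_space K A M" by (rule underlying_space_vectorspace[OF M])
  obtain S where S: "finite S" "S \<subseteq> carrier M"
    "\<And>m. m \<in> carrier M \<Longrightarrow> \<exists>c\<in>S \<rightarrow> carrier A. m = (\<Oplus>\<^bsub>M\<^esub> s\<in>S. c s \<odot>\<^bsub>M\<^esub> s)"
    using assms unfolding fin_gen_module_def by blast
  obtain B where B: "finite B" "basis B" using finite_basis_exists[OF fin_dim] by blast
  have BA: "B \<subseteq> carrier A" "span B = carrier A" using B by (auto simp: basis_def)
  define T where "T = (\<lambda>(b, s). b \<odot>\<^bsub>M\<^esub> s) ` (B \<times> S)"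
  have T: "finite T" "T \<subseteq> carrier (underlying_space K A M)"
    using B(1) S(1) subsetD[OF S(2)] subsetD[OF BA(1)] by (auto simp: T_def M.smult_closed)
  have sub: "submodule K (V.span T) (underlying_space K A M)" by (rule V.span_is_submodule[OF T(2)])
  have spT: "V.span T \<subseteq> carrier M" using V.span_is_subset2[OF T(2)] by simp
  have z: "\<zero>\<^bsub>M\<^esub> \<in> V.span T" using submodule.zero_closed[OF sub] by simp
  have ad: "x \<oplus>\<^bsub>M\<^esub> y \<in> V.span T" if "x \<in> V.span T" "y \<in> V.span T" for x y
    using submodule.m_closed[OF sub that] by simp
  have sm: "scalar c \<odot>\<^bsub>M\<^esub> x \<in> V.span T" if "c \<in> carrier K" "x \<in> V.span T" for x c
    using submodule.smult_closed[OF sub that] by simp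
  have gen: "a \<odot>\<^bsub>M\<^esub> s \<in> V.span T" if a: "a \<in> carrier A" and s: "s \<in> S" for a s
  proof -
    let ?W = "{a \<in> carrier A. a \<odot>\<^bsub>M\<^esub> s \<in> V.span T}"
    have sM: "s \<in> carrier M" using s S by auto
    have "VectorSpace.subspace K ?W A"
    proof (rule subspaceI)
      show "\<zero> \<in> ?W" using z by (simp add: M.zero_smult sM)
      show "x \<oplus> y \<in> ?W" if "x \<in> ?W" "y \<in> ?W" for x y
        using that ad by (simp add: M.smult_l_distr sM)
      show "c \<odot> x \<in> ?W" if c: "c \<in> carrier K" and x: "x \<in> ?W" for c x
      proof -
        have "(c \<odot> x) \<odot>\<^bsub>M\<^esub> s = scalar c \<odot>\<^bsub>M\<^esub> (x \<odot>\<^bsub>M\<^esub> s)"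
          using M.smult_assoc[OF scalar_closed[OF c] _ sM, of x] x c by (simp add: scalar_mult)
        then show ?thesis using sm[OF c] x c by (simp add: smult_closed)
      qed
    qed auto
    then have "submodule K ?W A" by (simp add: VectorSpace.subspace_def)
    moreover have "B \<subseteq> ?W"
    proof
      fix b assume b: "b \<in> B"
      then have "b \<odot>\<^bsub>M\<^esub> s \<in> T" using s by (force simp: T_def)
      then show "b \<in> ?W" using b BA V.in_own_span[OF T(2)] by auto
    qed
    ultimately have "span B \<subseteq> ?W" by (intro span_is_subset)
    then show ?thesis using a BA by auto
  qed
  have "V.span T = carrier M"
  proof
    show "carrier M \<subseteq> V.span T"
    proof
      fix m assume "m \<in> carrier M"
      then obtain c where c: "c \<in> S \<rightarrow> carrier A" "m = (\<Oplus>\<^bsub>M\<^esub> s\<in>S. c s \<odot>\<^bsub>M\<^esub> s)" using S(3) by blast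
      have "(\<Oplus>\<^bsub>M\<^esub> s\<in>S. c s \<odot>\<^bsub>M\<^esub> s) \<in> V.span T"
        by (rule M.finsum_in_additive_subset[OF S(1) _ spT z ad]) (use c gen in auto)
      then show "m \<in> V.span T" using c by simp
    qed
  qed (rule spT)
  then have "V.fin_dim" using T unfolding V.fin_dim_def by auto
  then show ?thesis using M by (simp add: fin_dim_module_def)
qed

lemma fin_gen_of_fin_dim:
  assumes "fin_dim_module K A M"
  shows "fin_gen_module A M"
proof -
  have M: "left_module A M" using assms by (simp add: fin_dim_module_def)
  interpret V: vectorspace K "underlying_space K A M" by (rule underlying_space_vectorspace[OF M])
  obtain B where B: "finite B" "V.basis B"
    using V.finite_basis_exists assms by (auto simp: fin_dim_module_def)
  have BM: "B \<subseteq> carrier (underlying_space K A M)" "V.span B = carrier M" using B by (auto simp: V.basis_def)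
  have "\<exists>c\<in>B \<rightarrow> carrier A. m = (\<Oplus>\<^bsub>M\<^esub> s\<in>B. c s \<odot>\<^bsub>M\<^esub> s)" if "m \<in> carrier M" for m
  proof -
    have "m \<in> V.span B" using that BM by simp
    then obtain a where a: "a \<in> B \<rightarrow> carrier K" "V.lincomb a B = m"
      using V.finite_in_span[OF B(1) BM(1)] by blast
    then show ?thesis
      by (intro bexI[of _ "\<lambda>s. scalar (a s)"])
        (auto simp: V.lincomb_def finsum_underlying_space scalar_closed)
  qed
  then show ?thesis
    unfolding fin_gen_module_def using M B(1) BM by auto
qed

end

section \<open>Projective modules split off principal modules\<close>

lemma projective_moduleD:
  fixes P M N :: "('a, 'm) module"
  assumes "projective_module R P" "left_module R M" "left_module R N"
    "g \<in> LinearCombinations.module_hom R M N" "g ` carrier M = carrier N"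
    "h \<in> LinearCombinations.module_hom R P N"
  shows "\<exists>h'\<in>LinearCombinations.module_hom R P M. \<forall>x\<in>carrier P. g (h' x) = h x"
  using assms unfolding projective_module_def by blast

context fin_dim_algebra
begin

text \<open>A proper submodule of largest dimension is maximal.\<close>

lemma maximal_submodule_exists:
  assumes M: "fin_dim_module K A M" and nz: "carrier M \<noteq> {\<zero>\<^bsub>M\<^esub>}"
  obtains U where "left_submodule A U M" "U \<noteq> carrier M"
    "\<And>U'. left_submodule A U' M \<Longrightarrow> U \<subseteq> U' \<Longrightarrow> U' = U \<or> U' = carrier M"
proof -
  have M': "left_module A M" and fd: "vectorspace.fin_dim K (underlying_space K A M)"
    using M by (auto simp: fin_dim_module_def)
  interpret M: left_module A M by (rule M')
  interpret V: vectorspace K "underlying_space K A M" by (rule underlying_space_vectorspace[OF M'])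
  let ?d = "\<lambda>U. vectorspace.dim K (V.vs U)"
  let ?Q = "\<lambda>U. left_submodule A U M \<and> U \<noteq> carrier M"
  have "?Q {\<zero>\<^bsub>M\<^esub>}" using nz by (auto simp: left_submodule_def M.smult_zero)
  moreover have "\<forall>U. ?Q U \<longrightarrow> ?d U < Suc V.dim"
    using V.subspace_fin_dim(2)[OF fd left_submodule_subspace[OF M']] by (auto simp: less_Suc_eq_le)
  ultimately have "\<exists>U. ?Q U \<and> (\<forall>U'. ?Q U' \<longrightarrow> ?d U' \<le> ?d U)"
    by (rule ex_has_greatest_nat)
  then obtain U where U: "?Q U" and max: "\<And>U'. ?Q U' \<Longrightarrow> ?d U' \<le> ?d U" by blast
  have "U' = U \<or> U' = carrier M" if U': "left_submodule A U' M" "U \<subseteq> U'" for U'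
  proof (rule disjCI)
    assume "U' \<noteq> carrier M"
    then have "?d U' \<le> ?d U" using max U' by blast
    then show "U' = U"
      using V.subspace_dim_mono[OF fd left_submodule_subspace[OF M'] left_submodule_subspace[OF M'] U'(2)]
        U U'(1) by force
  qed
  then show ?thesis using that U by blast
qed

lemma left_submodule_plus_cyclic:
  assumes M: "left_module A M" and U: "left_submodule A U M" and v: "v \<in> carrier M"
  shows "left_submodule A {u \<oplus>\<^bsub>M\<^esub> a \<odot>\<^bsub>M\<^esub> v | u a. u \<in> U \<and> a \<in> carrier A} M" (is "left_submodule A ?W M")
    and "U \<subseteq> {u \<oplus>\<^bsub>M\<^esub> a \<odot>\<^bsub>M\<^esub> v | u a. u \<in> U \<and> a \<in> carrier A}"
    and "v \<in> {u \<oplus>\<^bsub>M\<^esub> a \<odot>\<^bsub>M\<^esub> v | u a. u \<in> U \<and> a \<in> carrier A}"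
proof -
  interpret M: left_module A M by (rule M)
  note D = left_submoduleD[OF U]
  show UW: "U \<subseteq> ?W"
  proof
    fix u assume "u \<in> U"
    moreover have "u = u \<oplus>\<^bsub>M\<^esub> \<zero> \<odot>\<^bsub>M\<^esub> v" using D(3)[OF \<open>u \<in> U\<close>] v by (simp add: M.zero_smult)
    ultimately show "u \<in> ?W" by blast
  qed
  have "v = \<zero>\<^bsub>M\<^esub> \<oplus>\<^bsub>M\<^esub> \<one> \<odot>\<^bsub>M\<^esub> v" using v by (simp add: M.smult_one)
  then show "v \<in> ?W" using D(2) by blast
  show "left_submodule A ?W M"
    unfolding left_submodule_def
  proof (intro conjI ballI)
    show "?W \<subseteq> carrier M" using D(3) v by (auto simp: M.smult_closed)
    show "\<zero>\<^bsub>M\<^esub> \<in> ?W" using UW D(2) by auto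
  next
    fix x y assume "x \<in> ?W" "y \<in> ?W"
    then obtain u a u' a' where h: "u \<in> U" "a \<in> carrier A" "x = u \<oplus>\<^bsub>M\<^esub> a \<odot>\<^bsub>M\<^esub> v"
      "u' \<in> U" "a' \<in> carrier A" "y = u' \<oplus>\<^bsub>M\<^esub> a' \<odot>\<^bsub>M\<^esub> v" by blast
    have "x \<oplus>\<^bsub>M\<^esub> y = (u \<oplus>\<^bsub>M\<^esub> u') \<oplus>\<^bsub>M\<^esub> (a \<oplus> a') \<odot>\<^bsub>M\<^esub> v"
      using h D(3)[OF h(1)] D(3)[OF h(4)] v by (simp add: M.smult_l_distr M.smult_closed M.M.a_ac)
    moreover have "u \<oplus>\<^bsub>M\<^esub> u' \<in> U" "a \<oplus> a' \<in> carrier A" using h D(4) by auto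
    ultimately show "x \<oplus>\<^bsub>M\<^esub> y \<in> ?W" by blast
  next
    fix b x assume b: "b \<in> carrier A" and "x \<in> ?W"
    then obtain u a where h: "u \<in> U" "a \<in> carrier A" "x = u \<oplus>\<^bsub>M\<^esub> a \<odot>\<^bsub>M\<^esub> v" by blast
    have "b \<odot>\<^bsub>M\<^esub> x = b \<odot>\<^bsub>M\<^esub> u \<oplus>\<^bsub>M\<^esub> (b \<otimes> a) \<odot>\<^bsub>M\<^esub> v"
      using h D(3)[OF h(1)] v b by (simp add: M.smult_r_distr M.smult_closed M.smult_assoc)
    moreover have "b \<odot>\<^bsub>M\<^esub> u \<in> U" "b \<otimes> a \<in> carrier A" using h D(5) b by auto
    ultimately show "b \<odot>\<^bsub>M\<^esub> x \<in> ?W" by blast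
  qed
qed

lemma maximal_submodule_complement:
  assumes M: "left_module A M" and U: "left_submodule A U M"
    and max: "\<And>U'. left_submodule A U' M \<Longrightarrow> U \<subseteq> U' \<Longrightarrow> U' = U \<or> U' = carrier M"
    and v: "v \<in> carrier M" "v \<notin> U" and x: "x \<in> carrier M"
  shows "\<exists>a\<in>carrier A. x \<ominus>\<^bsub>M\<^esub> a \<odot>\<^bsub>M\<^esub> v \<in> U"
proof -
  interpret M: left_module A M by (rule M)
  define W where "W = {u \<oplus>\<^bsub>M\<^esub> a \<odot>\<^bsub>M\<^esub> v | u a. u \<in> U \<and> a \<in> carrier A}"
  note W = left_submodule_plus_cyclic[OF M U v(1), folded W_def]
  have "x \<in> W" using max[OF W(1,2)] W(3) v(2) x by blast
  then obtain u a where h: "u \<in> U" "a \<in> carrier A" "x = u \<oplus>\<^bsub>M\<^esub> a \<odot>\<^bsub>M\<^esub> v"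
    unfolding W_def by blast
  have "x \<ominus>\<^bsub>M\<^esub> a \<odot>\<^bsub>M\<^esub> v = u"
    using h left_submoduleD(3)[OF U h(1)] v M.smult_closed[OF h(2) v(1)]
    by (simp add: a_minus_def M.M.a_assoc M.M.r_neg)
  then have "x \<ominus>\<^bsub>M\<^esub> a \<odot>\<^bsub>M\<^esub> v \<in> U" using h(1) by simp
  then show ?thesis using h(2) by blast
qed

text \<open>The map \<open>A e \<rightarrow> P/U\<close>, \<open>a \<mapsto> a v + U\<close>, is onto, so the projection \<open>P \<rightarrow> P/U\<close> lifts to \<open>A e\<close>.
  For the lifting property \<open>A e\<close> is copied to the type of \<open>P\<close> along \<open>a \<mapsto> {\<lambda>_. a}\<close>.\<close>

lemma projective_lift_principal:
  fixes P :: "('c, (nat \<Rightarrow> 'c) set) module"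
  assumes P: "projective_module A P" and U: "left_submodule A U P" and e: "idempotent_elem A e"
    and v: "v \<in> carrier P" "e \<odot>\<^bsub>P\<^esub> v = v"
    and gen: "\<And>x. x \<in> carrier P \<Longrightarrow> \<exists>a\<in>carrier A. x \<ominus>\<^bsub>P\<^esub> a \<odot>\<^bsub>P\<^esub> v \<in> U"
  shows "\<exists>f\<in>LinearCombinations.module_hom A P (principal_left_module A e).
    \<forall>x\<in>carrier P. x \<ominus>\<^bsub>P\<^esub> f x \<odot>\<^bsub>P\<^esub> v \<in> U"
proof -
  have P': "left_module A P" using P by (simp add: projective_module_def)
  interpret P: left_module A P by (rule P')
  have eA: "e \<in> carrier A" using e by (simp add: idempotent_elem_def)
  let ?L = "principal_left_module A e"
  have L: "left_module A ?L" by (rule alg.principal_left_module[OF eA])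
  have "inj_on (\<lambda>a. {\<lambda>_::nat. a}) (carrier ?L)" by (auto simp: inj_on_def dest: fun_cong)
  then obtain N :: "('c, (nat \<Rightarrow> 'c) set) module" where N: "left_module A N"
    "(\<lambda>a. {\<lambda>_. a}) \<in> LinearCombinations.module_hom A ?L N"
    "bij_betw (\<lambda>a. {\<lambda>_. a}) (carrier ?L) (carrier N)"
    by (rule module_copy_exists[OF L])
  define d where "d = inv_into (carrier ?L) (\<lambda>a. {\<lambda>_::nat. a})"
  have d: "d \<in> LinearCombinations.module_hom A N ?L" "bij_betw d (carrier N) (carrier ?L)"
    unfolding d_def by (rule module_hom_inverse[OF L N(2,3)])+
  obtain Q :: "('c, (nat \<Rightarrow> 'c) set) module" and q where Q: "left_module A Q"
    "q \<in> LinearCombinations.module_hom A P Q" "q ` carrier P = carrier Q"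
    "\<And>x y. x \<in> carrier P \<Longrightarrow> y \<in> carrier P \<Longrightarrow> q x = q y \<longleftrightarrow> x \<ominus>\<^bsub>P\<^esub> y \<in> U"
    by (rule quotient_module_exists[OF P' U]) blast
  let ?g = "\<lambda>z. q (d z \<odot>\<^bsub>P\<^esub> v)"
  have act: "(\<lambda>a. a \<odot>\<^bsub>P\<^esub> v) \<in> LinearCombinations.module_hom A ?L P"
    using alg.principal_memD(1)[OF e] v(1)
    unfolding LinearCombinations.module_hom_def
    by (auto simp: P.smult_closed P.smult_l_distr P.smult_assoc eA)
  have g: "?g \<in> LinearCombinations.module_hom A N Q"
    by (rule module_hom_comp[OF module_hom_comp[OF d(1) act] Q(2)])
  have "?g ` carrier N = carrier Q"
  proof
    show "?g ` carrier N \<subseteq> carrier Q" using LinearCombinations.module_hom_closed[OF g] by auto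
    show "carrier Q \<subseteq> ?g ` carrier N"
    proof
      fix y assume "y \<in> carrier Q"
      then obtain x where x: "x \<in> carrier P" "y = q x" using Q(3) by blast
      obtain a where a: "a \<in> carrier A" "x \<ominus>\<^bsub>P\<^esub> a \<odot>\<^bsub>P\<^esub> v \<in> U" using gen[OF x(1)] by blast
      have "a \<otimes> e \<in> carrier ?L" using a by simp
      then obtain z where z: "z \<in> carrier N" "d z = a \<otimes> e"
        using d(2) by (metis bij_betw_imp_surj_on imageE)
      have "(a \<otimes> e) \<odot>\<^bsub>P\<^esub> v = a \<odot>\<^bsub>P\<^esub> v" using P.smult_assoc[OF a(1) eA v(1)] v(2) by simp
      then have "?g z = q x" using Q(4)[OF x(1) P.smult_closed[OF a(1) v(1)]] a(2) z(2) by simp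
      then show "y \<in> ?g ` carrier N" using z x by force
    qed
  qed
  then obtain h where h: "h \<in> LinearCombinations.module_hom A P N"
    "\<forall>x\<in>carrier P. ?g (h x) = q x"
    using projective_moduleD[OF P N(1) Q(1) g _ Q(2)] by blast
  have hP: "d (h x) \<in> carrier ?L" if "x \<in> carrier P" for x
    using that LinearCombinations.module_hom_closed[OF h(1)]
      LinearCombinations.module_hom_closed[OF d(1)] by blast
  show ?thesis
  proof (intro bexI ballI)
    show "(\<lambda>x. d (h x)) \<in> LinearCombinations.module_hom A P ?L" by (rule module_hom_comp[OF h(1) d(1)])
    show "x \<ominus>\<^bsub>P\<^esub> d (h x) \<odot>\<^bsub>P\<^esub> v \<in> U" if x: "x \<in> carrier P" for x
      using Q(4)[OF x P.smult_closed[OF alg.principal_memD(1)[OF e hP[OF x]] v(1)]] h(2) x by simp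
  qed
qed

lemma retract_projective:
  fixes P :: "('c, 'm) module"
  assumes P: "projective_module A P" and U: "left_submodule A U P"
    and r: "r \<in> LinearCombinations.module_hom A P (P\<lparr>carrier := U\<rparr>)" "\<And>x. x \<in> U \<Longrightarrow> r x = x"
  shows "projective_module A (P\<lparr>carrier := U\<rparr>)"
  unfolding projective_module_def
proof (intro conjI allI impI)
  have P': "left_module A P" using P by (simp add: projective_module_def)
  show "left_module A (P\<lparr>carrier := U\<rparr>)" by (rule left_module_restrict[OF P' U])
  fix M N :: "('c, 'm) module" and g h
  assume as: "left_module A M \<and> left_module A N \<and> g \<in> LinearCombinations.module_hom A M N \<and>
    g ` carrier M = carrier N \<and> h \<in> LinearCombinations.module_hom A (P\<lparr>carrier := U\<rparr>) N"
  then have M: "left_module A M" and N: "left_module A N"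
    and g: "g \<in> LinearCombinations.module_hom A M N" "g ` carrier M = carrier N"
    and h: "h \<in> LinearCombinations.module_hom A (P\<lparr>carrier := U\<rparr>) N" by simp_all
  have hr: "(\<lambda>x. h (r x)) \<in> LinearCombinations.module_hom A P N"
    by (rule module_hom_comp[OF r(1) h])
  obtain h' where h': "h' \<in> LinearCombinations.module_hom A P M"
    "\<forall>x\<in>carrier P. g (h' x) = h (r x)"
    using projective_moduleD[OF P M N g hr] by blast
  have UP: "U \<subseteq> carrier P" by (rule left_submoduleD(1)[OF U])
  have "h' \<in> LinearCombinations.module_hom A (P\<lparr>carrier := U\<rparr>) (M\<lparr>carrier := carrier M\<rparr>)"
    by (rule module_hom_corestrict[OF h'(1) UP])
      (use LinearCombinations.module_hom_closed[OF h'(1)] UP in auto)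
  moreover have "g (h' x) = h x" if "x \<in> U" for x using h'(2) r(2)[OF that] UP that by auto
  ultimately show "\<exists>h'\<in>LinearCombinations.module_hom A (P\<lparr>carrier := U\<rparr>) M.
      \<forall>x\<in>carrier (P\<lparr>carrier := U\<rparr>). g (h' x) = h x"
    by (intro bexI[of _ h']) simp_all
qed

text \<open>The map \<open>x \<mapsto> x - f(x) p\<close> is a retraction of \<open>P\<close> onto the kernel of \<open>f\<close>.\<close>

lemma kernel_of_split_projective:
  fixes P :: "('c, 'm) module"
  assumes P: "projective_module A P" and e: "idempotent_elem A e"
    and f: "f \<in> LinearCombinations.module_hom A P (principal_left_module A e)"
    and p: "p \<in> carrier P" "f p = e"
  shows "projective_module A (P\<lparr>carrier := hom_kernel f P (principal_left_module A e)\<rparr>)"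
proof -
  have P': "left_module A P" using P by (simp add: projective_module_def)
  interpret P: left_module A P by (rule P')
  have eA: "e \<in> carrier A" using e by (simp add: idempotent_elem_def)
  let ?L = "principal_left_module A e"
  have L: "left_module A ?L" by (rule alg.principal_left_module[OF eA])
  interpret L: left_module A ?L by (rule L)
  let ?r = "\<lambda>x. x \<ominus>\<^bsub>P\<^esub> f x \<odot>\<^bsub>P\<^esub> p"
  have fL: "f x \<in> carrier ?L" if "x \<in> carrier P" for x
    using that LinearCombinations.module_hom_closed[OF f] by blast
  have fA: "f x \<in> carrier A" "f x \<otimes> e = f x" if "x \<in> carrier P" for x
    using alg.principal_memD[OF e fL[OF that]] by blast+
  have fp: "f x \<odot>\<^bsub>P\<^esub> p \<in> carrier P" if "x \<in> carrier P" for x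
    by (rule P.smult_closed[OF fA(1)[OF that] p(1)])
  have fadd: "f (x \<oplus>\<^bsub>P\<^esub> y) = f x \<oplus> f y" if "x \<in> carrier P" "y \<in> carrier P" for x y
    using LinearCombinations.module_hom_add[OF f that] by simp
  have fsm: "f (a \<odot>\<^bsub>P\<^esub> x) = a \<otimes> f x" if "a \<in> carrier A" "x \<in> carrier P" for a x
    using LinearCombinations.module_hom_smult[OF f that] by simp
  have rP: "?r x \<in> carrier P" if "x \<in> carrier P" for x
    using that fp by simp
  have rk: "f (?r x) = \<zero>\<^bsub>?L\<^esub>" if x: "x \<in> carrier P" for x
  proof -
    have "f (?r x) = f x \<ominus>\<^bsub>?L\<^esub> f (f x \<odot>\<^bsub>P\<^esub> p)"
      by (rule left_module_hom_zero(3)[OF P' L f x fp[OF x]])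
    also have "f (f x \<odot>\<^bsub>P\<^esub> p) = f x" using fsm[OF fA(1)[OF x] p(1)] fA(2)[OF x] p(2) by simp
    also have "f x \<ominus>\<^bsub>?L\<^esub> f x = \<zero>\<^bsub>?L\<^esub>" using L.M.r_neg[OF fL[OF x]] by (simp only: a_minus_def)
    finally show ?thesis .
  qed
  have "?r \<in> LinearCombinations.module_hom A P (P\<lparr>carrier := hom_kernel f P ?L\<rparr>)"
    unfolding LinearCombinations.module_hom_def
  proof (intro CollectI conjI allI impI)
    show "?r \<in> carrier P \<rightarrow> carrier (P\<lparr>carrier := hom_kernel f P ?L\<rparr>)"
      using rP rk by (simp add: hom_kernel_def)
    fix x y assume "x \<in> carrier P \<and> y \<in> carrier P"
    then have xy: "x \<in> carrier P" "y \<in> carrier P" by auto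
    have "?r (x \<oplus>\<^bsub>P\<^esub> y) = (x \<oplus>\<^bsub>P\<^esub> y) \<ominus>\<^bsub>P\<^esub> (f x \<odot>\<^bsub>P\<^esub> p \<oplus>\<^bsub>P\<^esub> f y \<odot>\<^bsub>P\<^esub> p)"
      using fadd[OF xy] P.smult_l_distr[OF fA(1)[OF xy(1)] fA(1)[OF xy(2)] p(1)] by simp
    also have "\<dots> = ?r x \<oplus>\<^bsub>P\<^esub> ?r y"
      using xy fp[OF xy(1)] fp[OF xy(2)] by (simp add: a_minus_def P.M.minus_add P.M.a_ac)
    finally show "?r (x \<oplus>\<^bsub>P\<^esub> y) = ?r x \<oplus>\<^bsub>P\<lparr>carrier := hom_kernel f P ?L\<rparr>\<^esub> ?r y" by simp
  next
    fix a x assume "a \<in> carrier A \<and> x \<in> carrier P"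
    then have ax: "a \<in> carrier A" "x \<in> carrier P" by auto
    have "?r (a \<odot>\<^bsub>P\<^esub> x) = a \<odot>\<^bsub>P\<^esub> x \<ominus>\<^bsub>P\<^esub> a \<odot>\<^bsub>P\<^esub> (f x \<odot>\<^bsub>P\<^esub> p)"
      using fsm[OF ax] P.smult_assoc[OF ax(1) fA(1)[OF ax(2)] p(1)] by simp
    also have "\<dots> = a \<odot>\<^bsub>P\<^esub> ?r x"
      using ax fp[OF ax(2)] by (simp add: a_minus_def P.smult_r_distr P.smult_r_minus)
    finally show "?r (a \<odot>\<^bsub>P\<^esub> x) = a \<odot>\<^bsub>P\<lparr>carrier := hom_kernel f P ?L\<rparr>\<^esub> ?r x" by simp
  qed
  moreover have "?r x = x" if "x \<in> hom_kernel f P ?L" for x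
    using that p(1) by (simp add: hom_kernel_def P.zero_smult a_minus_def)
  ultimately show ?thesis
    by (rule retract_projective[OF P left_submodule_hom_kernel[OF P' L f]])
qed

text \<open>If \<open>t v\<close> were outside \<open>U\<close>, it would generate \<open>M/U\<close>, so \<open>(e - a t) v\<close> would be in \<open>U\<close> for some
  \<open>a\<close>. But \<open>e - a t\<close> is not in the radical and generates \<open>A e\<close>, which puts \<open>v\<close> itself into \<open>U\<close>.\<close>

lemma radical_acts_into_maximal:
  assumes M: "left_module A M" and U: "left_submodule A U M"
    and max: "\<And>U'. left_submodule A U' M \<Longrightarrow> U \<subseteq> U' \<Longrightarrow> U' = U \<or> U' = carrier M"
    and e: "primitive_idempotent A e"
    and v: "v \<in> carrier M" "e \<odot>\<^bsub>M\<^esub> v = v" "v \<notin> U" and t: "t \<in> principal_radical A e"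
  shows "t \<odot>\<^bsub>M\<^esub> v \<in> U"
proof (rule ccontr)
  assume nU: "t \<odot>\<^bsub>M\<^esub> v \<notin> U"
  interpret M: left_module A M by (rule M)
  note eD = alg.primitive_idempotentD[OF e]
  have eA: "e \<in> carrier A" using eD by simp
  note N = principal_radical_submodule[OF e]
  have tA: "t \<in> carrier A" "t \<otimes> e = t"
    using alg.principal_memD[of e t] eD t by (auto simp: principal_radical_def)
  obtain a where a: "a \<in> carrier A" "v \<ominus>\<^bsub>M\<^esub> a \<odot>\<^bsub>M\<^esub> (t \<odot>\<^bsub>M\<^esub> v) \<in> U"
    using maximal_submodule_complement[OF M U max M.smult_closed[OF tA(1) v(1)] nU v(1)] by blast
  let ?y = "e \<ominus> a \<otimes> t"
  have yA: "?y \<in> carrier A" using a tA eA by simp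
  have ye: "?y \<otimes> e = ?y"
    using a tA eD by (simp add: a_minus_def alg.l_distr alg.l_minus alg.m_assoc)
  have yv: "?y \<odot>\<^bsub>M\<^esub> v \<in> U"
    using a(2) a(1) tA eA v
    by (simp add: a_minus_def M.smult_l_distr M.smult_l_minus M.smult_assoc)
  have "?y \<notin> principal_radical A e"
  proof
    assume "?y \<in> principal_radical A e"
    moreover have "a \<otimes> t \<in> principal_radical A e" using left_submoduleD(5)[OF N a(1) t] by simp
    ultimately have "?y \<oplus> a \<otimes> t \<in> principal_radical A e" using left_submoduleD(4)[OF N] by simp
    also have "?y \<oplus> a \<otimes> t = e" using alg.diff_add_cancel[of e "a \<otimes> t"] a tA eA by simp
    finally show False using generator_not_in_radical[OF e] by simp
  qed
  then obtain w where w: "w \<in> carrier A" "w \<otimes> ?y = e"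
    using alg.principal_memI[OF yA ye] unfolding principal_radical_def by blast
  have "v = w \<odot>\<^bsub>M\<^esub> (?y \<odot>\<^bsub>M\<^esub> v)" using M.smult_assoc[OF w(1) yA v(1)] w(2) v(2) by simp
  then have "v \<in> U" using left_submoduleD(5)[OF U w(1) yv] by simp
  then show False using v(3) by simp
qed

text \<open>If \<open>x\<close> is outside \<open>U\<close>, then so is some summand of \<open>x = \<Sum>\<^sub>k e\<^sub>k x\<close>.\<close>

lemma idempotent_outside_submodule:
  assumes ce: "complete_primitive_idempotents A n e"
    and M: "left_module A M" and U: "left_submodule A U M" "U \<noteq> carrier M"
  obtains k v where "k < n" "v \<in> carrier M" "e k \<odot>\<^bsub>M\<^esub> v = v" "v \<notin> U"
proof -
  interpret M: left_module A M by (rule M)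
  obtain x where x: "x \<in> carrier M" "x \<notin> U" using U left_submoduleD(1)[OF U(1)] by blast
  have e: "e i \<in> carrier A" "e i \<otimes> e i = e i" if "i < n" for i
    using ce that by (auto simp: complete_primitive_idempotents_def primitive_idempotent_def idempotent_elem_def)
  have "\<exists>k<n. e k \<odot>\<^bsub>M\<^esub> x \<notin> U"
  proof (rule ccontr)
    assume "\<not> ?thesis"
    then have all: "(\<lambda>i. e i \<odot>\<^bsub>M\<^esub> x) \<in> {..<n} \<rightarrow> U" by auto
    have "(\<Oplus>\<^bsub>A\<^esub> i\<in>{..<n}. e i) = \<one>" using ce by (simp add: complete_primitive_idempotents_def)
    then have "x = (\<Oplus>\<^bsub>A\<^esub> i\<in>{..<n}. e i) \<odot>\<^bsub>M\<^esub> x" using x by (simp add: M.smult_one)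
    also have "\<dots> = (\<Oplus>\<^bsub>M\<^esub> i\<in>{..<n}. e i \<odot>\<^bsub>M\<^esub> x)"
      by (rule M.finsum_smult_left) (use e x in auto)
    also have "\<dots> \<in> U"
      by (rule M.finsum_in_additive_subset[OF _ all left_submoduleD(1,2,4)[OF U(1)]]) simp
    finally show False using x by simp
  qed
  then obtain k where k: "k < n" "e k \<odot>\<^bsub>M\<^esub> x \<notin> U" by blast
  show ?thesis
    by (rule that[OF k(1) _ _ k(2)])
      (use e[OF k(1)] x in \<open>simp_all add: M.smult_closed M.smult_assoc[symmetric]\<close>)
qed

text \<open>Take a maximal submodule \<open>U\<close> of \<open>P\<close> and some \<open>v = e\<^sub>k v\<close> outside it, and let \<open>f\<close> be a lift of
  \<open>P \<rightarrow> P/U\<close> through \<open>A e\<^sub>k \<rightarrow> P/U\<close>, \<open>a \<mapsto> a v + U\<close>. The radical of \<open>A e\<^sub>k\<close> is sent to zero in \<open>P/U\<close>, so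
  the image of \<open>f\<close> is not contained in it, and hence \<open>f\<close> hits a generator.\<close>

lemma projective_maps_onto_principal:
  fixes P :: "('c, (nat \<Rightarrow> 'c) set) module"
  assumes ce: "complete_primitive_idempotents A n e"
    and P: "projective_module A P" "fin_dim_module K A P" and nz: "carrier P \<noteq> {\<zero>\<^bsub>P\<^esub>}"
  obtains k f p where "k < n" "f \<in> LinearCombinations.module_hom A P (principal_left_module A (e k))"
    "p \<in> carrier P" "f p = e k" "f ` carrier P = carrier (principal_left_module A (e k))"
proof -
  have P': "left_module A P" using P by (simp add: projective_module_def)
  interpret P: left_module A P by (rule P')
  obtain U where U: "left_submodule A U P" "U \<noteq> carrier P"
    and max: "\<And>U'. left_submodule A U' P \<Longrightarrow> U \<subseteq> U' \<Longrightarrow> U' = U \<or> U' = carrier P"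
    by (rule maximal_submodule_exists[OF P(2) nz]) blast
  obtain k v where k: "k < n" and v: "v \<in> carrier P" "e k \<odot>\<^bsub>P\<^esub> v = v" "v \<notin> U"
    by (rule idempotent_outside_submodule[OF ce P' U])
  have pe: "primitive_idempotent A (e k)" using ce k by (simp add: complete_primitive_idempotents_def)
  note eD = alg.primitive_idempotentD[OF pe]
  have ie: "idempotent_elem A (e k)" using eD by simp
  let ?L = "principal_left_module A (e k)"
  obtain f where f: "f \<in> LinearCombinations.module_hom A P ?L"
    and fU: "\<And>x. x \<in> carrier P \<Longrightarrow> x \<ominus>\<^bsub>P\<^esub> f x \<odot>\<^bsub>P\<^esub> v \<in> U"
    using projective_lift_principal[OF P(1) U(1) ie v(1,2)
        maximal_submodule_complement[OF P' U(1) max v(1,3)]] by blast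
  have fL: "f x \<in> carrier ?L" if "x \<in> carrier P" for x
    using that LinearCombinations.module_hom_closed[OF f] by blast
  have fsm: "f (a \<odot>\<^bsub>P\<^esub> x) = a \<otimes> f x" if "a \<in> carrier A" "x \<in> carrier P" for a x
    using LinearCombinations.module_hom_smult[OF f that] by simp
  obtain x where x: "x \<in> carrier P" "x \<notin> U" using U left_submoduleD(1)[OF U(1)] by blast
  have "f x \<notin> principal_radical A (e k)"
  proof
    assume "f x \<in> principal_radical A (e k)"
    then have t: "f x \<odot>\<^bsub>P\<^esub> v \<in> U"
      using radical_acts_into_maximal[OF P' U(1) max pe v] by blast
    have "(x \<ominus>\<^bsub>P\<^esub> f x \<odot>\<^bsub>P\<^esub> v) \<oplus>\<^bsub>P\<^esub> f x \<odot>\<^bsub>P\<^esub> v \<in> U"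
      by (rule left_submoduleD(4)[OF U(1) fU[OF x(1)] t])
    also have "(x \<ominus>\<^bsub>P\<^esub> f x \<odot>\<^bsub>P\<^esub> v) \<oplus>\<^bsub>P\<^esub> f x \<odot>\<^bsub>P\<^esub> v = x"
      using x(1) left_submoduleD(3)[OF U(1) t] by (simp add: a_minus_def P.M.a_assoc P.M.l_neg)
    finally show False using x(2) by simp
  qed
  then obtain w where w: "w \<in> carrier A" "w \<otimes> f x = e k"
    using fL[OF x(1)] unfolding principal_radical_def by blast
  show ?thesis
  proof (rule that[OF k f])
    show p: "w \<odot>\<^bsub>P\<^esub> x \<in> carrier P" by (rule P.smult_closed[OF w(1) x(1)])
    show fp: "f (w \<odot>\<^bsub>P\<^esub> x) = e k" using fsm[OF w(1) x(1)] w(2) by simp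
    show "f ` carrier P = carrier ?L"
    proof
      show "f ` carrier P \<subseteq> carrier ?L" using fL by auto
      show "carrier ?L \<subseteq> f ` carrier P"
      proof
        fix b assume b: "b \<in> carrier ?L"
        note bD = alg.principal_memD[OF ie b]
        have "f (b \<odot>\<^bsub>P\<^esub> (w \<odot>\<^bsub>P\<^esub> x)) = b" using fsm[OF bD(1) p] fp bD(2) by simp
        then show "b \<in> f ` carrier P" using P.smult_closed[OF bD(1) p] by force
      qed
    qed
  qed
qed

end

section \<open>Additive functions on modules of finite projective dimension\<close>

text \<open>A linear function \<open>x\<close> of the dimension vector of \<open>M\<close>, whose entries are the dimensions of the
  \<open>e\<^sub>j M\<close>.\<close>

definition corner_weight ::
  "('k, 'd) ring_scheme \<Rightarrow> ('k, 'a, 'c) module_scheme \<Rightarrow> nat \<Rightarrow> (nat \<Rightarrow> 'a) \<Rightarrow> (nat \<Rightarrow> rat) \<Rightarrow>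
    ('a, 'm) module \<Rightarrow> rat" where
  "corner_weight K A n e x M = (\<Sum>j<n. x j * of_nat (corner_dim K A M (e j)))"

context fin_dim_algebra
begin

lemma complete_idempotentsD:
  assumes "complete_primitive_idempotents A n e" "i < n"
  shows "primitive_idempotent A (e i)" "idempotent_elem A (e i)" "e i \<in> carrier A"
  using assms by (auto simp: complete_primitive_idempotents_def primitive_idempotent_def idempotent_elem_def)

lemma corner_weight_exact:
  assumes e: "complete_primitive_idempotents A n e" and M: "fin_dim_module K A M"
    and N: "left_module A N" and f: "f \<in> LinearCombinations.module_hom A M N"
  shows "corner_weight K A n e x M =
    corner_weight K A n e x (N\<lparr>carrier := f ` carrier M\<rparr>) +
    corner_weight K A n e x (M\<lparr>carrier := hom_kernel f M N\<rparr>)"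
  unfolding corner_weight_def sum.distrib[symmetric]
proof (rule sum.cong)
  fix j assume "j \<in> {..<n}"
  then have "idempotent_elem A (e j)" using complete_idempotentsD[OF e] by simp
  from corner_dim_exact[OF M N f this]
  show "x j * of_nat (corner_dim K A M (e j)) =
      x j * of_nat (corner_dim K A (N\<lparr>carrier := f ` carrier M\<rparr>) (e j)) +
      x j * of_nat (corner_dim K A (M\<lparr>carrier := hom_kernel f M N\<rparr>) (e j))"
    by (simp add: algebra_simps)
qed simp

lemma corner_weight_zero_module:
  assumes e: "complete_primitive_idempotents A n e" and M: "left_module A M" "carrier M = {\<zero>\<^bsub>M\<^esub>}"
  shows "corner_weight K A n e x M = 0"
  unfolding corner_weight_def
  by (rule sum.neutral) (use corner_dim_zero_module[OF M] complete_idempotentsD(3)[OF e] in auto)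

text \<open>By the Krull-Schmidt theorem \<open>P\<close> is a direct sum of copies of the \<open>A e\<^sub>k\<close>. These are split off
  one at a time: \<open>P\<close> maps onto some \<open>A e\<^sub>k\<close>, and the kernel is projective of smaller dimension.\<close>

lemma corner_weight_projective:
  fixes P :: "('c, (nat \<Rightarrow> 'c) set) module"
  assumes e: "complete_primitive_idempotents A n e"
    and x: "\<And>k. k < n \<Longrightarrow> corner_weight K A n e x (principal_left_module A (e k)) = 0"
    and P: "projective_module A P" "fin_dim_module K A P"
  shows "corner_weight K A n e x P = 0"
  using P
proof (induction "vectorspace.dim K (underlying_space K A P)" arbitrary: P rule: less_induct)
  case less
  have P': "left_module A P" using less(2) by (simp add: projective_module_def)
  interpret V: vectorspace K "underlying_space K A P" by (rule underlying_space_vectorspace[OF P'])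
  show ?case
  proof (cases "carrier P = {\<zero>\<^bsub>P\<^esub>}")
    case True
    then show ?thesis by (rule corner_weight_zero_module[OF e P'])
  next
    case False
    obtain k f p where k: "k < n"
      and f: "f \<in> LinearCombinations.module_hom A P (principal_left_module A (e k))"
      and p: "p \<in> carrier P" "f p = e k"
      and surj: "f ` carrier P = carrier (principal_left_module A (e k))"
      by (rule projective_maps_onto_principal[OF e less(2,3) False])
    note ek = complete_idempotentsD[OF e k]
    let ?L = "principal_left_module A (e k)"
    let ?N = "hom_kernel f P ?L"
    let ?P = "P\<lparr>carrier := ?N\<rparr>"
    have L: "left_module A ?L" by (rule alg.principal_left_module[OF ek(3)])
    have sub: "left_submodule A ?N P" by (rule left_submodule_hom_kernel[OF P' L f])
    have proj: "projective_module A ?P" by (rule kernel_of_split_projective[OF less(2) ek(2) f p])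
    have fd: "fin_dim_module K A ?P" by (rule fin_dim_module_restrict[OF less(3) sub])
    have fdV: "V.fin_dim" using less(3) by (simp add: fin_dim_module_def)
    have "p \<notin> ?N" using p(2) alg.primitive_idempotentD[OF ek(1)] by (simp add: hom_kernel_def)
    then have "?N \<noteq> carrier (underlying_space K A P)" using p(1) by auto
    then have "vectorspace.dim K (V.vs ?N) \<noteq> V.dim" "vectorspace.dim K (V.vs ?N) \<le> V.dim"
      using V.subspace_fin_dim(2,3)[OF fdV left_submodule_subspace[OF P' sub]] by blast+
    then have "vectorspace.dim K (underlying_space K A ?P) < V.dim" by simp
    then have "corner_weight K A n e x ?P = 0" using less(1)[OF _ proj fd] by simp
    then show ?thesis
      using corner_weight_exact[OF e less(3) L f, of x] x[OF k] surj
      by (simp del: principal_left_module_simps)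
  qed
qed

text \<open>In a resolution by modules of weight zero, successive syzygies have opposite weights, and the
  last syzygy is zero.\<close>

lemma corner_weight_resolution:
  fixes M :: "('c, (nat \<Rightarrow> 'c) set) module"
  assumes e: "complete_primitive_idempotents A n e"
    and x: "\<And>k. k < n \<Longrightarrow> corner_weight K A n e x (principal_left_module A (e k)) = 0"
    and M: "left_module A M" and res: "has_projective_resolution A M d"
  shows "corner_weight K A n e x M = 0"
proof -
  obtain P :: "nat \<Rightarrow> ('c, (nat \<Rightarrow> 'c) set) module" and \<delta> \<epsilon> where
    P: "\<forall>i. fin_gen_module A (P i) \<and> projective_module A (P i)"
    and P0: "\<forall>i>d. carrier (P i) = {\<zero>\<^bsub>P i\<^esub>}"
    and eps: "\<epsilon> \<in> LinearCombinations.module_hom A (P 0) M"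
    and del': "\<forall>i. \<delta> i \<in> LinearCombinations.module_hom A (P (Suc i)) (P i)"
    and ex1: "\<epsilon> ` carrier (P 0) = carrier M"
    and ex2: "\<delta> 0 ` carrier (P (Suc 0)) = {x \<in> carrier (P 0). \<epsilon> x = \<zero>\<^bsub>M\<^esub>}"
    and ex3: "\<forall>i. \<delta> (Suc i) ` carrier (P (Suc (Suc i))) =
        {x \<in> carrier (P (Suc i)). \<delta> i x = \<zero>\<^bsub>P i\<^esub>}"
    using res unfolding has_projective_resolution_def
    by (elim exE conjE) (rule that, assumption+)
  have fg: "fin_gen_module A (P i)" and proj: "projective_module A (P i)"
    and del: "\<delta> i \<in> LinearCombinations.module_hom A (P (Suc i)) (P i)" for i
    using P del' by auto
  have fd: "fin_dim_module K A (P i)" for i by (rule fin_dim_of_fin_gen[OF fg])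
  have lm: "left_module A (P i)" for i using fd by (simp add: fin_dim_module_def)
  have wP: "corner_weight K A n e x (P i) = 0" for i
    by (rule corner_weight_projective[OF e x proj fd])
  let ?w = "\<lambda>i. corner_weight K A n e x ((P (Suc i))\<lparr>carrier := hom_kernel (\<delta> i) (P (Suc i)) (P i)\<rparr>)"
  have step: "?w i = - ?w (Suc i)" for i
    using corner_weight_exact[OF e fd lm del[of "Suc i"], of x] wP[of "Suc (Suc i)"] ex3[rule_format, of i]
    by (simp add: hom_kernel_def)
  have last: "?w d = 0"
  proof (rule corner_weight_zero_module[OF e])
    have sub: "left_submodule A (hom_kernel (\<delta> d) (P (Suc d)) (P d)) (P (Suc d))"
      by (rule left_submodule_hom_kernel[OF lm lm del])
    show "left_module A ((P (Suc d))\<lparr>carrier := hom_kernel (\<delta> d) (P (Suc d)) (P d)\<rparr>)"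
      by (rule left_module_restrict[OF lm sub])
    show "carrier ((P (Suc d))\<lparr>carrier := hom_kernel (\<delta> d) (P (Suc d)) (P d)\<rparr>) =
        {\<zero>\<^bsub>(P (Suc d))\<lparr>carrier := hom_kernel (\<delta> d) (P (Suc d)) (P d)\<rparr>\<^esub>}"
      using left_submoduleD(1,2)[OF sub] P0 by auto
  qed
  have "?w i = 0 \<Longrightarrow> ?w 0 = 0" for i
  proof (induction i)
    case (Suc i)
    then show ?case using step[of i] by linarith
  qed
  then have w0: "?w 0 = 0" using last by blast
  have "corner_weight K A n e x ((P 0)\<lparr>carrier := hom_kernel \<epsilon> (P 0) M\<rparr>) = - ?w 0"
    using corner_weight_exact[OF e fd lm del[of 0], of x] wP[of "Suc 0"] ex2
    by (simp add: hom_kernel_def)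
  moreover have "corner_weight K A n e x M =
      - corner_weight K A n e x ((P 0)\<lparr>carrier := hom_kernel \<epsilon> (P 0) M\<rparr>)"
    using corner_weight_exact[OF e fd M eps, of x] wP[of 0] ex1 by simp
  ultimately show ?thesis using w0 by simp
qed

text \<open>The injection \<open>i\<close> serves to copy \<open>M\<close> to the type over which the global dimension ranges.\<close>

lemma corner_weight_finite_gl_dim:
  fixes M :: "('c, 'm) module" and i :: "'m \<Rightarrow> (nat \<Rightarrow> 'c) set"
  assumes e: "complete_primitive_idempotents A n e"
    and x: "\<And>k. k < n \<Longrightarrow> corner_weight K A n e x (principal_left_module A (e k)) = 0"
    and gl: "gl_dim A < \<infinity>" and M: "fin_dim_module K A M" and i: "inj_on i (carrier M)"
  shows "corner_weight K A n e x M = 0"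
proof -
  have M': "left_module A M" using M by (simp add: fin_dim_module_def)
  obtain N :: "('c, (nat \<Rightarrow> 'c) set) module" where N: "left_module A N"
    "i \<in> LinearCombinations.module_hom A M N" "bij_betw i (carrier M) (carrier N)"
    by (rule module_copy_exists[OF M' i])
  have fg: "fin_gen_module A N"
    by (rule fin_gen_of_fin_dim[OF fin_dim_module_image[OF M N(1,2) bij_betw_imp_surj_on[OF N(3)]]])
  have "proj_dim A N \<le> gl_dim A"
    unfolding gl_dim_def by (rule SUP_upper) (simp add: fg)
  then have "proj_dim A N < \<infinity>" using gl by (rule le_less_trans)
  then have "{d. has_projective_resolution A N d} \<noteq> {}"
    unfolding proj_dim_def by (intro notI) (simp add: Inf_enat_def)
  then obtain d where "has_projective_resolution A N d" by blast
  then have "corner_weight K A n e x N = 0" 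
    using corner_weight_resolution[OF e x N(1)] by blast
  moreover have "corner_weight K A n e x M = corner_weight K A n e x N"
    unfolding corner_weight_def
    by (rule sum.cong) (use corner_dim_iso[OF M N] complete_idempotentsD(2)[OF e] in auto)
  ultimately show ?thesis by simp
qed

text \<open>For \<open>j \<noteq> k\<close> no element of \<open>e\<^sub>j A e\<^sub>k\<close> generates \<open>A e\<^sub>k\<close>, since \<open>A e\<^sub>j\<close> and \<open>A e\<^sub>k\<close> are not isomorphic;
  but \<open>e\<^sub>k\<close> does generate it. This is where primitivity and basicness enter.\<close>

lemma corner_dim_radical:
  assumes b: "basic_algebra A n e" and k: "k < n" and j: "j < n"
  shows "j \<noteq> k \<Longrightarrow> corner_dim K A ((principal_left_module A (e k))\<lparr>carrier := principal_radical A (e k)\<rparr>) (e j) =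
      corner_dim K A (principal_left_module A (e k)) (e j)"
    and "corner_dim K A ((principal_left_module A (e k))\<lparr>carrier := principal_radical A (e k)\<rparr>) (e k) <
      corner_dim K A (principal_left_module A (e k)) (e k)"
proof -
  have ce: "complete_primitive_idempotents A n e" using b by (simp add: basic_algebra_def)
  note ek = complete_idempotentsD[OF ce k] and ej = complete_idempotentsD[OF ce j]
  note ekD = alg.primitive_idempotentD[OF ek(1)]
  let ?L = "principal_left_module A (e k)" and ?N = "principal_radical A (e k)"
  have L: "left_module A ?L" by (rule alg.principal_left_module[OF ek(3)])
  interpret L: left_module A ?L by (rule L)
  have N: "left_submodule A ?N ?L" by (rule principal_radical_submodule[OF ek(1)])
  have LN: "left_module A (?L\<lparr>carrier := ?N\<rparr>)" by (rule left_module_restrict[OF L N])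
  have NL: "corner (?L\<lparr>carrier := ?N\<rparr>) u \<subseteq> corner ?L u" for u
    using left_submoduleD(1)[OF N] unfolding corner_def by auto
  show "corner_dim K A (?L\<lparr>carrier := ?N\<rparr>) (e j) = corner_dim K A ?L (e j)" if jk: "j \<noteq> k"
  proof -
    have niso: "\<not> module_isomorphic A (principal_left_module A (e j)) ?L"
      using b j k jk by (simp add: basic_algebra_def)
    have "corner ?L (e j) \<subseteq> corner (?L\<lparr>carrier := ?N\<rparr>) (e j)"
    proof
      fix y assume y: "y \<in> corner ?L (e j)"
      note yD = corner_memD[OF L ej(2) y]
      note yA = alg.principal_memD[OF ek(2) yD(1)]
      have "u \<otimes> y \<noteq> e k" if "u \<in> carrier A" for u
        using alg.principal_modules_isomorphic[OF ej(1) ek(1) yA(1) _ yA(2) that] yD(2) niso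
        by auto
      then have "y \<in> ?N" using yD(1) by (simp add: principal_radical_def)
      then show "y \<in> corner (?L\<lparr>carrier := ?N\<rparr>) (e j)"
        by (intro corner_memI) (use yD(2) in simp_all)
    qed
    then have "corner (?L\<lparr>carrier := ?N\<rparr>) (e j) = corner ?L (e j)" using NL by blast
    then show ?thesis by (simp add: corner_dim_def)
  qed
  interpret V: vectorspace K "underlying_space K A ?L" by (rule underlying_space_vectorspace[OF L])
  have fd: "V.fin_dim" using principal_fin_dim[OF ek(3)] by (simp add: fin_dim_module_def)
  have s1: "VectorSpace.subspace K (corner ?L (e k)) (underlying_space K A ?L)"
    by (rule corner_subspace[OF L ek(3)])
  have s2: "VectorSpace.subspace K (corner (?L\<lparr>carrier := ?N\<rparr>) (e k)) (underlying_space K A ?L)"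
  proof (rule V.subspaceI)
    have s: "VectorSpace.subspace K (corner (?L\<lparr>carrier := ?N\<rparr>) (e k)) ((underlying_space K A ?L)\<lparr>carrier := ?N\<rparr>)"
      using corner_subspace[OF LN ek(3)] by simp
    then have sm: "submodule K (corner (?L\<lparr>carrier := ?N\<rparr>) (e k)) ((underlying_space K A ?L)\<lparr>carrier := ?N\<rparr>)"
      by (simp add: VectorSpace.subspace_def)
    show "corner (?L\<lparr>carrier := ?N\<rparr>) (e k) \<subseteq> carrier (underlying_space K A ?L)"
      using submodule.subset[OF sm] left_submoduleD(1)[OF N] by simp
    show "\<zero>\<^bsub>underlying_space K A ?L\<^esub> \<in> corner (?L\<lparr>carrier := ?N\<rparr>) (e k)"
      using submodule.zero_closed[OF sm] by simp
    show "y \<oplus>\<^bsub>underlying_space K A ?L\<^esub> z \<in> corner (?L\<lparr>carrier := ?N\<rparr>) (e k)"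
      if "y \<in> corner (?L\<lparr>carrier := ?N\<rparr>) (e k)" "z \<in> corner (?L\<lparr>carrier := ?N\<rparr>) (e k)" for y z
      using submodule.m_closed[OF sm that] by simp
    show "c \<odot>\<^bsub>underlying_space K A ?L\<^esub> y \<in> corner (?L\<lparr>carrier := ?N\<rparr>) (e k)"
      if "c \<in> carrier K" "y \<in> corner (?L\<lparr>carrier := ?N\<rparr>) (e k)" for c y
      using submodule.smult_closed[OF sm that] by simp
  qed
  have "e k \<in> corner ?L (e k)"
    by (rule corner_memI[OF _ alg.principal_generator[OF ek(2)]]) (use ekD in simp)
  moreover have "e k \<notin> corner (?L\<lparr>carrier := ?N\<rparr>) (e k)"
    using corner_memD(1)[OF LN ek(2)] generator_not_in_radical[OF ek(1)] by auto
  ultimately have "corner (?L\<lparr>carrier := ?N\<rparr>) (e k) \<noteq> corner ?L (e k)" by blast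
  then have "corner_dim K A (?L\<lparr>carrier := ?N\<rparr>) (e k) \<noteq> corner_dim K A ?L (e k)"
    and "corner_dim K A (?L\<lparr>carrier := ?N\<rparr>) (e k) \<le> corner_dim K A ?L (e k)"
    using V.subspace_dim_mono[OF fd s2 s1 NL] by (auto simp: corner_dim_def)
  then show "corner_dim K A (?L\<lparr>carrier := ?N\<rparr>) (e k) < corner_dim K A ?L (e k)" by simp
qed

text \<open>A row vector \<open>x\<close> that annihilates the Cartan matrix is a weight that vanishes on the \<open>A e\<^sub>k\<close>, hence,
  by finite global dimension, on every finite dimensional module. Applied to \<open>A e\<^sub>k\<close> modulo its radical
  this weight is a positive multiple of \<open>x\<^sub>k\<close>.\<close>

lemma cartan_rows_independent:
  assumes b: "basic_algebra A n e" and gl: "gl_dim A < \<infinity>"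
    and x: "\<And>k. k < n \<Longrightarrow> (\<Sum>j<n. x j * of_nat (peirce_dim K A (e j) (carrier A) (e k)) :: rat) = 0"
    and k: "k < n"
  shows "x k = 0"
proof -
  have ce: "complete_primitive_idempotents A n e" using b by (simp add: basic_algebra_def)
  note ek = complete_idempotentsD[OF ce]
  have w: "corner_weight K A n e x (principal_left_module A (e i)) = 0" if "i < n" for i
  proof -
    have "corner_weight K A n e x (principal_left_module A (e i)) =
        (\<Sum>j<n. x j * of_nat (peirce_dim K A (e j) (carrier A) (e i)))"
      unfolding corner_weight_def
      by (rule sum.cong) (simp_all add: corner_dim_principal[OF ek(2) ek(2)[OF that]])
    then show ?thesis using x[OF that] by simp
  qed
  let ?L = "principal_left_module A (e k)" and ?N = "principal_radical A (e k)"
  let ?R = "?L\<lparr>carrier := ?N\<rparr>"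
  have "fin_dim_module K A ?R"
    by (rule fin_dim_module_restrict[OF principal_fin_dim[OF ek(3)[OF k]]
        principal_radical_submodule[OF ek(1)[OF k]]])
  moreover have "inj_on (\<lambda>a. {\<lambda>_::nat. a}) (carrier ?R)" by (auto simp: inj_on_def dest: fun_cong)
  ultimately have "corner_weight K A n e x ?R = 0"
    using corner_weight_finite_gl_dim[OF ce w gl] by blast
  then have "0 = corner_weight K A n e x ?L - corner_weight K A n e x ?R" using w[OF k] by simp
  also have "\<dots> = (\<Sum>j<n. x j * (of_nat (corner_dim K A ?L (e j)) - of_nat (corner_dim K A ?R (e j))))"
    by (simp add: corner_weight_def sum_subtractf algebra_simps)
  also have "\<dots> = (\<Sum>j<n. if j = k then x k * (of_nat (corner_dim K A ?L (e k)) - of_nat (corner_dim K A ?R (e k))) else 0)"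
    by (rule sum.cong) (use corner_dim_radical(1)[OF b k] in auto)
  also have "\<dots> = x k * (of_nat (corner_dim K A ?L (e k)) - of_nat (corner_dim K A ?R (e k)))"
    using k by simp
  finally show ?thesis using corner_dim_radical(2)[OF b k k] by simp
qed

end

section \<open>Dual spaces\<close>

context vectorspace
begin

definition coords :: "'c set \<Rightarrow> 'c \<Rightarrow> 'c \<Rightarrow> 'a" where
  "coords B x = (SOME a. a \<in> B \<rightarrow>\<^sub>E carrier K \<and> lincomb a B = x)"

text \<open>The symmetric bilinear form for which the basis \<open>B\<close> is orthonormal.\<close>

definition coord_pairing :: "'c set \<Rightarrow> 'c \<Rightarrow> 'c \<Rightarrow> 'a" where
  "coord_pairing B x = (\<lambda>y\<in>carrier V. \<Oplus>\<^bsub>K\<^esub>b\<in>B. coords B x b \<otimes>\<^bsub>K\<^esub> coords B y b)"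

lemma coords:
  assumes B: "finite B" "basis B" and x: "x \<in> carrier V"
  shows "b \<in> B \<Longrightarrow> coords B x b \<in> carrier K" "lincomb (coords B x) B = x"
proof -
  have "B \<subseteq> carrier V" using B by (simp add: basis_def)
  then have "\<exists>a. a \<in> B \<rightarrow>\<^sub>E carrier K \<and> lincomb a B = x"
    using basis_criterion[OF B(1)] B(2) x by blast
  from someI_ex[OF this, folded coords_def]
  show "b \<in> B \<Longrightarrow> coords B x b \<in> carrier K" "lincomb (coords B x) B = x" by auto
qed

lemma coords_unique:
  assumes B: "finite B" "basis B" and a: "a \<in> B \<rightarrow> carrier K" and b: "b \<in> B"
  shows "coords B (lincomb a B) b = a b"
proof -
  have BV: "B \<subseteq> carrier V" using B by (simp add: basis_def)
  have x: "lincomb a B \<in> carrier V" using BV a by simp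
  have "\<exists>!a'. a' \<in> B \<rightarrow>\<^sub>E carrier K \<and> lincomb a' B = lincomb a B"
    using basis_criterion[OF B(1) BV] B(2) x by blast
  moreover have "restrict a B \<in> B \<rightarrow>\<^sub>E carrier K \<and> lincomb (restrict a B) B = lincomb a B"
    using a BV by (auto intro: lincomb_cong)
  moreover have "restrict (coords B (lincomb a B)) B \<in> B \<rightarrow>\<^sub>E carrier K \<and>
      lincomb (restrict (coords B (lincomb a B)) B) B = lincomb a B"
    using coords[OF B x] BV lincomb_cong[OF refl BV, of "restrict (coords B (lincomb a B)) B" "coords B (lincomb a B)"]
    by auto
  ultimately have "restrict (coords B (lincomb a B)) B = restrict a B" by blast
  then show ?thesis using b by (metis restrict_apply')
qed

lemma coords_add:
  assumes B: "finite B" "basis B" and xy: "x \<in> carrier V" "y \<in> carrier V" and b: "b \<in> B"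
  shows "coords B (x \<oplus>\<^bsub>V\<^esub> y) b = coords B x b \<oplus>\<^bsub>K\<^esub> coords B y b"
proof -
  have BV: "B \<subseteq> carrier V" using B by (simp add: basis_def)
  have c: "coords B x \<in> B \<rightarrow> carrier K" "coords B y \<in> B \<rightarrow> carrier K"
    using coords(1)[OF B xy(1)] coords(1)[OF B xy(2)] by auto
  have "x \<oplus>\<^bsub>V\<^esub> y = lincomb (\<lambda>b. coords B x b \<oplus>\<^bsub>K\<^esub> coords B y b) B"
    using lincomb_sum[OF B(1) BV c] coords(2)[OF B xy(1)] coords(2)[OF B xy(2)] by simp
  moreover have "(\<lambda>b. coords B x b \<oplus>\<^bsub>K\<^esub> coords B y b) \<in> B \<rightarrow> carrier K" using c by auto
  ultimately show ?thesis using coords_unique[OF B _ b] by metis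
qed

lemma coords_smult:
  assumes B: "finite B" "basis B" and x: "x \<in> carrier V" and c: "c \<in> carrier K" and b: "b \<in> B"
  shows "coords B (c \<odot>\<^bsub>V\<^esub> x) b = c \<otimes>\<^bsub>K\<^esub> coords B x b"
proof -
  have BV: "B \<subseteq> carrier V" using B by (simp add: basis_def)
  have cx: "coords B x \<in> B \<rightarrow> carrier K" using coords(1)[OF B x] by auto
  have "c \<odot>\<^bsub>V\<^esub> x = lincomb (\<lambda>b. c \<otimes>\<^bsub>K\<^esub> coords B x b) B"
    using lincomb_smult[OF BV cx c] coords(2)[OF B x] by simp
  moreover have "(\<lambda>b. c \<otimes>\<^bsub>K\<^esub> coords B x b) \<in> B \<rightarrow> carrier K" using cx c by auto
  ultimately show ?thesis using coords_unique[OF B _ b] by metis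
qed

lemma lincomb_single:
  assumes "finite B" "B \<subseteq> carrier V" "b \<in> B"
  shows "lincomb (\<lambda>b'. if b = b' then \<one>\<^bsub>K\<^esub> else \<zero>\<^bsub>K\<^esub>) B = b"
proof -
  have bV: "b \<in> carrier V" using assms by auto
  have "lincomb (\<lambda>b'. if b = b' then \<one>\<^bsub>K\<^esub> else \<zero>\<^bsub>K\<^esub>) B = (\<Oplus>\<^bsub>V\<^esub>b'\<in>B. if b = b' then b' else \<zero>\<^bsub>V\<^esub>)"
    unfolding lincomb_def by (rule M.finsum_cong') (use assms in auto)
  also have "\<dots> = b" using M.add.finprod_singleton[OF assms(3,1), of "\<lambda>x. x"] assms by auto
  finally show ?thesis .
qed

lemma coord_pairing_basis:
  assumes B: "finite B" "basis B" and x: "x \<in> carrier V" and b: "b \<in> B"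
  shows "coord_pairing B x b = coords B x b"
proof -
  have BV: "B \<subseteq> carrier V" using B by (simp add: basis_def)
  let ?d = "\<lambda>b'. if b = b' then \<one>\<^bsub>K\<^esub> else \<zero>\<^bsub>K\<^esub>"
  have "coords B b b' = ?d b'" if "b' \<in> B" for b'
    using coords_unique[OF B _ that, of ?d] lincomb_single[OF B(1) BV b] by auto
  then have "coord_pairing B x b = (\<Oplus>\<^bsub>K\<^esub>b'\<in>B. if b = b' then coords B x b' else \<zero>\<^bsub>K\<^esub>)"
    unfolding coord_pairing_def
    using b BV coords(1)[OF B x] by (auto intro!: R.finsum_cong')
  also have "\<dots> = coords B x b"
    using R.add.finprod_singleton[OF b B(1), of "coords B x"] coords(1)[OF B x] by auto
  finally show ?thesis .
qed

lemma functional_lincomb: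
  assumes f: "f \<in> LinearCombinations.module_hom K V (regular_module K)"
    and "finite B" "B \<subseteq> carrier V" "a \<in> B \<rightarrow> carrier K"
  shows "f (lincomb a B) = (\<Oplus>\<^bsub>K\<^esub>b\<in>B. a b \<otimes>\<^bsub>K\<^esub> f b)"
  using assms(2-4)
proof (induction B)
  case empty
  have f0: "f \<zero>\<^bsub>V\<^esub> \<in> carrier K" and fa: "f (\<zero>\<^bsub>V\<^esub> \<oplus>\<^bsub>V\<^esub> \<zero>\<^bsub>V\<^esub>) = f \<zero>\<^bsub>V\<^esub> \<oplus>\<^bsub>K\<^esub> f \<zero>\<^bsub>V\<^esub>"
    using LinearCombinations.module_hom_closed[OF f] LinearCombinations.module_hom_add[OF f, of "\<zero>\<^bsub>V\<^esub>" "\<zero>\<^bsub>V\<^esub>"]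
    by (auto simp: regular_module_def)
  then have "f \<zero>\<^bsub>V\<^esub> = \<zero>\<^bsub>K\<^esub>" by (simp add: R.add.r_cancel_one')
  then show ?case by (simp add: lincomb_def)
next
  case (insert b B)
  have c: "b \<in> carrier V" "B \<subseteq> carrier V" "a b \<in> carrier K" "a \<in> B \<rightarrow> carrier K" using insert by auto
  have fK: "f x \<in> carrier K" if "x \<in> carrier V" for x
    using that LinearCombinations.module_hom_closed[OF f] by (auto simp: regular_module_def)
  have "lincomb a (insert b B) = a b \<odot>\<^bsub>V\<^esub> b \<oplus>\<^bsub>V\<^esub> lincomb a B"
    by (rule lincomb_insert2) (use insert c in auto)
  moreover have "f (a b \<odot>\<^bsub>V\<^esub> b \<oplus>\<^bsub>V\<^esub> lincomb a B) = a b \<otimes>\<^bsub>K\<^esub> f b \<oplus>\<^bsub>K\<^esub> f (lincomb a B)"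
    using LinearCombinations.module_hom_add[OF f, of "a b \<odot>\<^bsub>V\<^esub> b" "lincomb a B"]
      LinearCombinations.module_hom_smult[OF f c(3,1)] c
    by (simp add: regular_module_def smult_closed)
  moreover have "(\<lambda>b. a b \<otimes>\<^bsub>K\<^esub> f b) \<in> B \<rightarrow> carrier K" using c fK by auto
  ultimately show ?case
    using insert c fK by simp
qed

lemma dual_space_simps [simp]:
  "carrier (dual_space K V) = LinearCombinations.module_hom K V (regular_module K) \<inter> extensional (carrier V)"
  "\<zero>\<^bsub>dual_space K V\<^esub> = (\<lambda>x\<in>carrier V. \<zero>\<^bsub>K\<^esub>)"
  "f \<oplus>\<^bsub>dual_space K V\<^esub> g = (\<lambda>x\<in>carrier V. f x \<oplus>\<^bsub>K\<^esub> g x)"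
  "c \<odot>\<^bsub>dual_space K V\<^esub> f = (\<lambda>x\<in>carrier V. c \<otimes>\<^bsub>K\<^esub> f x)"
  by (simp_all add: dual_space_def func_space_def)

text \<open>\<open>T\<close> is given by the pairing \<^const>\<open>vectorspace.coord_pairing\<close>, so it sends a basis to its dual
  basis.\<close>

lemma dual_space_iso:
  assumes fd: "fin_dim"
  obtains T where "bij_betw T (carrier V) (carrier (dual_space K V))"
    "\<And>x y. x \<in> carrier V \<Longrightarrow> y \<in> carrier V \<Longrightarrow> T (x \<oplus>\<^bsub>V\<^esub> y) = T x \<oplus>\<^bsub>dual_space K V\<^esub> T y"
    "\<And>c x. c \<in> carrier K \<Longrightarrow> x \<in> carrier V \<Longrightarrow> T (c \<odot>\<^bsub>V\<^esub> x) = c \<odot>\<^bsub>dual_space K V\<^esub> T x"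
proof -
  obtain B where B: "finite B" "basis B" using finite_basis_exists[OF fd] by blast
  have BV: "B \<subseteq> carrier V" using B by (simp add: basis_def)
  note cK = coords(1)[OF B]
  let ?T = "coord_pairing B"
  have TK: "?T x y \<in> carrier K" if "x \<in> carrier V" "y \<in> carrier V" for x y
    using that cK by (auto simp: coord_pairing_def intro!: R.finsum_closed)
  have ext: "?T x \<in> extensional (carrier V)" for x by (simp add: coord_pairing_def)
  have sym: "?T x y = ?T y x" if "x \<in> carrier V" "y \<in> carrier V" for x y
    using that cK by (auto simp: coord_pairing_def R.m_comm intro!: R.finsum_cong')
  have add: "?T x (y \<oplus>\<^bsub>V\<^esub> z) = ?T x y \<oplus>\<^bsub>K\<^esub> ?T x z"
    if "x \<in> carrier V" "y \<in> carrier V" "z \<in> carrier V" for x y z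
  proof -
    have "?T x (y \<oplus>\<^bsub>V\<^esub> z) = (\<Oplus>\<^bsub>K\<^esub>b\<in>B. coords B x b \<otimes>\<^bsub>K\<^esub> coords B (y \<oplus>\<^bsub>V\<^esub> z) b)"
      using that by (simp add: coord_pairing_def)
    also have "\<dots> = (\<Oplus>\<^bsub>K\<^esub>b\<in>B. coords B x b \<otimes>\<^bsub>K\<^esub> coords B y b \<oplus>\<^bsub>K\<^esub> coords B x b \<otimes>\<^bsub>K\<^esub> coords B z b)"
      by (rule R.finsum_cong') (use that cK coords_add[OF B that(2,3)] in \<open>auto simp: R.r_distr\<close>)
    also have "\<dots> = ?T x y \<oplus>\<^bsub>K\<^esub> ?T x z"
      using that cK by (subst R.finsum_addf) (auto simp: coord_pairing_def)
    finally show ?thesis .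
  qed
  have smult: "?T x (c \<odot>\<^bsub>V\<^esub> y) = c \<otimes>\<^bsub>K\<^esub> ?T x y"
    if "x \<in> carrier V" "y \<in> carrier V" "c \<in> carrier K" for x y c
  proof -
    have "?T x (c \<odot>\<^bsub>V\<^esub> y) = (\<Oplus>\<^bsub>K\<^esub>b\<in>B. c \<otimes>\<^bsub>K\<^esub> (coords B x b \<otimes>\<^bsub>K\<^esub> coords B y b))"
      using that cK coords_smult[OF B that(2,3)]
      by (auto simp: coord_pairing_def R.m_lcomm smult_closed intro!: R.finsum_cong')
    also have "\<dots> = c \<otimes>\<^bsub>K\<^esub> ?T x y"
      using that cK R.finsum_rdistr[OF B(1) that(3), of "\<lambda>b. coords B x b \<otimes>\<^bsub>K\<^esub> coords B y b"]
      by (auto simp: coord_pairing_def)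
    finally show ?thesis .
  qed
  show ?thesis
  proof (rule that)
    show "bij_betw ?T (carrier V) (carrier (dual_space K V))"
      unfolding bij_betw_def
    proof (intro conjI equalityI subsetI)
      show "inj_on ?T (carrier V)"
      proof (rule inj_onI)
        fix x y assume xy: "x \<in> carrier V" "y \<in> carrier V" and eq: "?T x = ?T y"
        have "coords B x b = coords B y b" if "b \<in> B" for b
          using coord_pairing_basis[OF B xy(1) that] coord_pairing_basis[OF B xy(2) that] eq by simp
        then have "lincomb (coords B x) B = lincomb (coords B y) B"
          by (intro lincomb_cong) (use BV cK xy in auto)
        then show "x = y" using coords(2)[OF B] xy by simp
      qed
    next
      fix f assume "f \<in> ?T ` carrier V"
      then obtain x where x: "x \<in> carrier V" "f = ?T x" by blast
      show "f \<in> carrier (dual_space K V)"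
        using x(1) TK add smult unfolding x(2)
        by (auto simp: LinearCombinations.module_hom_def regular_module_def ext)
    next
      fix f assume "f \<in> carrier (dual_space K V)"
      then have f: "f \<in> LinearCombinations.module_hom K V (regular_module K)" "f \<in> extensional (carrier V)"
        by auto
      have fK: "f x \<in> carrier K" if "x \<in> carrier V" for x
        using that LinearCombinations.module_hom_closed[OF f(1)] by (auto simp: regular_module_def)
      have fB: "f \<in> B \<rightarrow> carrier K" using fK BV by auto
      let ?x = "lincomb f B"
      have x: "?x \<in> carrier V" using BV fB by simp
      have "?T ?x y = f y" if y: "y \<in> carrier V" for y
      proof -
        have "?T ?x y = (\<Oplus>\<^bsub>K\<^esub>b\<in>B. coords B y b \<otimes>\<^bsub>K\<^esub> f b)"
          using y cK coords_unique[OF B fB] fB BV fK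
          by (auto simp: coord_pairing_def R.m_comm intro!: R.finsum_cong')
        also have "\<dots> = f (lincomb (coords B y) B)"
          by (rule functional_lincomb[OF f(1) B(1) BV, symmetric]) (use cK y in auto)
        finally show ?thesis using coords(2)[OF B y] by simp
      qed
      then have "?T ?x = f"
        by (intro extensionalityI[OF _ f(2)]) (auto simp: coord_pairing_def)
      moreover have "?T ?x \<in> ?T ` carrier V" using x by (rule imageI)
      ultimately show "f \<in> ?T ` carrier V" by simp
    qed
    fix x y assume xy: "x \<in> carrier V" "y \<in> carrier V"
    show "?T (x \<oplus>\<^bsub>V\<^esub> y) = ?T x \<oplus>\<^bsub>dual_space K V\<^esub> ?T y"
    proof (rule extensionalityI[where A = "carrier V"])
      fix z assume z: "z \<in> carrier V"
      show "?T (x \<oplus>\<^bsub>V\<^esub> y) z = (?T x \<oplus>\<^bsub>dual_space K V\<^esub> ?T y) z"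
        using add[OF z xy] sym[OF z] xy z by simp
    qed (simp_all add: coord_pairing_def)
  next
    fix c x assume cx: "c \<in> carrier K" "x \<in> carrier V"
    show "?T (c \<odot>\<^bsub>V\<^esub> x) = c \<odot>\<^bsub>dual_space K V\<^esub> ?T x"
    proof (rule extensionalityI[where A = "carrier V"])
      fix z assume z: "z \<in> carrier V"
      show "?T (c \<odot>\<^bsub>V\<^esub> x) z = (c \<odot>\<^bsub>dual_space K V\<^esub> ?T x) z"
        using smult[OF z cx(2,1)] sym[OF z] cx z by (simp add: smult_closed)
    qed (simp_all add: coord_pairing_def)
  qed
qed

end

text \<open>\<open>W\<close> inherits the axioms of a vector space from \<open>V\<close> through \<open>T\<close>, which saves verifying them
  for the pieces of the trivial extension.\<close>

lemma dim_transport: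
  assumes V: "vectorspace K V" and fd: "vectorspace.fin_dim K V"
    and T: "bij_betw T (carrier V) (carrier W)"
    "\<And>x y. x \<in> carrier V \<Longrightarrow> y \<in> carrier V \<Longrightarrow> T (x \<oplus>\<^bsub>V\<^esub> y) = T x \<oplus>\<^bsub>W\<^esub> T y"
    "\<And>c x. c \<in> carrier K \<Longrightarrow> x \<in> carrier V \<Longrightarrow> T (c \<odot>\<^bsub>V\<^esub> x) = c \<odot>\<^bsub>W\<^esub> T x"
    "T \<zero>\<^bsub>V\<^esub> = \<zero>\<^bsub>W\<^esub>"
  shows "vectorspace.dim K W = vectorspace.dim K V"
proof -
  interpret V: vectorspace K V by (rule V)
  have c: "carrier W = T ` carrier V" using T(1) by (simp add: bij_betw_def)
  have neg: "T x \<oplus>\<^bsub>W\<^esub> T (\<ominus>\<^bsub>V\<^esub> x) = \<zero>\<^bsub>W\<^esub>" if "x \<in> carrier V" for x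
    using T(2)[of x "\<ominus>\<^bsub>V\<^esub> x"] T(4) that by (simp add: V.M.r_neg)
  have "Module.module K W"
  proof (rule module_criteria)
    show "cring K" by (rule V.R.is_cring)
    show "\<zero>\<^bsub>W\<^esub> \<in> carrier W" unfolding c T(4)[symmetric] by simp
    show "\<forall>v\<in>carrier W. \<exists>w\<in>carrier W. v \<oplus>\<^bsub>W\<^esub> w = \<zero>\<^bsub>W\<^esub>"
      unfolding c using neg by (metis V.M.a_inv_closed imageE imageI)
    show "\<forall>v\<in>carrier W. v \<oplus>\<^bsub>W\<^esub> \<zero>\<^bsub>W\<^esub> = v"
      unfolding c T(4)[symmetric] by (auto simp: T(2)[symmetric])
  qed (auto simp: c T(2)[symmetric] T(3)[symmetric] V.M.a_ac V.smult_closed V.smult_assoc1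
      V.smult_l_distr V.smult_r_distr)
  then have W: "vectorspace K W" by (simp add: vectorspace_def V.field_axioms)
  show ?thesis by (rule dim_eq_of_bijection[OF V W fd T(1-3), symmetric])
qed

section \<open>Graded pieces of the trivial extension\<close>

lemma trivial_extension_simps [simp]:
  "x \<oplus>\<^bsub>trivial_extension K A\<^esub> y = (fst x \<oplus>\<^bsub>A\<^esub> fst y, snd x \<oplus>\<^bsub>dual_space K A\<^esub> snd y)"
  "c \<odot>\<^bsub>trivial_extension K A\<^esub> x = (c \<odot>\<^bsub>A\<^esub> fst x, c \<odot>\<^bsub>dual_space K A\<^esub> snd x)"
  "\<zero>\<^bsub>trivial_extension K A\<^esub> = (\<zero>\<^bsub>A\<^esub>, \<zero>\<^bsub>dual_space K A\<^esub>)"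
  "(a, f) \<otimes>\<^bsub>trivial_extension K A\<^esub> (b, g) = (a \<otimes>\<^bsub>A\<^esub> b,
    (\<lambda>x\<in>carrier A. g (x \<otimes>\<^bsub>A\<^esub> a)) \<oplus>\<^bsub>dual_space K A\<^esub> (\<lambda>x\<in>carrier A. f (b \<otimes>\<^bsub>A\<^esub> x)))"
  by (simp_all add: trivial_extension_def direct_sum_def)

context fin_dim_algebra
begin

lemma functional_closed:
  "f \<in> carrier (dual_space K A) \<Longrightarrow> x \<in> carrier A \<Longrightarrow> f x \<in> carrier K"
  by (auto simp: LinearCombinations.module_hom_def regular_module_def)

lemma trivial_extension_sandwich:
  assumes c: "u \<in> carrier A" "v \<in> carrier A" "a \<in> carrier A" and f: "f \<in> carrier (dual_space K A)"
  shows "(u, \<zero>\<^bsub>dual_space K A\<^esub>) \<otimes>\<^bsub>trivial_extension K A\<^esub> (a, f) \<otimes>\<^bsub>trivial_extension K A\<^esub> (v, \<zero>\<^bsub>dual_space K A\<^esub>) =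
    (u \<otimes> a \<otimes> v, \<lambda>x\<in>carrier A. f (v \<otimes> x \<otimes> u))"
proof -
  have fc: "f x \<in> carrier K" if "x \<in> carrier A" for x by (rule functional_closed[OF f that])
  show ?thesis
    using c by (auto simp: fc fun_eq_iff restrict_def)
qed

lemma zero_functional: "\<zero>\<^bsub>dual_space K A\<^esub> \<in> carrier (dual_space K A)"
  by (auto simp: LinearCombinations.module_hom_def regular_module_def smult_closed)

lemma peirce_dim_degree_0:
  assumes uv: "idempotent_elem A u" "idempotent_elem A v"
  shows "peirce_dim K (trivial_extension K A) (u, \<zero>\<^bsub>dual_space K A\<^esub>)
      (trivial_extension_grading K A 0) (v, \<zero>\<^bsub>dual_space K A\<^esub>) = peirce_dim K A u (carrier A) v"
proof -
  let ?L = "trivial_extension K A" and ?z = "\<zero>\<^bsub>dual_space K A\<^esub>"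
  have c: "u \<in> carrier A" "v \<in> carrier A" using uv by (auto simp: idempotent_elem_def)
  let ?Y = "(\<lambda>x. u \<otimes> x \<otimes> v) ` carrier A"
  note sub = peirce_subspace[OF c]
  have YA: "y \<in> carrier A" if "y \<in> ?Y" for y using that c by auto
  have "(u, ?z) \<otimes>\<^bsub>?L\<^esub> (a, ?z) \<otimes>\<^bsub>?L\<^esub> (v, ?z) = (u \<otimes> a \<otimes> v, ?z)" if "a \<in> carrier A" for a
    using trivial_extension_sandwich[OF c that zero_functional] c by (auto simp: fun_eq_iff restrict_def)
  then have im: "(\<lambda>x. (u, ?z) \<otimes>\<^bsub>?L\<^esub> x \<otimes>\<^bsub>?L\<^esub> (v, ?z)) ` (trivial_extension_grading K A 0) = (\<lambda>y. (y, ?z)) ` ?Y"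
    unfolding trivial_extension_grading_def image_image by (force simp del: dual_space_simps trivial_extension_simps)
  have "vectorspace.dim K (?L\<lparr>carrier := (\<lambda>y. (y, ?z)) ` ?Y\<rparr>) = vectorspace.dim K (A\<lparr>carrier := ?Y\<rparr>)"
  proof (rule dim_transport[where T = "\<lambda>y. (y, ?z)"])
    show "vectorspace K (A\<lparr>carrier := ?Y\<rparr>)" by (rule subspace_is_vs[OF sub])
    show "vectorspace.fin_dim K (A\<lparr>carrier := ?Y\<rparr>)" by (rule subspace_fin_dim(1)[OF fin_dim sub])
    show "bij_betw (\<lambda>y. (y, ?z)) (carrier (A\<lparr>carrier := ?Y\<rparr>)) (carrier (?L\<lparr>carrier := (\<lambda>y. (y, ?z)) ` ?Y\<rparr>))"
      by (auto simp: bij_betw_def inj_on_def)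
  qed (auto simp: fun_eq_iff restrict_def)
  then show ?thesis unfolding peirce_dim_def im .
qed

lemma functional_sandwich:
  assumes c: "u \<in> carrier A" "v \<in> carrier A"
    and g: "g \<in> carrier (dual_space K (A\<lparr>carrier := (\<lambda>x. v \<otimes> x \<otimes> u) ` carrier A\<rparr>))"
  shows "(\<lambda>x\<in>carrier A. g (v \<otimes> x \<otimes> u)) \<in> carrier (dual_space K A)"
proof -
  let ?Y = "(\<lambda>x. v \<otimes> x \<otimes> u) ` carrier A"
  interpret Y: vectorspace K "A\<lparr>carrier := ?Y\<rparr>" by (rule subspace_is_vs[OF peirce_subspace[OF c(2,1)]])
  have g': "g \<in> LinearCombinations.module_hom K (A\<lparr>carrier := ?Y\<rparr>) (regular_module K)" using g by simp
  have gK: "g y \<in> carrier K" if "y \<in> ?Y" for y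
    using LinearCombinations.module_hom_closed[OF g'] that by (auto simp: regular_module_def)
  have YI: "v \<otimes> x \<otimes> u \<in> ?Y" if "x \<in> carrier A" for x using that by blast
  have gadd: "g (y \<oplus> z) = g y \<oplus>\<^bsub>K\<^esub> g z" if "y \<in> ?Y" "z \<in> ?Y" for y z
    using LinearCombinations.module_hom_add[OF g', of y z] that by (simp add: regular_module_def)
  have gsm: "g (k \<odot> y) = k \<otimes>\<^bsub>K\<^esub> g y" if "y \<in> ?Y" "k \<in> carrier K" for y k
    using LinearCombinations.module_hom_smult[OF g', of k y] that by (simp add: regular_module_def)
  show ?thesis
    unfolding dual_space_simps LinearCombinations.module_hom_def
  proof (intro IntI CollectI conjI allI impI)
    show "(\<lambda>x\<in>carrier A. g (v \<otimes> x \<otimes> u)) \<in> carrier A \<rightarrow> carrier (regular_module K)"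
      using gK[OF YI] by (auto simp: regular_module_def)
  next
    fix x y assume "x \<in> carrier A \<and> y \<in> carrier A"
    then have xy: "x \<in> carrier A" "y \<in> carrier A" by auto
    have "v \<otimes> (x \<oplus> y) \<otimes> u = v \<otimes> x \<otimes> u \<oplus> v \<otimes> y \<otimes> u"
      using xy c by (simp add: alg.r_distr alg.l_distr)
    then show "(\<lambda>x\<in>carrier A. g (v \<otimes> x \<otimes> u)) (x \<oplus> y) =
        (\<lambda>x\<in>carrier A. g (v \<otimes> x \<otimes> u)) x \<oplus>\<^bsub>regular_module K\<^esub> (\<lambda>x\<in>carrier A. g (v \<otimes> x \<otimes> u)) y"
      using xy gadd[OF YI[OF xy(1)] YI[OF xy(2)]] by (simp add: regular_module_def)
  next
    fix k x assume "k \<in> carrier K \<and> x \<in> carrier A"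
    then have kx: "k \<in> carrier K" "x \<in> carrier A" by auto
    have "v \<otimes> (k \<odot> x) \<otimes> u = k \<odot> (v \<otimes> x \<otimes> u)"
      using kx c by (simp add: smult_mult_left smult_mult_right)
    then show "(\<lambda>x\<in>carrier A. g (v \<otimes> x \<otimes> u)) (k \<odot> x) =
        k \<odot>\<^bsub>regular_module K\<^esub> (\<lambda>x\<in>carrier A. g (v \<otimes> x \<otimes> u)) x"
      using kx gsm[OF YI[OF kx(2)] kx(1)] by (simp add: regular_module_def smult_closed)
  qed simp
qed

text \<open>\<open>u (DA) v\<close> consists of the functionals that factor through \<open>x \<mapsto> v x u\<close>, so it is the dual of
  \<open>v A u\<close>.\<close>

lemma peirce_dim_degree_1:
  assumes uv: "idempotent_elem A u" "idempotent_elem A v"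
  shows "peirce_dim K (trivial_extension K A) (u, \<zero>\<^bsub>dual_space K A\<^esub>)
      (trivial_extension_grading K A 1) (v, \<zero>\<^bsub>dual_space K A\<^esub>) = peirce_dim K A v (carrier A) u"
proof -
  let ?L = "trivial_extension K A" and ?z = "\<zero>\<^bsub>dual_space K A\<^esub>"
  have c: "u \<in> carrier A" "v \<in> carrier A" and i: "u \<otimes> u = u" "v \<otimes> v = v"
    using uv by (auto simp: idempotent_elem_def)
  let ?Y = "(\<lambda>x. v \<otimes> x \<otimes> u) ` carrier A"
  let ?VY = "A\<lparr>carrier := ?Y\<rparr>"
  note sub = peirce_subspace[OF c(2,1)]
  interpret Y: vectorspace K ?VY by (rule subspace_is_vs[OF sub])
  have fdY: "Y.fin_dim" by (rule subspace_fin_dim(1)[OF fin_dim sub])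
  have YI: "v \<otimes> x \<otimes> u \<in> ?Y" if "x \<in> carrier A" for x using that by blast
  have YA: "y \<in> carrier A" "v \<otimes> y \<otimes> u = y" if "y \<in> ?Y" for y
  proof -
    obtain x where x: "x \<in> carrier A" "y = v \<otimes> x \<otimes> u" using \<open>y \<in> ?Y\<close> by blast
    show "y \<in> carrier A" using x c by simp
    have "v \<otimes> (v \<otimes> x \<otimes> u) \<otimes> u = (v \<otimes> v) \<otimes> x \<otimes> (u \<otimes> u)" using x(1) c by (simp add: alg.m_assoc)
    then show "v \<otimes> y \<otimes> u = y" using x i by simp
  qed
  obtain T where T: "bij_betw T ?Y (carrier (dual_space K ?VY))"
    and Tadd: "\<And>x y. x \<in> ?Y \<Longrightarrow> y \<in> ?Y \<Longrightarrow> T (x \<oplus> y) = (\<lambda>z\<in>?Y. T x z \<oplus>\<^bsub>K\<^esub> T y z)"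
    and Tsm: "\<And>k x. k \<in> carrier K \<Longrightarrow> x \<in> ?Y \<Longrightarrow> T (k \<odot> x) = (\<lambda>z\<in>?Y. k \<otimes>\<^bsub>K\<^esub> T x z)"
    by (rule Y.dual_space_iso[OF fdY]) simp
  define S where "S y = (\<zero>, \<lambda>x\<in>carrier A. T y (v \<otimes> x \<otimes> u))" for y
  let ?I = "(\<lambda>x. (u, ?z) \<otimes>\<^bsub>?L\<^esub> x \<otimes>\<^bsub>?L\<^esub> (v, ?z)) ` (trivial_extension_grading K A 1)"
  have im: "?I = (\<lambda>f. (\<zero>, \<lambda>x\<in>carrier A. f (v \<otimes> x \<otimes> u))) ` carrier (dual_space K A)"
  proof -
    have "(u, ?z) \<otimes>\<^bsub>?L\<^esub> (\<zero>, f) \<otimes>\<^bsub>?L\<^esub> (v, ?z) = (\<zero>, \<lambda>x\<in>carrier A. f (v \<otimes> x \<otimes> u))"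
      if "f \<in> carrier (dual_space K A)" for f
      using trivial_extension_sandwich[OF c M.zero_closed that] c by simp
    then show ?thesis
      unfolding trivial_extension_grading_def by (force simp del: dual_space_simps trivial_extension_simps)
  qed
  have TD: "T y \<in> carrier (dual_space K ?VY)" if "y \<in> ?Y" for y
    using T that by (auto simp: bij_betw_def)
  have "vectorspace.dim K (?L\<lparr>carrier := ?I\<rparr>) = vectorspace.dim K ?VY"
  proof (rule dim_transport[where T = S])
    show "vectorspace K ?VY" by (rule Y.vectorspace_axioms)
    show "vectorspace.fin_dim K ?VY" by (rule fdY)
    show "bij_betw S (carrier ?VY) (carrier (?L\<lparr>carrier := ?I\<rparr>))"
      unfolding bij_betw_def
    proof
      show "inj_on S (carrier ?VY)"
      proof (rule inj_onI)
        fix y y' assume yy: "y \<in> carrier ?VY" "y' \<in> carrier ?VY" and eq: "S y = S y'"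
        have "T y = T y'"
        proof (rule extensionalityI[where A = ?Y])
          show "T y \<in> extensional ?Y" "T y' \<in> extensional ?Y" using TD[of y] TD[of y'] yy by simp_all
          fix z assume z: "z \<in> ?Y"
          have "(\<lambda>x\<in>carrier A. T y (v \<otimes> x \<otimes> u)) z = (\<lambda>x\<in>carrier A. T y' (v \<otimes> x \<otimes> u)) z"
            using eq by (simp add: S_def)
          then show "T y z = T y' z" using YA[OF z] by simp
        qed
        then show "y = y'" using T yy by (auto simp: bij_betw_def dest: inj_onD)
      qed
      show "S ` carrier ?VY = carrier (?L\<lparr>carrier := ?I\<rparr>)"
      proof
        show "S ` carrier ?VY \<subseteq> carrier (?L\<lparr>carrier := ?I\<rparr>)"
        proof
          fix p assume "p \<in> S ` carrier ?VY"
          then obtain y where y: "y \<in> ?Y" "p = S y" by auto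
          let ?f = "\<lambda>x\<in>carrier A. T y (v \<otimes> x \<otimes> u)"
          have f: "?f \<in> carrier (dual_space K A)" by (rule functional_sandwich[OF c TD[OF y(1)]])
          have "?f (v \<otimes> x \<otimes> u) = T y (v \<otimes> x \<otimes> u)" if "x \<in> carrier A" for x
            using YA[OF YI[OF that]] by simp
          then have "p = (\<zero>, \<lambda>x\<in>carrier A. ?f (v \<otimes> x \<otimes> u))"
            unfolding y(2) S_def by (auto simp: fun_eq_iff restrict_def)
          then have "p \<in> ?I" unfolding im using f by (rule image_eqI)
          then show "p \<in> carrier (?L\<lparr>carrier := ?I\<rparr>)" by simp
        qed
        show "carrier (?L\<lparr>carrier := ?I\<rparr>) \<subseteq> S ` carrier ?VY"
        proof
          fix p assume "p \<in> carrier (?L\<lparr>carrier := ?I\<rparr>)"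
          then have "p \<in> ?I" by simp
          then obtain f where f: "f \<in> carrier (dual_space K A)" "p = (\<zero>, \<lambda>x\<in>carrier A. f (v \<otimes> x \<otimes> u))"
            unfolding im by blast
          have fh: "f \<in> LinearCombinations.module_hom K A (regular_module K)" using f(1) by simp
          have sm: "submodule K ?Y A" using sub by (simp add: VectorSpace.subspace_def)
          have "restrict f ?Y \<in> LinearCombinations.module_hom K ?VY (regular_module K)"
            unfolding LinearCombinations.module_hom_def
          proof (intro CollectI conjI allI impI)
            show "restrict f ?Y \<in> carrier ?VY \<rightarrow> carrier (regular_module K)"
            proof
              fix y assume "y \<in> carrier ?VY"
              then have "y \<in> ?Y" by simp
              then show "restrict f ?Y y \<in> carrier (regular_module K)"
                using functional_closed[OF f(1) YA(1)] by (simp only: restrict_apply') (simp add: regular_module_def)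
            qed
          next
            fix x y assume "x \<in> carrier ?VY \<and> y \<in> carrier ?VY"
            then have xy: "x \<in> ?Y" "y \<in> ?Y" by simp_all
            have "f (x \<oplus> y) = f x \<oplus>\<^bsub>regular_module K\<^esub> f y"
              by (rule LinearCombinations.module_hom_add[OF fh YA(1)[OF xy(1)] YA(1)[OF xy(2)]])
            then show "restrict f ?Y (x \<oplus>\<^bsub>?VY\<^esub> y) =
                restrict f ?Y x \<oplus>\<^bsub>regular_module K\<^esub> restrict f ?Y y"
              using xy submodule.m_closed[OF sm xy] by (simp only: restrict_apply') simp
          next
            fix k x assume "k \<in> carrier K \<and> x \<in> carrier ?VY"
            then have kx: "k \<in> carrier K" "x \<in> ?Y" by simp_all
            have "f (k \<odot> x) = k \<odot>\<^bsub>regular_module K\<^esub> f x"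
              by (rule LinearCombinations.module_hom_smult[OF fh kx(1) YA(1)[OF kx(2)]])
            then show "restrict f ?Y (k \<odot>\<^bsub>?VY\<^esub> x) = k \<odot>\<^bsub>regular_module K\<^esub> restrict f ?Y x"
              using kx submodule.smult_closed[OF sm kx] by (simp only: restrict_apply') simp
          qed
          then have "restrict f ?Y \<in> carrier (dual_space K ?VY)" by simp
          then have "restrict f ?Y \<in> T ` ?Y" unfolding bij_betw_imp_surj_on[OF T] .
          then obtain y where y: "y \<in> ?Y" "restrict f ?Y = T y" by (rule imageE) simp
          have "T y (v \<otimes> x \<otimes> u) = f (v \<otimes> x \<otimes> u)" if "x \<in> carrier A" for x
            using y(2) YI[OF that] by (metis restrict_apply')
          then have "S y = p" unfolding f(2) S_def by (auto simp: fun_eq_iff restrict_def)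
          then show "p \<in> S ` carrier ?VY" using y(1) by auto
        qed
      qed
    qed
    show "S (x \<oplus>\<^bsub>?VY\<^esub> y) = S x \<oplus>\<^bsub>?L\<lparr>carrier := ?I\<rparr>\<^esub> S y" if "x \<in> carrier ?VY" "y \<in> carrier ?VY" for x y
      using that Tadd[of x y] YI by (auto simp: S_def fun_eq_iff restrict_def)
    show Ssm: "S (k \<odot>\<^bsub>?VY\<^esub> x) = k \<odot>\<^bsub>?L\<lparr>carrier := ?I\<rparr>\<^esub> S x" if "k \<in> carrier K" "x \<in> carrier ?VY" for k x
      using that Tsm[of k x] YI by (auto simp: S_def fun_eq_iff restrict_def)
    have z: "\<zero> \<in> ?Y" using Y.M.zero_closed by simp
    have T0: "T \<zero> = (\<lambda>y\<in>?Y. \<zero>\<^bsub>K\<^esub> \<otimes>\<^bsub>K\<^esub> T \<zero> y)" using Tsm[OF R.zero_closed z] by simp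
    have TK: "T \<zero> y \<in> carrier K" if "y \<in> ?Y" for y
      using TD[OF z] that by (auto simp: LinearCombinations.module_hom_def regular_module_def)
    have "T \<zero> y = \<zero>\<^bsub>K\<^esub>" if "y \<in> ?Y" for y
      using fun_cong[OF T0, of y] that TK[OF that] by (simp only: restrict_apply' R.l_null)
    then show "S \<zero>\<^bsub>?VY\<^esub> = \<zero>\<^bsub>?L\<lparr>carrier := ?I\<rparr>\<^esub>" using YI by (auto simp: S_def fun_eq_iff restrict_def)
  qed
  then show ?thesis unfolding peirce_dim_def .
qed

text \<open>In matrix form this is \<open>C + x C\<^sup>T\<close>. Degrees \<open>0\<close> and \<open>1\<close> are both present when there is an
  idempotent \<open>e\<^sub>i\<close> at all, as then \<open>A\<close> and \<open>DA\<close> are nonzero.\<close>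

lemma graded_cartan_trivial_extension:
  assumes ce: "complete_primitive_idempotents A n e"
  shows "graded_cartan_mat K (trivial_extension K A) (trivial_extension_grading K A) n
      (\<lambda>i. (e i, \<zero>\<^bsub>dual_space K A\<^esub>)) =
    mat n n (\<lambda>(i, j). [: cartan_mat K A n e $$ (i, j), cartan_mat K A n e $$ (j, i) :])"
proof (rule eq_matI)
  fix i j
  assume "i < dim_row (mat n n (\<lambda>(i, j). [: cartan_mat K A n e $$ (i, j), cartan_mat K A n e $$ (j, i) :]))"
    "j < dim_col (mat n n (\<lambda>(i, j). [: cartan_mat K A n e $$ (i, j), cartan_mat K A n e $$ (j, i) :]))"
  then have ij: "i < n" "j < n" by simp_all
  let ?\<Lambda> = "trivial_extension_grading K A" and ?L = "trivial_extension K A"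
  let ?E = "\<lambda>i. (e i, \<zero>\<^bsub>dual_space K A\<^esub>)"
  have ei: "e i \<in> carrier A" "e i \<noteq> \<zero>"
    using ce ij by (auto simp: complete_primitive_idempotents_def primitive_idempotent_def idempotent_elem_def)
  have "?\<Lambda> 0 \<noteq> {\<zero>\<^bsub>?L\<^esub>}" using ei by (auto simp: trivial_extension_grading_def)
  moreover have "?\<Lambda> 1 \<noteq> {\<zero>\<^bsub>?L\<^esub>}"
  proof
    assume "?\<Lambda> 1 = {\<zero>\<^bsub>?L\<^esub>}"
    then have one: "carrier (dual_space K A) = {\<zero>\<^bsub>dual_space K A\<^esub>}"
      by (auto simp: trivial_extension_grading_def simp del: dual_space_simps)
    obtain T where T: "bij_betw T (carrier A) (carrier (dual_space K A))"
      by (rule dual_space_iso[OF fin_dim])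
    have "T (e i) = T \<zero>"
      using bij_betw_apply[OF T ei(1)] bij_betw_apply[OF T M.zero_closed] 
      unfolding one singleton_iff by (rule trans[OF _ sym])
    then have "e i = \<zero>" by (rule inj_onD[OF bij_betw_imp_inj_on[OF T] _ ei(1) M.zero_closed])
    then show False using ei by simp
  qed
  moreover have "?\<Lambda> k = {\<zero>\<^bsub>?L\<^esub>}" if "k \<noteq> 0" "k \<noteq> 1" for k
    using that by (simp add: trivial_extension_grading_def)
  ultimately have "{k. ?\<Lambda> k \<noteq> {\<zero>\<^bsub>?L\<^esub>}} = {0, 1}" by blast
  then have "graded_cartan_mat K ?L ?\<Lambda> n ?E $$ (i, j) =
      (\<Sum>k\<in>{0, 1}. monom (of_nat (peirce_dim K ?L (?E i) (?\<Lambda> k) (?E j))) k)"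
    using ij by (simp add: graded_cartan_mat_def del: trivial_extension_simps dual_space_simps)
  also have "\<dots> = monom (cartan_mat K A n e $$ (i, j)) 0 + monom (cartan_mat K A n e $$ (j, i)) 1"
    using ij peirce_dim_degree_0[OF complete_idempotentsD(2)[OF ce ij(1)] complete_idempotentsD(2)[OF ce ij(2)]]
      peirce_dim_degree_1[OF complete_idempotentsD(2)[OF ce ij(1)] complete_idempotentsD(2)[OF ce ij(2)]]
    by (simp add: cartan_mat_def del: trivial_extension_simps dual_space_simps)
  also have "\<dots> = [: cartan_mat K A n e $$ (i, j), cartan_mat K A n e $$ (j, i) :]"
    by (simp add: monom_0 monom_Suc)
  finally show "graded_cartan_mat K ?L ?\<Lambda> n ?E $$ (i, j) =
      mat n n (\<lambda>(i, j). [: cartan_mat K A n e $$ (i, j), cartan_mat K A n e $$ (j, i) :]) $$ (i, j)"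
    using ij by simp
qed (simp_all add: graded_cartan_mat_def)

lemma cartan_mat_det_nonzero:
  assumes b: "basic_algebra A n e" and gl: "gl_dim A < \<infinity>"
  shows "det (cartan_mat K A n e) \<noteq> 0"
proof
  let ?C = "cartan_mat K A n e"
  have C: "?C \<in> carrier_mat n n" by (simp add: cartan_mat_def)
  assume "det ?C = 0"
  then have "det (transpose_mat ?C) = 0" using det_transpose[OF C] by simp
  moreover have Ct: "transpose_mat ?C \<in> carrier_mat n n" using C by simp
  ultimately obtain w where w: "w \<in> carrier_vec n" "w \<noteq> 0\<^sub>v n" "transpose_mat ?C *\<^sub>v w = 0\<^sub>v n"
    using det_0_iff_vec_prod_zero_field[OF Ct] by blast
  have s: "(\<Sum>j<n. w $ j * of_nat (peirce_dim K A (e j) (carrier A) (e k))) = 0" if k: "k < n" for k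
  proof -
    have "0 = (transpose_mat ?C *\<^sub>v w) $ k" using w k by simp
    also have "\<dots> = (\<Sum>j<n. w $ j * of_nat (peirce_dim K A (e j) (carrier A) (e k)))"
      using k w(1) by (simp add: cartan_mat_def scalar_prod_def mult.commute lessThan_atLeast0)
    finally show ?thesis by simp
  qed
  have "w $ k = 0" if "k < n" for k
    by (rule cartan_rows_independent[OF b gl s that])
  then have "w = 0\<^sub>v n" using w(1) by (intro eq_vecI) auto
  then show False using w(2) by simp
qed

end

section \<open>The determinant identity\<close>

text \<open>The transpose of \<open>C + x C\<^sup>T\<close> is \<open>x C + C\<^sup>T = (x I + C\<^sup>T C\<^sup>-\<^sup>1) C\<close>.\<close>

lemma det_pencil_coxeter:
  fixes C :: "'a :: field mat"
  assumes C: "C \<in> carrier_mat n n" and d: "det C \<noteq> 0"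
  shows "det (mat n n (\<lambda>(i, j). [: C $$ (i, j), C $$ (j, i) :])) =
    char_poly (- (transpose_mat C * the (mat_inverse C))) * [:det C:]"
proof -
  obtain X where inv: "mat_inverse C = Some X"
    using det_non_zero_imp_unit[OF C d, of undefined] mat_inverse(1)[OF C] by fastforce
  then have X: "X \<in> carrier_mat n n" "X * C = 1\<^sub>m n" using mat_inverse(2)[OF C] by auto
  interpret h: comm_ring_hom "\<lambda>a :: 'a. [:a:]"
    by unfold_locales (simp_all add: one_pCons)
  let ?h = "map_mat (\<lambda>a :: 'a. [:a:])"
  let ?P = "transpose_mat C * X"
  have P: "?P \<in> carrier_mat n n" and Ct: "transpose_mat C \<in> carrier_mat n n" using C X by simp_all
  have hC: "?h C \<in> carrier_mat n n" and hP: "?h ?P \<in> carrier_mat n n" using C P by simp_all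
  have cp: "char_poly_matrix (- ?P) = [:0, 1:] \<cdot>\<^sub>m 1\<^sub>m n + ?h ?P"
    unfolding char_poly_matrix_def by (rule eq_matI) (use P in auto)
  have one: "[:0, 1:] \<cdot>\<^sub>m 1\<^sub>m n \<in> carrier_mat n n" by simp
  have "([:0, 1:] \<cdot>\<^sub>m 1\<^sub>m n + ?h ?P) * ?h C = [:0, 1:] \<cdot>\<^sub>m 1\<^sub>m n * ?h C + ?h ?P * ?h C"
    by (rule add_mult_distrib_mat[OF one hP hC])
  also have "[:0, 1:] \<cdot>\<^sub>m 1\<^sub>m n * ?h C = [:0, 1:] \<cdot>\<^sub>m ?h C"
    using mult_smult_assoc_mat[of "1\<^sub>m n" n n "?h C" n "[:0, 1:]"] hC by simp
  also have "?h ?P * ?h C = ?h (?P * C)" by (rule h.mat_hom_mult[OF P C, symmetric])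
  also have "?P * C = transpose_mat C" using assoc_mult_mat[OF Ct X(1) C] X(2) Ct by simp
  also have "[:0, 1:] \<cdot>\<^sub>m ?h C + ?h (transpose_mat C) =
      transpose_mat (mat n n (\<lambda>(i, j). [: C $$ (i, j), C $$ (j, i) :]))"
    by (rule eq_matI) (use C in auto)
  finally have eq: "char_poly_matrix (- ?P) * ?h C =
      transpose_mat (mat n n (\<lambda>(i, j). [: C $$ (i, j), C $$ (j, i) :]))" unfolding cp .
  have "det (mat n n (\<lambda>(i, j). [: C $$ (i, j), C $$ (j, i) :])) = det (char_poly_matrix (- ?P) * ?h C)"
    unfolding eq by (rule det_transpose[symmetric, of _ n]) simp
  also have "\<dots> = det (char_poly_matrix (- ?P)) * det (?h C)"
    by (rule det_mult[of _ n]) (use P C in auto)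
  finally show ?thesis by (simp add: char_poly_def inv)
qed

theorem proposition1p6:
  fixes K :: "'k ring" and A :: "('k, 'a) module" and n :: nat and e :: "nat \<Rightarrow> 'a"
  assumes "fin_dim_algebra K A"
    and "basic_algebra A n e"
    and "gl_dim A < \<infinity>"
  shows "det (graded_cartan_mat K (trivial_extension K A) (trivial_extension_grading K A) n
            (\<lambda>i. (e i, \<zero>\<^bsub>dual_space K A\<^esub>)))
       = coxeter_poly K A n e * [:det (cartan_mat K A n e):]"
proof -
  interpret fin_dim_algebra K A by fact
  have ce: "complete_primitive_idempotents A n e" using assms(2) by (simp add: basic_algebra_def)
  have C: "cartan_mat K A n e \<in> carrier_mat n n" by (simp add: cartan_mat_def)
  show ?thesis
    unfolding graded_cartan_trivial_extension[OF ce] coxeter_poly_def coxeter_mat_def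
    by (rule det_pencil_coxeter[OF C cartan_mat_det_nonzero[OF assms(2,3)]])
qed

end
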